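(* Let $N\ge2$, let $\mathcal{N}$ be a norm on $\mathbb{R}^N$, $\alpha\in[1,2)$ and $c>0$. Let $$\mathcal{W}=\{x\in\mathbb{R}^N:\langle x,p\rangle\le c\,\Phi_\alpha(p)\ \text{for all }p\in\mathbb{S}^{N-1}\}.$$ Then there exists $R=R(\alpha,c,N,\mathcal{N})>0$ such that if $\varepsilon>0$ and $\Omega_0\subset\mathbb{R}^N$ is open, bounded and contains $B_R$, then for some $T>0$ and for each $t\ge T$, $$\{x\in\mathcal{W}:\operatorname{dist}(x,\partial\mathcal{W})>\varepsilon\}\subset t^{-1}O_t(\Omega_0)\quad\text{and}\quad t^{-1}X_t(\overline{\Omega}_0)\subset\{x\in\mathbb{R}^N:\operatorname{dist}(x,\mathcal{W})<\varepsilon\},$$ where $(X_t(\overline{\Omega}_0),O_t(\Omega_0))_{t\ge0}$ is the generalized evolution corresponding to $$\partial_tu=\mu_\alpha(Du)\big(F_\alpha(D^2u,Du)+c|Du|\big)\quad\text{in }\mathbb{R}^N\times(0,+\infty).$$ In particular, $t^{-1}\big(X_t(\overline{\Omega}_0)\setminus O_t(\Omega_0)\big)\to\partial\mathcal{W}$ in the Hausdorff distance as $t\to+\infty$.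
   Context: $B_R$ is the open Euclidean ball of radius $R$ centered at $0$; $\operatorname{dist}$ is Euclidean distance. $P_\alpha(x)=\frac{1}{1+\mathcal{N}(x)^{N+\alpha}}$. For $p\in\mathbb{R}^N\setminus\{0\}$ and a symmetric $N\times N$ matrix $M$, with $p^\perp=\{x:\langle x,p\rangle=0\}$: $\mu_\alpha(p)=\Big(2\int_{p^\perp}P_\alpha\,d\mathcal{H}^{N-1}\Big)^{-1}$; $\Phi_\alpha(p)=\mu_\alpha(p)|p|$ (a norm on $\mathbb{R}^N$, with $\Phi_\alpha(0)=0$); $F_\alpha(M,p)=\operatorname{tr}(M\mathcal{A}(p/|p|))$, $\mathcal{A}(p/|p|)=C_{N,\alpha}\int_{\mathbb{S}^{N-1}\cap p^\perp}\theta\otimes\theta\,\frac{d\mathcal{H}^{N-2}(\theta)}{\mathcal{N}(\theta)^{N+1}}$, with $C_{N,\alpha}=\int_0^{+\infty}\frac{t^N}{1+t^{N+\alpha}}dt$ if $\alpha\in(1,2)$ and $C_{N,1}=1$. Viscosity solutions. A locally bounded upper semicontinuous $u:\mathbb{R}^N\times[0,+\infty)\to\mathbb{R}$ is a viscosity subsolution if, whenever $\varphi\in C^2(\mathbb{R}^N\times(0,+\infty))$ and $u-\varphi$ has a maximum at $(x_0,t_0)$, $t_0>0$, then at $(x_0,t_0)$: $\partial_t\varphi\le\mu_\alpha(D\varphi)(F_\alpha(D^2\varphi,D\varphi)+c|D\varphi|)$ if $D\varphi\ne0$, and $\partial_t\varphi\le0$ if $D\varphi=0$ and $D^2\varphi=0$.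 Supersolutions are defined symmetrically (lower semicontinuous, minimum, reversed inequalities). A viscosity solution is a continuous function that is both. The paper takes as known that for uniformly continuous initial data there is a unique viscosity solution. Generalized evolution. Let $u_0:\mathbb{R}^N\to\mathbb{R}$ be uniformly continuous with $\Omega_0=\{u_0>0\}$ and $\Gamma_0=\{u_0=0\}$ (here $\Gamma_0=\partial\Omega_0$, so $\Omega_0\cup\Gamma_0=\overline{\Omega}_0$), and let $u$ be the viscosity solution with $u(\cdot,0)=u_0$. With $\Omega_t=\{u(\cdot,t)>0\}$ and $\Gamma_t=\{u(\cdot,t)=0\}$, set $X_t(\Omega_0\cup\Gamma_0)=\Omega_t\cup\Gamma_t$ and $O_t(\Omega_0)=\Omega_t$. *)

theory Defs
  imports "HOL-Analysis.Analysis"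
begin

text \<open>
  The dimension is \<open>N = CARD('n)\<close>.  A function of space and time is a function on
  \<^typ>\<open>(real^'n) \<times> real\<close>; functions on \<open>\<real>\<^sup>N \<times> [0,\<infinity>)\<close> are only ever evaluated at
  nonnegative times.
\<close>

definition is_norm :: "('a::real_vector \<Rightarrow> real) \<Rightarrow> bool" where
  "is_norm \<N> \<longleftrightarrow>
     (\<forall>x. 0 \<le> \<N> x) \<and> (\<forall>x. \<N> x = 0 \<longleftrightarrow> x = 0) \<and>
     (\<forall>a x. \<N> (a *\<^sub>R x) = \<bar>a\<bar> * \<N> x) \<and> (\<forall>x y. \<N> (x + y) \<le> \<N> x + \<N> y)"

section \<open>Hausdorff measure\<close>

text \<open>
  The normalisation by \<^const>\<open>unit_ball_vol\<close> makes the \<open>k\<close>-dimensional Hausdorff measure agree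
  with \<open>k\<close>-dimensional surface measure, and with counting measure for \<open>k = 0\<close>: the empty set is
  charged \<open>0\<close> and, as \<open>0 ^ 0 = 1\<close>, a singleton is charged \<open>1\<close>.
  Boundedness is required because \<^const>\<open>diameter\<close> is meaningless on unbounded sets.
\<close>

definition hausdorff_gauge :: "nat \<Rightarrow> 'a::metric_space set \<Rightarrow> ennreal" where
  "hausdorff_gauge k C =
     (if C = {} then 0 else ennreal (unit_ball_vol (real k) * (diameter C / 2) ^ k))"

definition hausdorff_pre_measure :: "nat \<Rightarrow> real \<Rightarrow> 'a::metric_space set \<Rightarrow> ennreal" where
  "hausdorff_pre_measure k \<delta> A =
     (INF C \<in> {C :: nat \<Rightarrow> 'a set.
                 A \<subseteq> (\<Union>i. C i) \<and> (\<forall>i. bounded (C i) \<and> diameter (C i) \<le> \<delta>)}.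
        \<Sum>i. hausdorff_gauge k (C i))"

definition hausdorff_outer_measure :: "nat \<Rightarrow> 'a::metric_space set \<Rightarrow> ennreal" where
  "hausdorff_outer_measure k A = (SUP \<delta> \<in> {0<..}. hausdorff_pre_measure k \<delta> A)"

text \<open>
  The outer measure is a metric outer measure, hence countably additive on the Borel sets, so that
  \<^const>\<open>measure_of\<close> returns its restriction to them.
\<close>

definition hausdorff_measure :: "nat \<Rightarrow> 'a::metric_space measure" where
  "hausdorff_measure k = measure_of UNIV (sets borel) (hausdorff_outer_measure k)"

section \<open>Hausdorff distance\<close>

text \<open>Taken in \<^typ>\<open>ennreal\<close>, it is \<open>\<infinity>\<close> if exactly one of the sets is empty.\<close>

definition hausdorff_distance :: "'a::metric_space set \<Rightarrow> 'a set \<Rightarrow> ennreal" where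
  "hausdorff_distance A B =
     (INF r \<in> {r::real. 0 \<le> r \<and> (\<forall>x\<in>A. \<exists>y\<in>B. dist x y \<le> r) \<and> (\<forall>y\<in>B. \<exists>x\<in>A. dist x y \<le> r)}.
        ennreal r)"

section \<open>The geometric operator\<close>

definition P\<alpha> :: "(real^'n \<Rightarrow> real) \<Rightarrow> real \<Rightarrow> real^'n \<Rightarrow> real" where
  "P\<alpha> \<N> \<alpha> x = 1 / (1 + \<N> x powr (real CARD('n) + \<alpha>))"

definition orth_hyperplane :: "real^'n \<Rightarrow> (real^'n) set" where
  "orth_hyperplane p = {x. x \<bullet> p = 0}"

definition \<mu>\<alpha> :: "(real^'n \<Rightarrow> real) \<Rightarrow> real \<Rightarrow> real^'n \<Rightarrow> real" where
  "\<mu>\<alpha> \<N> \<alpha> p =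
     inverse (2 * (LINT x : orth_hyperplane p | hausdorff_measure (CARD('n) - 1). P\<alpha> \<N> \<alpha> x))"

definition \<Phi>\<alpha> :: "(real^'n \<Rightarrow> real) \<Rightarrow> real \<Rightarrow> real^'n \<Rightarrow> real" where
  "\<Phi>\<alpha> \<N> \<alpha> p = (if p = 0 then 0 else \<mu>\<alpha> \<N> \<alpha> p * norm p)"

definition C_const :: "nat \<Rightarrow> real \<Rightarrow> real" where
  "C_const N \<alpha> =
     (if \<alpha> = 1 then 1 else (LINT t : {0..} | lborel. t ^ N / (1 + t powr (real N + \<alpha>))))"

definition tensor_square :: "real^'n \<Rightarrow> real^'n^'n" where
  "tensor_square \<theta> = (\<chi> i j. \<theta> $ i * \<theta> $ j)"

definition A_matrix :: "(real^'n \<Rightarrow> real) \<Rightarrow> real \<Rightarrow> real^'n \<Rightarrow> real^'n^'n" where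
  "A_matrix \<N> \<alpha> e =
     C_const CARD('n) \<alpha> *\<^sub>R
       (LINT \<theta> : sphere 0 1 \<inter> orth_hyperplane e | hausdorff_measure (CARD('n) - 2).
          (1 / \<N> \<theta> ^ (CARD('n) + 1)) *\<^sub>R tensor_square \<theta>)"

definition F\<alpha> :: "(real^'n \<Rightarrow> real) \<Rightarrow> real \<Rightarrow> real^'n^'n \<Rightarrow> real^'n \<Rightarrow> real" where
  "F\<alpha> \<N> \<alpha> M p = trace (M ** A_matrix \<N> \<alpha> (p /\<^sub>R norm p))"

definition Wulff_shape :: "(real^'n \<Rightarrow> real) \<Rightarrow> real \<Rightarrow> real \<Rightarrow> (real^'n) set" where
  "Wulff_shape \<N> \<alpha> c = {x. \<forall>p \<in> sphere 0 1. x \<bullet> p \<le> c * \<Phi>\<alpha> \<N> \<alpha> p}"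

section \<open>Viscosity solutions\<close>

definition C2_on :: "'a::real_normed_vector set \<Rightarrow> ('a \<Rightarrow> real) \<Rightarrow> bool" where
  "C2_on S f \<longleftrightarrow>
     (\<exists>(f' :: 'a \<Rightarrow> 'a \<Rightarrow>\<^sub>L real) (f'' :: 'a \<Rightarrow> 'a \<Rightarrow>\<^sub>L ('a \<Rightarrow>\<^sub>L real)).
        (\<forall>z\<in>S. (f has_derivative blinfun_apply (f' z)) (at z)) \<and>
        (\<forall>z\<in>S. (f' has_derivative blinfun_apply (f'' z)) (at z)) \<and>
        continuous_on S f'')"

definition time_deriv :: "((real^'n) \<times> real \<Rightarrow> real) \<Rightarrow> (real^'n) \<times> real \<Rightarrow> real" where
  "time_deriv \<phi> z = frechet_derivative \<phi> (at z) (0, 1)"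

definition space_grad :: "((real^'n) \<times> real \<Rightarrow> real) \<Rightarrow> (real^'n) \<times> real \<Rightarrow> real^'n" where
  "space_grad \<phi> z = (\<chi> i. frechet_derivative \<phi> (at z) (axis i 1, 0))"

definition space_hess :: "((real^'n) \<times> real \<Rightarrow> real) \<Rightarrow> (real^'n) \<times> real \<Rightarrow> real^'n^'n" where
  "space_hess \<phi> z =
     (\<chi> i j. frechet_derivative (\<lambda>w. space_grad \<phi> w $ j) (at z) (axis i 1, 0))"

definition usc_on :: "'a::topological_space set \<Rightarrow> ('a \<Rightarrow> real) \<Rightarrow> bool" where
  "usc_on S u \<longleftrightarrow> (\<forall>z\<in>S. \<forall>a > u z. \<forall>\<^sub>F w in at z within S. u w < a)"

definition lsc_on :: "'a::topological_space set \<Rightarrow> ('a \<Rightarrow> real) \<Rightarrow> bool" where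
  "lsc_on S u \<longleftrightarrow> (\<forall>z\<in>S. \<forall>a < u z. \<forall>\<^sub>F w in at z within S. a < u w)"

definition locally_bounded_on :: "'a::metric_space set \<Rightarrow> ('a \<Rightarrow> real) \<Rightarrow> bool" where
  "locally_bounded_on S u \<longleftrightarrow> (\<forall>z\<in>S. \<exists>r>0. bounded (u ` (ball z r \<inter> S)))"

abbreviation closed_halfspace :: "((real^'n) \<times> real) set" where
  "closed_halfspace \<equiv> UNIV \<times> {0..}"

abbreviation open_halfspace :: "((real^'n) \<times> real) set" where
  "open_halfspace \<equiv> UNIV \<times> {0<..}"

definition viscosity_subsolution ::
    "(real^'n \<Rightarrow> real) \<Rightarrow> real \<Rightarrow> real \<Rightarrow> ((real^'n) \<times> real \<Rightarrow> real) \<Rightarrow> bool" where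
  "viscosity_subsolution \<N> \<alpha> c u \<longleftrightarrow>
     locally_bounded_on closed_halfspace u \<and> usc_on closed_halfspace u \<and>
     (\<forall>\<phi>. \<forall>z \<in> open_halfspace.
        C2_on open_halfspace \<phi> \<and> (\<forall>w \<in> open_halfspace. u w - \<phi> w \<le> u z - \<phi> z) \<longrightarrow>
        (space_grad \<phi> z \<noteq> 0 \<longrightarrow>
           time_deriv \<phi> z \<le> \<mu>\<alpha> \<N> \<alpha> (space_grad \<phi> z) *
             (F\<alpha> \<N> \<alpha> (space_hess \<phi> z) (space_grad \<phi> z) + c * norm (space_grad \<phi> z))) \<and>
        (space_grad \<phi> z = 0 \<and> space_hess \<phi> z = 0 \<longrightarrow> time_deriv \<phi> z \<le> 0))"

definition viscosity_supersolution ::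
    "(real^'n \<Rightarrow> real) \<Rightarrow> real \<Rightarrow> real \<Rightarrow> ((real^'n) \<times> real \<Rightarrow> real) \<Rightarrow> bool" where
  "viscosity_supersolution \<N> \<alpha> c u \<longleftrightarrow>
     locally_bounded_on closed_halfspace u \<and> lsc_on closed_halfspace u \<and>
     (\<forall>\<phi>. \<forall>z \<in> open_halfspace.
        C2_on open_halfspace \<phi> \<and> (\<forall>w \<in> open_halfspace. u w - \<phi> w \<ge> u z - \<phi> z) \<longrightarrow>
        (space_grad \<phi> z \<noteq> 0 \<longrightarrow>
           time_deriv \<phi> z \<ge> \<mu>\<alpha> \<N> \<alpha> (space_grad \<phi> z) *
             (F\<alpha> \<N> \<alpha> (space_hess \<phi> z) (space_grad \<phi> z) + c * norm (space_grad \<phi> z))) \<and>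
        (space_grad \<phi> z = 0 \<and> space_hess \<phi> z = 0 \<longrightarrow> time_deriv \<phi> z \<ge> 0))"

definition viscosity_solution ::
    "(real^'n \<Rightarrow> real) \<Rightarrow> real \<Rightarrow> real \<Rightarrow> ((real^'n) \<times> real \<Rightarrow> real) \<Rightarrow> bool" where
  "viscosity_solution \<N> \<alpha> c u \<longleftrightarrow>
     continuous_on closed_halfspace u \<and>
     viscosity_subsolution \<N> \<alpha> c u \<and> viscosity_supersolution \<N> \<alpha> c u"

section \<open>Generalized evolution\<close>

text \<open>
  \<open>Xs t\<close> and \<open>Os t\<close> stand for \<open>X\<^sub>t(\<Omega>\<^sub>0 \<union> \<Gamma>\<^sub>0)\<close> and \<open>O\<^sub>t(\<Omega>\<^sub>0)\<close>.  The predicate determines them for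
  \<open>t \<ge> 0\<close>, by uniqueness of viscosity solutions and their independence of the function \<open>u\<^sub>0\<close>
  representing \<open>\<Omega>\<^sub>0\<close>.
\<close>

definition generalized_evolution ::
    "(real^'n \<Rightarrow> real) \<Rightarrow> real \<Rightarrow> real \<Rightarrow> (real^'n) set \<Rightarrow>
     (real \<Rightarrow> (real^'n) set) \<Rightarrow> (real \<Rightarrow> (real^'n) set) \<Rightarrow> bool" where
  "generalized_evolution \<N> \<alpha> c \<Omega>0 Xs Os \<longleftrightarrow>
     (\<exists>u0 u. uniformly_continuous_on UNIV u0 \<and>
        \<Omega>0 = {x. u0 x > 0} \<and> frontier \<Omega>0 = {x. u0 x = 0} \<and>
        viscosity_solution \<N> \<alpha> c u \<and> (\<forall>x. u (x, 0) = u0 x) \<and>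
        (\<forall>t\<ge>0. Xs t = {x. u (x, t) > 0} \<union> {x. u (x, t) = 0} \<and> Os t = {x. u (x, t) > 0}))"

end

theory Submission
  imports Defs
begin

text \<open>
  All comparisons are made with explicit smooth barriers \<open>\<psi>\<close> that are quadratic in space, so that neither a general
  comparison principle nor any regularity of the shape \<open>W\<close> is needed. Large shrinking balls keep the set
  \<open>{u \<ge> 0}\<close> in a bounded region, and then the half-space \<open>{x. x \<bullet> p \<le> c \<mu>(p) t + R}\<close>, which moves exactly with the speed prescribed
  by the equation, is a barrier in each direction \<open>p\<close>; intersecting over \<open>p\<close> gives the upper bound \<open>t W\<close>. For the lower bound, a
  ball of radius \<open>R\<close> that travels with velocity \<open>(1 - \<delta>) w\<close>, \<open>w \<in> W\<close>, is a subflow as soon as \<open>R\<close> is large compared to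
  \<open>1 / \<delta>\<close>, because \<open>w \<bullet> p \<le> c \<mu>(p)\<close> for every normal \<open>p\<close>. The only facts needed about the coefficients are
  that \<open>\<mu>\<close> lies between two positive constants, that the trace of \<open>A\<close> is bounded, and that \<open>A(e) e = 0\<close>; they
  follow from packing and covering estimates for the Hausdorff measure of hyperplanes and of their unit spheres.
\<close>

section \<open>The Hausdorff measure on the Borel sets\<close>

text \<open>The radius \<open>R\<close> may depend neither on \<open>\<epsilon>\<close> nor on the
  initial set, so it cannot be of order \<open>1 / \<delta>\<close> from the start. Hence the
  travelling ball begins with a fixed radius, above \<open>2 * C / c\<close>, at which curvature
  uses up at most half of the forcing; the radius then grows linearly at a small rate, and at each
  time the speed is lowered by just what curvature costs. The lost distance is an integral of
  \<open>C / (c * R t)\<close>, thus logarithmic in time, and disappears after division by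
  \<open>t\<close>. The time \<open>T\<close> must serve all functions that represent the same
  initial set, so it is computed from radii of balls inside and around that set and never from the
  size of \<open>u\<close>. As \<open>u\<close> is only known to be continuous, its growth at
  infinity is arbitrary, and a test function that touches it globally has to be built from bounds on
  \<open>u\<close> itself. \<open>measure_of\<close> yields the zero measure unless countable
  additivity is established, and with \<open>inverse 0 = 0\<close> the mobility would then vanish;
  this is why Caratheodory's theorem precedes every bound on the coefficients.\<close>

lemma hausdorff_gauge_empty [simp]: "hausdorff_gauge k {} = 0"
  by (simp add: hausdorff_gauge_def)

section \<open>Premeasures of mesh \<open>\<delta>\<close> and the metric outer measure\<close>

lemma hausdorff_pre_measure_le:
  assumes "A \<subseteq> (\<Union>i. C i)" "\<And>i. bounded (C i)" "\<And>i. diameter (C i) \<le> \<delta>"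
  shows "hausdorff_pre_measure k \<delta> A \<le> (\<Sum>i. hausdorff_gauge k (C i))"
  unfolding hausdorff_pre_measure_def using assms by (intro INF_lower) auto

lemma hausdorff_pre_measure_mono: "A \<subseteq> B \<Longrightarrow> hausdorff_pre_measure k \<delta> A \<le> hausdorff_pre_measure k \<delta> B"
  unfolding hausdorff_pre_measure_def by (rule INF_superset_mono) auto

lemma hausdorff_pre_measure_antimono:
  "\<delta> \<le> \<delta>' \<Longrightarrow> hausdorff_pre_measure k \<delta>' A \<le> hausdorff_pre_measure k \<delta> A"
  unfolding hausdorff_pre_measure_def by (rule INF_superset_mono) (auto intro: order_trans)

lemma hausdorff_pre_measure_empty: "0 \<le> \<delta> \<Longrightarrow> hausdorff_pre_measure k \<delta> {} = 0"
  using hausdorff_pre_measure_le[of "{}" "\<lambda>_. {}" \<delta> k] by (simp add: diameter_def)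

text \<open>Each \<open>A i\<close> gets a cover that is optimal up to
  \<open>e / 2 ^ (i + 1)\<close>, and \<open>prod_decode\<close> lists all covering sets as one
  sequence. \<open>ennreal_le_epsilon\<close> supplies the finiteness without which a strictly
  near-optimal cover could fail to exist.\<close>

lemma hausdorff_pre_measure_countably_subadditive:
  fixes A :: "nat \<Rightarrow> 'a::metric_space set"
  shows "hausdorff_pre_measure k \<delta> (\<Union>i. A i) \<le> (\<Sum>i. hausdorff_pre_measure k \<delta> (A i))"
proof (rule ennreal_le_epsilon)
  fix e :: real assume fin: "(\<Sum>i. hausdorff_pre_measure k \<delta> (A i)) < top" and e: "0 < e"
  define h where "h i = ennreal (e * (1/2) ^ Suc i)" for i
  have h0: "0 < h i" for i
    using e by (simp add: h_def)
  have "hausdorff_pre_measure k \<delta> (A i) < top" for i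
  proof -
    have "hausdorff_pre_measure k \<delta> (A i) \<le> (\<Sum>i. hausdorff_pre_measure k \<delta> (A i))"
      using sum_le_suminf[of "\<lambda>i. hausdorff_pre_measure k \<delta> (A i)" "{i}"] by auto
    with fin show ?thesis by (simp add: order.strict_trans1)
  qed
  then have "hausdorff_pre_measure k \<delta> (A i) < hausdorff_pre_measure k \<delta> (A i) + h i" for i
    using h0[of i] ennreal_add_left_cancel_less[of "hausdorff_pre_measure k \<delta> (A i)" 0 "h i"]
    by (auto simp: less_top)
  then have "\<exists>C. A i \<subseteq> (\<Union>j. C j) \<and> (\<forall>j. bounded (C j) \<and> diameter (C j) \<le> \<delta>) \<and>
      (\<Sum>j. hausdorff_gauge k (C j)) < hausdorff_pre_measure k \<delta> (A i) + h i" for i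
    unfolding hausdorff_pre_measure_def by (subst (asm) INF_less_iff) auto
  then obtain C where C: "\<And>i. A i \<subseteq> (\<Union>j. C i j)" "\<And>i j. bounded (C i j)" "\<And>i j. diameter (C i j) \<le> \<delta>"
      "\<And>i. (\<Sum>j. hausdorff_gauge k (C i j)) < hausdorff_pre_measure k \<delta> (A i) + h i"
    by metis
  define D where "D n = (case prod_decode n of (i, j) \<Rightarrow> C i j)" for n
  have "hausdorff_pre_measure k \<delta> (\<Union>i. A i) \<le> (\<Sum>n. hausdorff_gauge k (D n))"
  proof (rule hausdorff_pre_measure_le)
    show "(\<Union>i. A i) \<subseteq> (\<Union>n. D n)"
    proof
      fix x assume "x \<in> (\<Union>i. A i)"
      then obtain i j where "x \<in> C i j" using C(1) by blast
      then have "x \<in> D (prod_encode (i, j))" by (simp add: D_def)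
      then show "x \<in> (\<Union>n. D n)" by blast
    qed
  qed (auto simp: D_def C split: prod.split)
  also have "\<dots> = (\<Sum>i. \<Sum>j. hausdorff_gauge k (C i j))"
    using suminf_ennreal_2dimen[of "\<lambda>i. \<Sum>j. hausdorff_gauge k (C i j)" "\<lambda>(i,j). hausdorff_gauge k (C i j)"]
    by (simp add: D_def split_beta)
  also have "\<dots> \<le> (\<Sum>i. hausdorff_pre_measure k \<delta> (A i) + h i)"
    using C(4) by (intro suminf_le) (auto intro: less_imp_le)
  also have "\<dots> = (\<Sum>i. hausdorff_pre_measure k \<delta> (A i)) + (\<Sum>i. h i)"
    by (rule suminf_add[symmetric]) auto
  also have "(\<Sum>i. h i) = ennreal e"
    unfolding h_def using e sums_mult[OF power_half_series, of e]
    by (intro suminf_ennreal_eq) auto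
  finally show "hausdorff_pre_measure k \<delta> (\<Union>i. A i) \<le> (\<Sum>i. hausdorff_pre_measure k \<delta> (A i)) + ennreal e" .
qed

lemma hausdorff_pre_measure_le_outer:
  "0 < \<delta> \<Longrightarrow> hausdorff_pre_measure k \<delta> A \<le> hausdorff_outer_measure k A"
  unfolding hausdorff_outer_measure_def by (intro SUP_upper) auto

lemma outer_measure_space_hausdorff:
  "outer_measure_space UNIV (hausdorff_outer_measure k :: 'a::metric_space set \<Rightarrow> _)"
proof -
  have "hausdorff_outer_measure k (\<Union>i. A i) \<le> (\<Sum>i. hausdorff_outer_measure k (A i))" for A :: "nat \<Rightarrow> 'a set"
    unfolding hausdorff_outer_measure_def[of k "\<Union>i. A i"]
  proof (rule SUP_least)
    fix \<delta> :: real assume "\<delta> \<in> {0<..}"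
    then show "hausdorff_pre_measure k \<delta> (\<Union>i. A i) \<le> (\<Sum>i. hausdorff_outer_measure k (A i))"
      by (intro order_trans[OF hausdorff_pre_measure_countably_subadditive] suminf_le
          hausdorff_pre_measure_le_outer) auto
  qed
  moreover have "hausdorff_outer_measure k A \<le> hausdorff_outer_measure k B" if "A \<subseteq> B" for A B :: "'a set"
    unfolding hausdorff_outer_measure_def
    by (rule SUP_mono) (auto intro: hausdorff_pre_measure_mono[OF that])
  moreover have "hausdorff_outer_measure k ({} :: 'a set) = 0"
    unfolding hausdorff_outer_measure_def
    by (intro SUP_eq_const) (auto simp: hausdorff_pre_measure_empty)
  ultimately show ?thesis
    by (auto simp: outer_measure_space_def positive_def increasing_def countably_subadditive_def)
qed

text \<open>A set of diameter below \<open>d\<close> cannot meet both \<open>A\<close> and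
  \<open>B\<close>, so a fine cover of the union splits into a cover of \<open>A\<close> and a cover
  of \<open>B\<close> of no larger total cost.\<close>

lemma hausdorff_outer_measure_separated:
  fixes A B :: "'a::metric_space set"
  assumes d: "0 < d" and AB: "\<And>x y. x \<in> A \<Longrightarrow> y \<in> B \<Longrightarrow> d \<le> dist x y"
  shows "hausdorff_outer_measure k A + hausdorff_outer_measure k B \<le> hausdorff_outer_measure k (A \<union> B)"
proof -
  have *: "hausdorff_pre_measure k \<delta> A + hausdorff_pre_measure k \<delta> B \<le> hausdorff_pre_measure k \<delta> (A \<union> B)"
    if \<delta>: "0 < \<delta>" "\<delta> < d" for \<delta>
    unfolding hausdorff_pre_measure_def[of k \<delta> "A \<union> B"]
  proof (rule INF_greatest)
    fix C :: "nat \<Rightarrow> 'a set"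
    assume C: "C \<in> {C. A \<union> B \<subseteq> (\<Union>i. C i) \<and> (\<forall>i. bounded (C i) \<and> diameter (C i) \<le> \<delta>)}"
    define D where "D S i = (if C i \<inter> S = {} then {} else C i)" for S i
    have D: "hausdorff_pre_measure k \<delta> S \<le> (\<Sum>i. hausdorff_gauge k (D S i))" if "S \<subseteq> A \<union> B" for S
    proof (rule hausdorff_pre_measure_le)
      show "S \<subseteq> (\<Union>i. D S i)" using that C by (fastforce simp: D_def)
    qed (use C \<delta> in \<open>auto simp: D_def\<close>)
    have "hausdorff_gauge k (D A i) + hausdorff_gauge k (D B i) \<le> hausdorff_gauge k (C i)" for i
    proof -
      have "C i \<inter> A = {} \<or> C i \<inter> B = {}"
      proof (rule ccontr)
        assume "\<not> ?thesis"
        then obtain x y where "x \<in> C i" "x \<in> A" "y \<in> C i" "y \<in> B" by blast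
        moreover have "dist x y \<le> diameter (C i)"
          using C \<open>x \<in> C i\<close> \<open>y \<in> C i\<close> by (intro diameter_bounded_bound) auto
        moreover have "diameter (C i) \<le> \<delta>" using C by auto
        ultimately show False using AB[of x y] \<delta> by linarith
      qed
      then show ?thesis by (auto simp: D_def)
    qed
    then have "(\<Sum>i. hausdorff_gauge k (D A i)) + (\<Sum>i. hausdorff_gauge k (D B i)) \<le> (\<Sum>i. hausdorff_gauge k (C i))"
      by (subst suminf_add) (auto intro!: suminf_le)
    with D[of A] D[of B] show "hausdorff_pre_measure k \<delta> A + hausdorff_pre_measure k \<delta> B \<le> (\<Sum>i. hausdorff_gauge k (C i))"
      by (meson add_mono order_trans sup_ge1 sup_ge2)
  qed
  \<comment> \<open>The two mesh sizes are independent because a sum of two suprema is a double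
    supremum; both are lowered to a common mesh below \<open>d\<close>.\<close>
  have **: "hausdorff_pre_measure k i A + hausdorff_pre_measure k j B \<le> hausdorff_outer_measure k (A \<union> B)"
    if "0 < i" "0 < j" for i j
  proof -
    define \<delta> where "\<delta> = min (min i j) (d/2)"
    have \<delta>: "0 < \<delta>" "\<delta> < d" "\<delta> \<le> i" "\<delta> \<le> j" using d that by (auto simp: \<delta>_def)
    have "hausdorff_pre_measure k i A + hausdorff_pre_measure k j B
       \<le> hausdorff_pre_measure k \<delta> A + hausdorff_pre_measure k \<delta> B"
      using \<delta> by (intro add_mono hausdorff_pre_measure_antimono)
    also have "\<dots> \<le> hausdorff_pre_measure k \<delta> (A \<union> B)" using * \<delta> by blast
    also have "\<dots> \<le> hausdorff_outer_measure k (A \<union> B)" using \<delta> by (intro hausdorff_pre_measure_le_outer)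
    finally show ?thesis .
  qed
  have ne: "{0::real<..} \<noteq> {}" by auto
  have "hausdorff_outer_measure k A + hausdorff_outer_measure k B
      = (SUP i\<in>{0<..}. SUP j\<in>{0<..}. hausdorff_pre_measure k i A + hausdorff_pre_measure k j B)"
    unfolding hausdorff_outer_measure_def
    by (simp only: ennreal_SUP_add_left[OF ne, symmetric] ennreal_SUP_add_right[OF ne, symmetric])
  also have "\<dots> \<le> hausdorff_outer_measure k (A \<union> B)" by (intro SUP_least) (auto intro: **)
  finally show ?thesis .
qed

text \<open>Caratheodory's criterion: the shells at distance between \<open>1/(n+2)\<close> and \<open>1/(n+1)\<close> from a closed
  set are separated from each other if their indices differ by at least two, so their measures are summable.\<close>

lemma closed_in_lambda_system:
  fixes \<nu> :: "'a::metric_space set \<Rightarrow> ennreal"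
  assumes oms: "outer_measure_space UNIV \<nu>"
    and sep: "\<And>A B d. 0 < d \<Longrightarrow> (\<And>x y. x \<in> A \<Longrightarrow> y \<in> B \<Longrightarrow> d \<le> dist x y) \<Longrightarrow> \<nu> A + \<nu> B \<le> \<nu> (A \<union> B)"
    and F: "closed F"
  shows "F \<in> lambda_system UNIV UNIV \<nu>"
proof -
  have mono: "A \<subseteq> B \<Longrightarrow> \<nu> A \<le> \<nu> B" for A B
    using oms by (auto simp: outer_measure_space_def increasing_def)
  have empty: "\<nu> {} = 0" using oms by (auto simp: outer_measure_space_def positive_def)
  have sub: "\<nu> (A \<union> B) \<le> \<nu> A + \<nu> B" for A B
  proof -
    have "subadditive UNIV \<nu>"
      using oms ring_of_sets.countably_subadditive_subadditive[OF ring_of_sets_Pow, of UNIV \<nu>]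
      by (auto simp: outer_measure_space_def)
    have "\<nu> (A \<union> (B - A)) \<le> \<nu> A + \<nu> (B - A)"
      by (rule subadditiveD[OF \<open>subadditive UNIV \<nu>\<close>]) auto
    with mono[of "B - A" B] show ?thesis by (metis Diff_subset Un_Diff_cancel add_left_mono order_trans)
  qed
  \<comment> \<open>Countable subadditivity of an outer measure speaks of disjoint families only;
    passing to \<open>disjointed A\<close> removes this restriction.\<close>
  have csub: "\<nu> (\<Union>i. A i) \<le> (\<Sum>i. \<nu> (A i))" for A :: "nat \<Rightarrow> 'a set"
  proof -
    have "\<nu> (\<Union>i. disjointed A i) \<le> (\<Sum>i. \<nu> (disjointed A i))"
      using oms disjoint_family_disjointed[of A] by (simp add: outer_measure_space_def countably_subadditive_def)
    also have "\<dots> \<le> (\<Sum>i. \<nu> (A i))" by (intro suminf_le mono disjointed_subset) auto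
    finally show ?thesis by (simp add: UN_disjointed_eq)
  qed
  have key: "\<nu> (A \<inter> F) + \<nu> (A - F) \<le> \<nu> A" for A
  proof (cases "F = {} \<or> \<nu> A = top")
    case True then show ?thesis by (auto simp: empty)
  next
    case False
    then have Fne: "F \<noteq> {}" and fin: "\<nu> A \<noteq> top" by auto
    define f where "f x = infdist x F" for x
    have f0: "f x = 0 \<longleftrightarrow> x \<in> F" for x unfolding f_def using in_closed_iff_infdist_zero[OF F Fne] by simp
    have fge: "0 \<le> f x" for x by (simp add: f_def infdist_nonneg)
    have flip: "f x \<le> f y + dist x y" for x y unfolding f_def by (rule infdist_triangle)
    define r where "r n = 1 / (real n + 1)" for n
    have r: "0 < r n" "r (Suc n) < r n" for n by (auto simp: r_def field_simps)
    have rm: "m \<le> n \<Longrightarrow> r n \<le> r m" for m n by (auto simp: r_def field_simps)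
    define B where "B n = {x\<in>A. r (Suc n) \<le> f x \<and> f x < r n}" for n
    define a where "a n = \<nu> (B n)" for n
    have alt: "(\<Sum>i<n. a (2*i+j)) \<le> \<nu> (\<Union>i<n. B (2*i+j))" for n j
    proof (induction n)
      case (Suc n)
      have "(\<Sum>i<Suc n. a (2*i+j)) \<le> \<nu> (\<Union>i<n. B (2*i+j)) + \<nu> (B (2*n+j))"
        using Suc by (simp add: a_def add_right_mono)
      also have "\<dots> \<le> \<nu> ((\<Union>i<n. B (2*i+j)) \<union> B (2*n+j))"
      proof (rule sep)
        \<comment> \<open>For \<open>n = 0\<close> the union is empty and any positive gap will do.
          The other expression can be 0 there, because natural subtraction gives
          \<open>0 - 1 = 0\<close>.\<close>
        show "0 < (if n = 0 then 1 else r (2*n+j-1) - r (2*n+j))"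
          using r(2)[of "2*n+j-1"] by auto
        fix x y assume x: "x \<in> (\<Union>i<n. B (2*i+j))" and y: "y \<in> B (2*n+j)"
        then obtain i where i: "i < n" "r (Suc (2*i+j)) \<le> f x" by (auto simp: B_def)
        then have "r (2*n+j-1) \<le> f x" using rm[of "Suc (2*i+j)" "2*n+j-1"] by linarith
        moreover have "f y < r (2*n+j)" using y by (simp add: B_def)
        ultimately show "(if n = 0 then 1 else r (2*n+j-1) - r (2*n+j)) \<le> dist x y"
          using flip[of x y] i by auto
      qed
      finally show ?case by (simp add: lessThan_Suc Un_commute)
    qed (simp add: empty)
    have alt': "(\<Sum>i<n. a (2*i+j)) \<le> \<nu> A" for n j
      by (rule order_trans[OF alt mono]) (auto simp: B_def)
    have "(\<Sum>i<n. a i) \<le> \<nu> A + \<nu> A" for n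
    proof -
      have "(\<Sum>i<n. a i) \<le> (\<Sum>i<2*n. a i)" by (rule sum_mono2) auto
      also have "\<dots> = (\<Sum>i<n. a (2*i+0)) + (\<Sum>i<n. a (2*i+1))"
        by (induction n) (auto simp: algebra_simps)
      also have "\<dots> \<le> \<nu> A + \<nu> A" by (rule add_mono[OF alt' alt'])
      finally show ?thesis .
    qed
    then have "suminf a \<le> \<nu> A + \<nu> A" by (intro suminf_le_const) auto
    then have afin: "suminf a \<noteq> top" using fin by (auto simp: top_unique)
    \<comment> \<open>The head of the series stands on the left and the whole series on the right,
      so the tail never has to be subtracted; in the limit the finite value \<open>suminf a\<close>
      cancels.\<close>
    have "(\<Sum>i<n. a i) + (\<nu> (A \<inter> F) + \<nu> (A - F)) \<le> \<nu> A + suminf a" for n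
    proof -
      have "A - F \<subseteq> {x\<in>A. r n \<le> f x} \<union> (\<Union>i. B (i+n))"
      proof
        fix x assume x: "x \<in> A - F"
        then have "0 < f x" using f0[of x] fge[of x] by auto
        then obtain m where "inverse (real (Suc m)) < f x" using reals_Archimedean by blast
        then have m: "r m \<le> f x" by (simp add: r_def inverse_eq_divide add.commute)
        define k where "k = (LEAST k. r k \<le> f x)"
        have k: "r k \<le> f x" unfolding k_def using m by (rule LeastI)
        show "x \<in> {x\<in>A. r n \<le> f x} \<union> (\<Union>i. B (i+n))"
        proof (cases "k \<le> n")
          case True then show ?thesis using x k rm[of k n] by auto
        next
          case False
          then have "\<not> r (k-1) \<le> f x" unfolding k_def
            by (intro not_less_Least) (auto simp: k_def[symmetric])
          then have "x \<in> B ((k-1-n)+n)" using x k False by (auto simp: B_def)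
          then show ?thesis by blast
        qed
      qed
      then have q: "\<nu> (A - F) \<le> \<nu> {x\<in>A. r n \<le> f x} + (\<Sum>i. a (i+n))"
        unfolding a_def
        using order_trans[OF mono order_trans[OF sub add_left_mono[OF csub[of "\<lambda>i. B (i+n)"]]]] by blast
      have p: "\<nu> (A \<inter> F) + \<nu> {x\<in>A. r n \<le> f x} \<le> \<nu> A"
      proof (rule order_trans[OF sep mono])
        show "0 < r n" by (rule r)
        fix x y assume "x \<in> A \<inter> F" "y \<in> {x\<in>A. r n \<le> f x}"
        then show "r n \<le> dist x y" using flip[of y x] f0[of x] by (auto simp: dist_commute)
      qed auto
      have "(\<Sum>i<n. a i) + (\<nu> (A \<inter> F) + \<nu> (A - F))
          \<le> (\<Sum>i<n. a i) + (\<nu> (A \<inter> F) + (\<nu> {x\<in>A. r n \<le> f x} + (\<Sum>i. a (i+n))))"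
        by (intro add_left_mono q)
      also have "\<dots> = (\<nu> (A \<inter> F) + \<nu> {x\<in>A. r n \<le> f x}) + ((\<Sum>i. a (i+n)) + (\<Sum>i<n. a i))"
        by (simp only: ac_simps)
      also have "\<dots> \<le> \<nu> A + ((\<Sum>i. a (i+n)) + (\<Sum>i<n. a i))" by (intro add_right_mono p)
      also have "(\<Sum>i. a (i+n)) + (\<Sum>i<n. a i) = suminf a"
        by (rule suminf_offset[symmetric]) simp
      finally show ?thesis .
    qed
    then have "suminf a + (\<nu> (A \<inter> F) + \<nu> (A - F)) \<le> \<nu> A + suminf a"
      by (rule ennreal_suminf_bound_add)
    then have "suminf a + (\<nu> (A \<inter> F) + \<nu> (A - F)) \<le> suminf a + \<nu> A"
      by (simp only: add.commute[of "\<nu> A"])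
    then show ?thesis unfolding ennreal_add_left_cancel_le using afin by (simp add: infinity_ennreal_def)
  qed
  have "\<nu> (F \<inter> A) + \<nu> ((UNIV - F) \<inter> A) = \<nu> A" for A
  proof (rule antisym)
    show "\<nu> (F \<inter> A) + \<nu> ((UNIV - F) \<inter> A) \<le> \<nu> A" using key[of A] by (simp add: Int_commute Diff_eq)
    have "F \<inter> A \<union> (UNIV - F) \<inter> A = A" by blast
    with sub[of "F \<inter> A" "(UNIV - F) \<inter> A"] show "\<nu> A \<le> \<nu> (F \<inter> A) + \<nu> ((UNIV - F) \<inter> A)" by simp
  qed
  then show ?thesis by (simp add: lambda_system_def)
qed


lemma
  shows space_hausdorff_measure [simp]: "space (hausdorff_measure k :: 'a::metric_space measure) = UNIV"
    and sets_hausdorff_measure [simp, measurable_cong]: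
      "sets (hausdorff_measure k :: 'a::metric_space measure) = sets borel"
  using sets.sigma_sets_eq[of "borel :: 'a measure"] by (simp_all add: hausdorff_measure_def)

text \<open>The outer measure is a measure on the sigma-algebra of its Caratheodory-measurable sets.
  This contains the closed sets and hence the Borel sets, so \<open>measure_of\<close> does not fall
  back to zero.\<close>

lemma emeasure_hausdorff_measure:
  fixes A :: "'a::metric_space set"
  assumes "A \<in> sets borel"
  shows "emeasure (hausdorff_measure k) A = hausdorff_outer_measure k A"
proof -
  let ?\<nu> = "hausdorff_outer_measure k :: 'a set \<Rightarrow> ennreal"
  let ?L = "lambda_system UNIV UNIV ?\<nu>"
  interpret U: sigma_algebra UNIV "UNIV :: 'a set set" using sigma_algebra_Pow[of UNIV] by simp
  have ms: "measure_space UNIV ?L ?\<nu>"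
    by (rule U.caratheodory_lemma[OF outer_measure_space_hausdorff])
  have "sets borel \<subseteq> ?L"
  proof -
    have "sigma_sets UNIV {S :: 'a set. closed S} \<subseteq> ?L"
    proof (rule sigma_algebra.sigma_sets_subset)
      show "sigma_algebra UNIV ?L" using ms by (simp add: measure_space_def)
      show "{S :: 'a set. closed S} \<subseteq> ?L"
        using closed_in_lambda_system[OF outer_measure_space_hausdorff] hausdorff_outer_measure_separated
        by blast
    qed
    then show ?thesis by (simp add: borel_eq_closed)
  qed
  moreover have "sigma_algebra UNIV (sets (borel :: 'a measure))"
    by (metis sets.sigma_algebra_axioms space_borel)
  ultimately have "measure_space UNIV (sets borel) ?\<nu>"
    using measure_down[OF ms] by blast
  with assms show ?thesis
    unfolding hausdorff_measure_def
    by (subst emeasure_measure_of_sigma)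
       (auto simp: measure_space_def)
qed

section \<open>Hausdorff measure of hyperplane sections\<close>

text \<open>Volume comparison: the balls of radius \<open>\<delta>/2\<close> about the points are
  disjoint and lie in the ball of radius \<open>\<rho> + \<delta>/2\<close>.\<close>

lemma card_separated_le:
  fixes X :: "'a::euclidean_space set"
  assumes X: "finite X" "X \<subseteq> cball 0 \<rho>" "pairwise (\<lambda>x y. \<delta> \<le> dist x y) X" and \<delta>: "0 < \<delta>" and \<rho>: "0 \<le> \<rho>"
  shows "real (card X) * (\<delta>/2) ^ DIM('a) \<le> (\<rho> + \<delta>/2) ^ DIM('a)"
proof -
  let ?v = "unit_ball_vol (real DIM('a))"
  have v: "0 < ?v" by simp
  have disj: "disjoint_family_on (\<lambda>x. ball x (\<delta>/2)) X"
    unfolding disjoint_family_on_def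
  proof (intro ballI impI)
    fix x y assume "x \<in> X" "y \<in> X" "x \<noteq> y"
    then have "\<delta> \<le> dist x y" using X(3) by (auto simp: pairwise_def)
    then show "ball x (\<delta>/2) \<inter> ball y (\<delta>/2) = {}" by (intro disjoint_ballI) auto
  qed
  have "real (card X) * (?v * (\<delta>/2) ^ DIM('a)) = (\<Sum>x\<in>X. measure lborel (ball x (\<delta>/2)))"
    using \<delta> by (simp add: content_ball)
  also have "\<dots> = measure lborel (\<Union>x\<in>X. ball x (\<delta>/2))"
    using X(1) disj emeasure_bounded_finite[OF bounded_ball] 
    by (intro measure_finite_Union[symmetric]) (auto simp: less_top)
  also have "\<dots> \<le> measure lborel (ball (0::'a) (\<rho> + \<delta>/2))"
  proof (rule measure_mono_fmeasurable)
    show "(\<Union>x\<in>X. ball x (\<delta>/2)) \<subseteq> ball 0 (\<rho> + \<delta>/2)"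
    proof
      fix y assume "y \<in> (\<Union>x\<in>X. ball x (\<delta>/2))"
      then obtain x where "x \<in> X" "dist x y < \<delta>/2" by auto
      then show "y \<in> ball 0 (\<rho> + \<delta>/2)" using X(2) norm_triangle_ineq[of x "y - x"]
        by (auto simp: dist_norm norm_minus_commute subset_iff)
    qed
  qed (use X(1) emeasure_bounded_finite[OF bounded_ball] in \<open>auto simp: fmeasurable_def\<close>)
  also have "\<dots> = ?v * (\<rho> + \<delta>/2) ^ DIM('a)" using \<delta> \<rho> by (simp add: content_ball)
  finally show ?thesis using v by (simp add: mult.left_commute)
qed

text \<open>A separated set of maximal cardinality is a net, since a point farther than
  \<open>\<delta>\<close> from all its members could be added. The uniform bound \<open>n\<close>
  guarantees that a maximum exists.\<close>

lemma separated_net: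
  fixes A :: "'a::metric_space set"
  assumes "\<And>F. finite F \<Longrightarrow> F \<subseteq> A \<Longrightarrow> pairwise (\<lambda>x y. \<delta> \<le> dist x y) F \<Longrightarrow> real (card F) \<le> n"
    and "0 \<le> \<delta>"
  obtains F where "finite F" "F \<subseteq> A" "real (card F) \<le> n" "A \<subseteq> (\<Union>x\<in>F. cball x \<delta>)"
proof -
  define Q where "Q F \<longleftrightarrow> finite F \<and> F \<subseteq> A \<and> pairwise (\<lambda>x y. \<delta> \<le> dist x y) F" for F
  have "Q {}" by (simp add: Q_def)
  moreover have "\<forall>F. Q F \<longrightarrow> card F < Suc (nat \<lfloor>n\<rfloor>)"
    using assms(1) by (auto simp: Q_def less_Suc_eq_le le_nat_floor)
  ultimately obtain F where F: "Q F" "\<And>F'. Q F' \<Longrightarrow> card F' \<le> card F"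
    using ex_has_greatest_nat[of Q "{}" card] by blast
  have "A \<subseteq> (\<Union>x\<in>F. cball x \<delta>)"
  proof
    fix y assume y: "y \<in> A"
    show "y \<in> (\<Union>x\<in>F. cball x \<delta>)"
    proof (rule ccontr)
      assume far: "y \<notin> (\<Union>x\<in>F. cball x \<delta>)"
      then have "y \<notin> F" using assms(2) by force
      have "Q (insert y F)" using F(1) y far
        by (force simp: Q_def pairwise_insert dist_commute)
      then show False using F(1) F(2)[of "insert y F"] \<open>y \<notin> F\<close> by (simp add: Q_def)
    qed
  qed
  with F(1) assms(1) show ?thesis by (intro that[of F]) (auto simp: Q_def)
qed

lemma hausdorff_pre_measure_le_net:
  fixes A :: "'a::euclidean_space set"
  assumes "finite F" "A \<subseteq> (\<Union>x\<in>F. cball x \<delta>)" "0 \<le> \<delta>"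
  shows "hausdorff_pre_measure k (2*\<delta>) A \<le> ennreal (real (card F) * (unit_ball_vol (real k) * \<delta> ^ k))"
proof -
  obtain f where f: "bij_betw f {..<card F} F"
    using ex_bij_betw_nat_finite[OF assms(1)] by (auto simp: atLeast0LessThan)
  \<comment> \<open>The finite cover is padded with empty sets, which cost nothing even for
    \<open>k = 0\<close>, where every nonempty set costs 1.\<close>
  define C where "C i = (if i < card F then cball (f i) \<delta> else {})" for i
  have "hausdorff_pre_measure k (2*\<delta>) A \<le> (\<Sum>i. hausdorff_gauge k (C i))"
  proof (rule hausdorff_pre_measure_le)
    show "A \<subseteq> (\<Union>i. C i)"
    proof
      fix a assume "a \<in> A"
      then obtain x where x: "x \<in> F" "a \<in> cball x \<delta>" using assms(2) by blast
      then obtain i where "i < card F" "x = f i" using f by (auto simp: bij_betw_def)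
      with x show "a \<in> (\<Union>i. C i)" by (auto simp: C_def intro!: exI[of _ i])
    qed
  qed (use assms(3) in \<open>auto simp: C_def\<close>)
  also have "\<dots> = (\<Sum>i<card F. hausdorff_gauge k (C i))"
    by (rule suminf_finite) (auto simp: C_def)
  also have "\<dots> = (\<Sum>i<card F. ennreal (unit_ball_vol (real k) * \<delta> ^ k))"
    using assms(3) by (intro sum.cong) (auto simp: C_def hausdorff_gauge_def)
  also have "\<dots> = ennreal (real (card F) * (unit_ball_vol (real k) * \<delta> ^ k))"
    using assms(3) by (simp add: ennreal_mult' ennreal_of_nat_eq_real_of_nat)
  finally show ?thesis .
qed

text \<open>A maximal packing is a net, and each ball of radius \<open>\<delta>\<close> about one of
  its points costs \<open>unit_ball_vol k * \<delta> ^ k\<close>, which the packing bound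
  compensates. Testing \<open>\<delta> \<le> 1\<close> suffices because a finer mesh gives a larger
  premeasure.\<close>

lemma hausdorff_outer_measure_le_packing:
  fixes A :: "'a::euclidean_space set"
  assumes pack: "\<And>F \<delta>. finite F \<Longrightarrow> F \<subseteq> A \<Longrightarrow> 0 < \<delta> \<Longrightarrow> \<delta> \<le> 1 \<Longrightarrow>
      pairwise (\<lambda>x y. \<delta> \<le> dist x y) F \<Longrightarrow> real (card F) * \<delta> ^ k \<le> n"
  shows "hausdorff_outer_measure k A \<le> ennreal (unit_ball_vol (real k) * n)"
  unfolding hausdorff_outer_measure_def
proof (rule SUP_least)
  fix \<delta>0 :: real assume "\<delta>0 \<in> {0<..}"
  define \<delta> where "\<delta> = min (\<delta>0/2) 1"
  have \<delta>: "0 < \<delta>" "\<delta> \<le> 1" "2 * \<delta> \<le> \<delta>0" using \<open>\<delta>0 \<in> {0<..}\<close> by (auto simp: \<delta>_def)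
  obtain F where F: "finite F" "F \<subseteq> A" "real (card F) \<le> n / \<delta> ^ k" "A \<subseteq> (\<Union>x\<in>F. cball x \<delta>)"
    using separated_net[of A \<delta> "n / \<delta> ^ k"] pack \<delta> by (auto simp: field_simps)
  have "hausdorff_pre_measure k \<delta>0 A \<le> hausdorff_pre_measure k (2*\<delta>) A"
    by (rule hausdorff_pre_measure_antimono) fact
  also have "\<dots> \<le> ennreal (real (card F) * (unit_ball_vol (real k) * \<delta> ^ k))"
    using F \<delta> by (intro hausdorff_pre_measure_le_net) auto
  also have "\<dots> = ennreal (unit_ball_vol (real k) * (real (card F) * \<delta> ^ k))"
    by (simp add: mult_ac)
  also have "\<dots> \<le> ennreal (unit_ball_vol (real k) * n)"
    using F(3) \<delta> by (intro ennreal_leI mult_left_mono) (auto simp: field_simps)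
  finally show "hausdorff_pre_measure k \<delta>0 A \<le> ennreal (unit_ball_vol (real k) * n)" .
qed

section \<open>Packing in hyperplanes and in their unit spheres\<close>

lemma norm_orth_add:
  fixes v p :: "'a::real_inner"
  assumes "v \<bullet> p = 0" "norm p = 1"
  shows "norm v \<le> norm (v + s *\<^sub>R p)" "\<bar>s\<bar> \<le> norm (v + s *\<^sub>R p)"
proof -
  have "p \<bullet> p = 1" using assms(2) by (simp add: dot_square_norm)
  then have eq: "norm (v + s *\<^sub>R p) ^ 2 = norm v ^ 2 + s ^ 2"
    using assms(1) unfolding power2_norm_eq_inner
    by (simp add: inner_simps inner_commute power2_eq_square)
  show "norm v \<le> norm (v + s *\<^sub>R p)" by (rule power2_le_imp_le) (auto simp: eq)
  show "\<bar>s\<bar> \<le> norm (v + s *\<^sub>R p)" by (rule power2_le_imp_le) (auto simp: eq)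
qed

text \<open>With \<open>J = nat \<lfloor>1/\<delta>\<rfloor>\<close>, the \<open>Suc J\<close>
  layers at heights \<open>0\<close> to \<open>J * \<delta>\<close> fit into the unit interval. The
  second bound lets \<open>Suc J * \<delta> ^ N\<close> replace \<open>\<delta> ^ (N - 1)\<close> in
  packing estimates; the third limits the number of balls in a cover.\<close>

lemma floor_inverse_bounds:
  assumes "0 < \<delta>" "\<delta> \<le> (1::real)" 
  shows "real (nat \<lfloor>1/\<delta>\<rfloor>) * \<delta> \<le> 1" "1 \<le> real (Suc (nat \<lfloor>1/\<delta>\<rfloor>)) * \<delta>" "real (Suc (nat \<lfloor>1/\<delta>\<rfloor>)) * \<delta> \<le> 2"
proof -
  have "1 \<le> 1/\<delta>" using assms by simp
  then have "real (nat \<lfloor>1/\<delta>\<rfloor>) \<le> 1/\<delta>" "1/\<delta> \<le> real (nat \<lfloor>1/\<delta>\<rfloor>) + 1" by linarith+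
  from this[THEN mult_right_mono, of \<delta>]
  show 1: "real (nat \<lfloor>1/\<delta>\<rfloor>) * \<delta> \<le> 1" and "1 \<le> real (Suc (nat \<lfloor>1/\<delta>\<rfloor>)) * \<delta>"
    using assms(1) by (auto simp: algebra_simps)
  show "real (Suc (nat \<lfloor>1/\<delta>\<rfloor>)) * \<delta> \<le> 2" using 1 assms by (simp add: algebra_simps)
qed

lemma dist_nat_multiples:
  assumes "(i::nat) \<noteq> j" "0 < \<delta>" shows "\<delta> \<le> \<bar>(real i - real j) * \<delta>\<bar>"
proof -
  have "1 \<le> \<bar>real i - real j\<bar>" using assms(1) by linarith
  from mult_right_mono[OF this, of \<delta>] show ?thesis using assms(2) by (simp add: abs_mult)
qed

text \<open>Stacking translates of the points along \<open>p\<close> reduces packing in the hyperplane to packing in a ball.\<close>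

lemma card_separated_hyperplane_le:
  fixes p :: "real^'n"
  assumes p: "norm p = 1" and X: "finite X" "X \<subseteq> orth_hyperplane p \<inter> cball 0 r"
    and sep: "pairwise (\<lambda>x y. \<delta> \<le> dist x y) X" and \<delta>: "0 < \<delta>" "\<delta> \<le> 1" and r: "0 \<le> r"
  shows "real (card X) * \<delta> ^ (CARD('n) - 1) \<le> (2 * (r + 2)) ^ CARD('n)"
proof -
  define J where "J = nat \<lfloor>1/\<delta>\<rfloor>"
  note J = floor_inverse_bounds[OF \<delta>, folded J_def]
  define f where "f = (\<lambda>(x, j). x + (real j * \<delta>) *\<^sub>R p)"
  have d: "\<delta> \<le> dist (f a) (f b)" if "a \<in> X \<times> {..J}" "b \<in> X \<times> {..J}" "a \<noteq> b" for a b
  proof -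
    obtain x i y j where ab: "a = (x,i)" "b = (y,j)" by (metis surj_pair)
    have "x \<in> orth_hyperplane p" "y \<in> orth_hyperplane p" using that X(2) by (auto simp: ab)
    then have "(x - y) \<bullet> p = 0" by (simp add: orth_hyperplane_def inner_diff_left)
    moreover have "f a - f b = (x - y) + ((real i - real j) * \<delta>) *\<^sub>R p"
      by (simp add: f_def ab algebra_simps)
    ultimately have "norm (x - y) \<le> dist (f a) (f b)" "\<bar>(real i - real j) * \<delta>\<bar> \<le> dist (f a) (f b)"
      unfolding dist_norm using norm_orth_add[OF _ p] by metis+
    moreover have "\<delta> \<le> norm (x - y) \<or> i \<noteq> j"
      using that sep by (auto simp: ab pairwise_def dist_norm)
    ultimately show ?thesis using dist_nat_multiples[OF _ \<delta>(1)] by fastforce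
  qed
  have inj: "inj_on f (X \<times> {..J})"
    by (rule inj_onI) (use d \<delta> in \<open>metis dist_self not_less\<close>)
  have "real (card (f ` (X \<times> {..J}))) * (\<delta>/2) ^ DIM(real^'n) \<le> ((r + 1) + \<delta>/2) ^ DIM(real^'n)"
  proof (rule card_separated_le)
    show "f ` (X \<times> {..J}) \<subseteq> cball 0 (r + 1)"
    proof (rule image_subsetI)
      fix a assume "a \<in> X \<times> {..J}"
      then obtain x j where a: "a = (x, j)" and "x \<in> X" "j \<in> {..J}" by blast
      then have "norm x \<le> r" "real j * \<delta> \<le> real J * \<delta>" using X(2) \<delta> by auto
      then have "norm x \<le> r" "real j * \<delta> \<le> 1" using J(1) by linarith+
      then show "f a \<in> cball 0 (r + 1)" using norm_triangle_ineq[of x "(real j * \<delta>) *\<^sub>R p"] p \<delta>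
        by (auto simp: f_def a)
    qed
    show "pairwise (\<lambda>x y. \<delta> \<le> dist x y) (f ` (X \<times> {..J}))"
      unfolding pairwise_def using d by blast
  qed (use X \<delta> r in auto)
  also have "\<dots> \<le> (r + 2) ^ CARD('n)" using \<delta> r by (auto intro!: power_mono)
  finally have 1: "real (card X) * real (Suc J) * (\<delta>/2) ^ CARD('n) \<le> (r + 2) ^ CARD('n)"
    by (simp add: card_image[OF inj] card_cartesian_product algebra_simps)
  have N: "\<delta> ^ CARD('n) = \<delta> * \<delta> ^ (CARD('n) - 1)" by (simp add: power_eq_if)
  have "real (card X) * \<delta> ^ (CARD('n) - 1) \<le> real (card X) * \<delta> ^ (CARD('n) - 1) * (real (Suc J) * \<delta>)"
    using mult_left_mono[OF J(2), of "real (card X) * \<delta> ^ (CARD('n) - 1)"] \<delta> by simp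
  also have "\<dots> = real (card X) * real (Suc J) * (\<delta>/2) ^ CARD('n) * 2 ^ CARD('n)"
    by (simp add: N power_divide)
  also have "\<dots> \<le> (r + 2) ^ CARD('n) * 2 ^ CARD('n)"
    by (intro mult_right_mono 1) auto
  finally show ?thesis unfolding power_mult_distrib by (simp add: mult.commute)
qed

text \<open>Dilations by \<open>1 + j * \<delta>\<close>, between 1 and 2, turn a packing of the
  unit sphere into one of the disc of radius 2 in the hyperplane: points of one layer do not come
  closer, and points of different layers differ in norm by at least \<open>\<delta>\<close>. The
  base \<open>8 = 2 * (2 + 2)\<close> is the hyperplane bound for radius 2.\<close>

lemma card_separated_sphere_le:
  fixes p :: "real^'n"
  assumes N: "2 \<le> CARD('n)" and p: "norm p = 1" and X: "finite X" "X \<subseteq> sphere 0 1 \<inter> orth_hyperplane p"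
    and sep: "pairwise (\<lambda>x y. \<delta> \<le> dist x y) X" and \<delta>: "0 < \<delta>" "\<delta> \<le> 1"
  shows "real (card X) * \<delta> ^ (CARD('n) - 2) \<le> 8 ^ CARD('n)"
proof -
  define J where "J = nat \<lfloor>1/\<delta>\<rfloor>"
  note J = floor_inverse_bounds[OF \<delta>, folded J_def]
  define f where "f = (\<lambda>(x :: real^'n, j). (1 + real j * \<delta>) *\<^sub>R x)"
  have nf: "norm (f (x, j)) = 1 + real j * \<delta>" if "x \<in> X" for x j
    using that X(2) \<delta> by (auto simp: f_def)
  have d: "\<delta> \<le> dist (f a) (f b)" if "a \<in> X \<times> {..J}" "b \<in> X \<times> {..J}" "a \<noteq> b" for a b
  proof -
    obtain x i y j where ab: "a = (x,i)" "b = (y,j)" by (metis surj_pair)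
    show ?thesis
    proof (cases "i = j")
      case True
      then have "\<delta> \<le> dist x y" using that sep by (auto simp: ab pairwise_def)
      also have "\<dots> \<le> (1 + real i * \<delta>) * dist x y" using \<delta> by (simp add: algebra_simps)
      also have "\<dots> = dist (f a) (f b)" using True \<delta>
        by (simp add: ab f_def dist_norm scaleR_diff_right[symmetric])
      finally show ?thesis .
    next
      case False
      have "\<bar>(real i - real j) * \<delta>\<bar> = \<bar>norm (f a) - norm (f b)\<bar>"
        using nf that by (auto simp: ab algebra_simps)
      also have "\<dots> \<le> dist (f a) (f b)" unfolding dist_norm by (rule norm_triangle_ineq3)
      finally show ?thesis using dist_nat_multiples[OF False \<delta>(1)] by linarith
    qed
  qed
  have inj: "inj_on f (X \<times> {..J})"
    by (rule inj_onI) (use d \<delta> in \<open>metis dist_self not_less\<close>)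
  have "real (card (f ` (X \<times> {..J}))) * \<delta> ^ (CARD('n) - 1) \<le> (2 * (2 + 2)) ^ CARD('n)"
  proof (rule card_separated_hyperplane_le[OF p])
    show "f ` (X \<times> {..J}) \<subseteq> orth_hyperplane p \<inter> cball 0 2"
    proof (rule image_subsetI)
      fix a assume "a \<in> X \<times> {..J}"
      then obtain x j where a: "a = (x, j)" and x: "x \<in> X" "j \<in> {..J}" by blast
      then have "real j * \<delta> \<le> real J * \<delta>" using \<delta> by auto
      then have "norm (f (x, j)) \<le> 2" using J(1) nf[OF x(1)] by simp
      moreover have "f (x, j) \<in> orth_hyperplane p" using x(1) X(2) by (auto simp: f_def orth_hyperplane_def)
      ultimately show "f a \<in> orth_hyperplane p \<inter> cball 0 2" by (simp add: a)
    qed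
    show "pairwise (\<lambda>x y. \<delta> \<le> dist x y) (f ` (X \<times> {..J}))"
      unfolding pairwise_def using d by blast
  qed (use X \<delta> in auto)
  then have 1: "real (card X) * real (Suc J) * \<delta> ^ (CARD('n) - 1) \<le> 8 ^ CARD('n)"
    by (simp add: card_image[OF inj] card_cartesian_product algebra_simps)
  have "Suc (CARD('n) - 2) = CARD('n) - 1" using N by simp
  then have N': "\<delta> ^ (CARD('n) - 1) = \<delta> * \<delta> ^ (CARD('n) - 2)" by (metis power_Suc)
  have "real (card X) * \<delta> ^ (CARD('n) - 2) \<le> real (card X) * \<delta> ^ (CARD('n) - 2) * (real (Suc J) * \<delta>)"
    using mult_left_mono[OF J(2), of "real (card X) * \<delta> ^ (CARD('n) - 2)"] \<delta> by simp
  also have "\<dots> = real (card X) * real (Suc J) * \<delta> ^ (CARD('n) - 1)" unfolding N' by simp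
  finally show ?thesis using 1 by linarith
qed

lemma hausdorff_outer_measure_hyperplane_le:
  fixes p :: "real^'n"
  assumes "norm p = 1" "0 \<le> r"
  shows "hausdorff_outer_measure (CARD('n) - 1) (orth_hyperplane p \<inter> cball 0 r)
    \<le> ennreal (unit_ball_vol (real (CARD('n) - 1)) * (2 * (r + 2)) ^ CARD('n))"
  using assms by (intro hausdorff_outer_measure_le_packing card_separated_hyperplane_le) auto

lemma hausdorff_outer_measure_sphere_le:
  fixes p :: "real^'n"
  assumes "2 \<le> CARD('n)" "norm p = 1"
  shows "hausdorff_outer_measure (CARD('n) - 2) (sphere 0 1 \<inter> orth_hyperplane p)
    \<le> ennreal (unit_ball_vol (real (CARD('n) - 2)) * 8 ^ CARD('n))"
  using assms by (intro hausdorff_outer_measure_le_packing card_separated_sphere_le) auto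

text \<open>Balls of radius \<open>2 * d\<close> placed at steps \<open>d\<close> along the axis
  cover the cylinder. At most \<open>2 / d\<close> of them are used, which cancels one factor
  \<open>d\<close> of their volume and leaves the power \<open>N - 1\<close> of the
  diameter.\<close>

lemma measure_cylinder_le:
  fixes p :: "real^'n"
  assumes p: "norm p = 1" and C: "compact C" "diameter C \<le> 1/2"
  defines "T \<equiv> (\<lambda>(x, s). x + s *\<^sub>R p) ` (C \<times> {0..1})"
  shows "compact T"
    and "emeasure lborel T \<le> ennreal (2 * unit_ball_vol (real CARD('n)) * 2 ^ CARD('n) * diameter C ^ (CARD('n) - 1))"
proof -
  let ?K = "2 * unit_ball_vol (real CARD('n)) * 2 ^ CARD('n)"
  show T: "compact T" unfolding T_def split_beta
    by (intro compact_continuous_image compact_Times C continuous_intros) auto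
  \<comment> \<open>A number \<open>d\<close> strictly above the diameter stays positive for a
    one-point \<open>C\<close>; afterwards \<open>d\<close> decreases to the diameter.\<close>
  have bd: "measure lborel T \<le> ?K * d ^ (CARD('n) - 1)" if d: "diameter C < d" "d < 1" for d
  proof (cases "C = {}")
    case True then show ?thesis using d by (simp add: T_def)
  next
    case False
    then obtain x0 where x0: "x0 \<in> C" by blast
    have d0: "0 < d" using d diameter_ge_0[OF compact_imp_bounded[OF C(1)]] by linarith
    define J where "J = nat \<lfloor>1/d\<rfloor>"
    note J = floor_inverse_bounds[OF d0 less_imp_le[OF d(2)], folded J_def]
    define B where "B j = cball (x0 + (real j * d) *\<^sub>R p) (2*d)" for j
    have "T \<subseteq> (\<Union>j\<le>J. B j)"
    proof
      fix y assume "y \<in> T"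
      then obtain x s where y: "y = x + s *\<^sub>R p" "x \<in> C" "0 \<le> s" "s \<le> 1" by (auto simp: T_def)
      define j where "j = nat \<lfloor>s/d\<rfloor>"
      have "0 \<le> s/d" using y d0 by simp
      then have "real j \<le> s/d" "s/d \<le> real j + 1" unfolding j_def by linarith+
      then have js: "real j * d \<le> s" "s \<le> real j * d + d" using d0 by (auto simp: field_simps)
      have "s/d \<le> 1/d" using y d0 by (simp add: divide_right_mono)
      then have "j \<le> J" unfolding j_def J_def by (intro nat_mono floor_mono)
      moreover have "y \<in> B j"
      proof -
        have "dist x x0 \<le> d" using diameter_bounded_bound[OF compact_imp_bounded[OF C(1)] y(2) x0] d by linarith
        moreover have eq: "y - (x0 + (real j * d) *\<^sub>R p) = (x - x0) + (s - real j * d) *\<^sub>R p"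
          by (simp add: y(1) algebra_simps)
        have "dist y (x0 + (real j * d) *\<^sub>R p) \<le> dist x x0 + \<bar>s - real j * d\<bar>"
          unfolding dist_norm eq using norm_triangle_ineq[of "x - x0" "(s - real j * d) *\<^sub>R p"] p by simp
        ultimately have "dist y (x0 + (real j * d) *\<^sub>R p) \<le> d + \<bar>s - real j * d\<bar>" by linarith
        then show ?thesis using js by (simp add: B_def dist_commute)
      qed
      ultimately show "y \<in> (\<Union>j\<le>J. B j)" by blast
    qed
    then have "measure lborel T \<le> measure lborel (\<Union>j\<le>J. B j)"
      using T by (intro measure_mono_fmeasurable) 
        (auto simp: B_def fmeasurable_def borel_compact
          intro!: emeasure_bounded_finite[unfolded infinity_ennreal_def] bounded_UN)
    also have "\<dots> \<le> (\<Sum>j\<le>J. measure lborel (B j))"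
      by (intro measure_UNION_le) (auto simp: B_def)
    also have "\<dots> = real (Suc J) * (unit_ball_vol (real CARD('n)) * (2*d) ^ CARD('n))"
      using d0 by (simp add: B_def content_cball)
    also have "\<dots> = (real (Suc J) * d) * (unit_ball_vol (real CARD('n)) * 2 ^ CARD('n) * d ^ (CARD('n) - 1))"
      by (simp add: power_mult_distrib power_eq_if[of d "CARD('n)"])
    also have "\<dots> \<le> 2 * (unit_ball_vol (real CARD('n)) * 2 ^ CARD('n) * d ^ (CARD('n) - 1))"
      using d0 by (intro mult_right_mono J) auto
    finally show ?thesis by (simp add: mult_ac)
  qed
  have "measure lborel T \<le> ?K * diameter C ^ (CARD('n) - 1)"
  proof (rule tendsto_lowerbound)
    show "((\<lambda>d. ?K * d ^ (CARD('n) - 1)) \<longlongrightarrow> ?K * diameter C ^ (CARD('n) - 1)) (at_right (diameter C))"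
      by (intro tendsto_intros)
    show "\<forall>\<^sub>F d in at_right (diameter C). measure lborel T \<le> ?K * d ^ (CARD('n) - 1)"
      unfolding eventually_at_right_field using bd C(2) by (intro exI[of _ 1]) auto
  qed auto
  moreover have "emeasure lborel T = ennreal (measure lborel T)"
    using emeasure_bounded_finite[OF compact_imp_bounded[OF T]] by (intro emeasure_eq_ennreal_measure) auto
  ultimately show "emeasure lborel T \<le> ennreal (?K * diameter C ^ (CARD('n) - 1))"
    by (simp add: ennreal_leI)
qed

text \<open>Cylinders of height 1 over the sets of any cover of the unit disc cover a full ball of
  radius \<open>1/2\<close> centred at \<open>p /\<^sub>R 2\<close>. The Lebesgue measure of this
  ball bounds the sum of the cylinder volumes from below, and each volume is at most
  \<open>K\<close> times the gauge of its base.\<close>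

lemma hausdorff_outer_measure_hyperplane_ge:
  fixes p :: "real^'n"
  assumes p: "norm p = 1"
  shows "ennreal ((1/2) ^ CARD('n) * unit_ball_vol (real (CARD('n) - 1)) / (2 ^ CARD('n) * 2 ^ CARD('n)))
     \<le> hausdorff_outer_measure (CARD('n) - 1) (orth_hyperplane p \<inter> cball 0 1)"
proof -
  let ?v = "unit_ball_vol (real CARD('n))" 
  define w where "w = unit_ball_vol (real (CARD('n) - 1))"
  define K where "K = (2 * ?v * 2 ^ CARD('n)) * 2 ^ (CARD('n) - 1) / w"
  have w: "0 < w" and v: "0 < ?v" by (simp_all add: w_def)
  then have K: "0 < K" by (simp add: K_def)
  have "ennreal (?v * (1/2) ^ CARD('n) / K) \<le> hausdorff_pre_measure (CARD('n) - 1) (1/2) (orth_hyperplane p \<inter> cball 0 1)"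
    unfolding hausdorff_pre_measure_def
  proof (rule INF_greatest)
    fix C :: "nat \<Rightarrow> (real^'n) set"
    assume "C \<in> {C. orth_hyperplane p \<inter> cball 0 1 \<subseteq> (\<Union>i. C i) \<and> (\<forall>i. bounded (C i) \<and> diameter (C i) \<le> 1/2)}"
    then have C: "orth_hyperplane p \<inter> cball 0 1 \<subseteq> (\<Union>i. C i)" "\<And>i. bounded (C i)" "\<And>i. diameter (C i) \<le> 1/2"
      by auto
    \<comment> \<open>Closures make the cylinders compact, hence measurable, and keep the
      diameters.\<close>
    define T where "T i = (\<lambda>(x, s). x + s *\<^sub>R p) ` (closure (C i) \<times> {0..1})" for i
    have cl: "compact (closure (C i))" "diameter (closure (C i)) = diameter (C i)" for i
      using C(2) by (auto simp: compact_closure diameter_closure)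
    have Tc: "compact (T i)" for i
      unfolding T_def using measure_cylinder_le(1)[OF p cl(1)] cl(2) C(3) by simp
    have T: "emeasure lborel (T i) \<le> ennreal K * hausdorff_gauge (CARD('n) - 1) (C i)" for i
    proof (cases "C i = {}")
      case True then show ?thesis by (simp add: T_def)
    next
      case False
      have "emeasure lborel (T i) \<le> ennreal (2 * ?v * 2 ^ CARD('n) * diameter (C i) ^ (CARD('n) - 1))"
        unfolding T_def using measure_cylinder_le(2)[OF p cl(1)] cl(2) C(3) by metis
      also have "\<dots> = ennreal K * hausdorff_gauge (CARD('n) - 1) (C i)"
        using False w K diameter_ge_0[OF C(2)]
        unfolding hausdorff_gauge_def w_def[symmetric]
        by (simp add: K_def power_divide flip: ennreal_mult')
      finally show ?thesis .
    qed
    have "cball (p /\<^sub>R 2) (1/2) \<subseteq> (\<Union>i. T i)"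
    proof
      fix y assume y: "y \<in> cball (p /\<^sub>R 2) (1/2)"
      define z where "z = y - p /\<^sub>R 2"
      define s where "s = y \<bullet> p"
      have pp: "p \<bullet> p = 1" using p by (simp add: dot_square_norm)
      have z: "norm z \<le> 1/2" using y by (simp add: z_def dist_norm norm_minus_commute)
      have zp: "\<bar>z \<bullet> p\<bar> \<le> 1/2" using Cauchy_Schwarz_ineq2[of z p] z p by simp
      have "s = z \<bullet> p + 1/2" by (simp add: z_def s_def inner_diff_left pp)
      then have s: "0 \<le> s" "s \<le> 1" using zp by auto
      define x where "x = y - s *\<^sub>R p"
      have "x = z - (s - 1/2) *\<^sub>R p" by (simp add: x_def z_def scaleR_diff_left)
      then have "x = z - (z \<bullet> p) *\<^sub>R p" by (simp add: \<open>s = z \<bullet> p + 1/2\<close>)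
      then have "norm x \<le> norm z + \<bar>z \<bullet> p\<bar>" using norm_triangle_ineq4[of z "(z \<bullet> p) *\<^sub>R p"] p by simp
      then have "norm x \<le> 1" using z zp by linarith
      moreover have "x \<bullet> p = 0" by (simp add: x_def s_def inner_diff_left pp)
      ultimately obtain i where "x \<in> C i" using C(1) by (force simp: orth_hyperplane_def)
      then have "y \<in> T i" using s closure_subset[of "C i"] unfolding T_def
        by (intro image_eqI[of _ _ "(x, s)"]) (auto simp: x_def)
      then show "y \<in> (\<Union>i. T i)" by blast
    qed
    then have "emeasure lborel (cball (p /\<^sub>R 2) (1/2)) \<le> emeasure lborel (\<Union>i. T i)"
      using Tc by (intro emeasure_mono) (auto simp: borel_compact)
    also have "\<dots> \<le> (\<Sum>i. emeasure lborel (T i))"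
      using Tc by (intro emeasure_subadditive_countably) (auto simp: borel_compact)
    also have "\<dots> \<le> (\<Sum>i. ennreal K * hausdorff_gauge (CARD('n) - 1) (C i))"
      by (intro suminf_le T) auto
    also have "\<dots> = ennreal K * (\<Sum>i. hausdorff_gauge (CARD('n) - 1) (C i))"
      by (rule ennreal_suminf_cmult)
    finally have 1: "ennreal (?v * (1/2) ^ CARD('n)) \<le> ennreal K * (\<Sum>i. hausdorff_gauge (CARD('n) - 1) (C i))"
      by (simp add: emeasure_cball)
    have "ennreal (?v * (1/2) ^ CARD('n) / K) = ennreal (1/K) * ennreal (?v * (1/2) ^ CARD('n))"
      using K by (simp flip: ennreal_mult')
    also have "\<dots> \<le> ennreal (1/K) * (ennreal K * (\<Sum>i. hausdorff_gauge (CARD('n) - 1) (C i)))"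
      by (intro mult_left_mono 1) auto
    also have "\<dots> = (\<Sum>i. hausdorff_gauge (CARD('n) - 1) (C i))"
      using K by (simp add: mult.assoc[symmetric] flip: ennreal_mult')
    finally show "ennreal (?v * (1/2) ^ CARD('n) / K) \<le> (\<Sum>i. hausdorff_gauge (CARD('n) - 1) (C i))" .
  qed
  also have "\<dots> \<le> hausdorff_outer_measure (CARD('n) - 1) (orth_hyperplane p \<inter> cball 0 1)"
    by (rule hausdorff_pre_measure_le_outer) simp
  also have "?v * (1/2) ^ CARD('n) / K = (1/2) ^ CARD('n) * w / (2 ^ CARD('n) * 2 ^ CARD('n))"
    using less_imp_neq[OF v] w by (simp add: K_def field_simps power_eq_if[of 2 "CARD('n)"])
  finally show ?thesis by (simp add: w_def)
qed

section \<open>Bounds on the coefficients\<close>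

lemma is_norm_bounds:
  fixes \<N> :: "real^'n \<Rightarrow> real"
  assumes "is_norm \<N>"
  obtains b B where "0 < b" "0 \<le> B" "\<And>x. b * norm x \<le> \<N> x" "\<And>x. \<N> x \<le> B * norm x" "continuous_on UNIV \<N>"
proof -
  have N: "\<And>x. 0 \<le> \<N> x" "\<And>x. \<N> x = 0 \<longleftrightarrow> x = 0" "\<And>a x. \<N> (a *\<^sub>R x) = \<bar>a\<bar> * \<N> x"
      "\<And>x y. \<N> (x + y) \<le> \<N> x + \<N> y"
    using assms by (auto simp: is_norm_def)
  define B where "B = (\<Sum>i\<in>UNIV. \<N> (axis i 1))"
  have N0: "\<N> 0 = 0" by (simp add: N(2))
  have sumN: "\<N> (\<Sum>i\<in>I. f i) \<le> (\<Sum>i\<in>I. \<N> (f i))" if "finite I" for f :: "'n \<Rightarrow> real^'n" and I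
    using that by (induction I) (auto simp: N0 intro: order_trans[OF N(4)])
  have up: "\<N> x \<le> B * norm x" for x
  proof -
    have "x = (\<Sum>i\<in>UNIV. x $ i *\<^sub>R axis i 1)"
      using basis_expansion[of x] by (simp add: scalar_mult_eq_scaleR)
    then have "\<N> x \<le> (\<Sum>i\<in>UNIV. \<N> (x $ i *\<^sub>R axis i 1))" using sumN[of UNIV "\<lambda>i. x $ i *\<^sub>R axis i 1"] by simp
    also have "\<dots> \<le> (\<Sum>i\<in>UNIV. norm x * \<N> (axis i 1))"
      unfolding N(3) by (intro sum_mono mult_right_mono component_le_norm_cart N(1))
    finally show ?thesis by (simp add: B_def sum_distrib_left mult.commute)
  qed
  have B0: "0 \<le> B" by (simp add: B_def N(1) sum_nonneg)
  have "\<bar>\<N> x - \<N> y\<bar> \<le> B * dist x y" for x y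
    using N(4)[of y "x - y"] N(4)[of x "y - x"] up[of "x - y"] up[of "y - x"]
    by (auto simp: dist_norm norm_minus_commute abs_le_iff)
  then have "B-lipschitz_on UNIV \<N>" by (intro lipschitz_onI B0) (auto simp: dist_real_def)
  then have cont: "continuous_on UNIV \<N>" by (rule lipschitz_on_continuous_on)
  have "\<exists>x\<in>sphere (0::real^'n) 1. \<forall>y\<in>sphere 0 1. \<N> x \<le> \<N> y"
    by (intro continuous_attains_inf continuous_on_subset[OF cont])
       (auto intro: exI[of _ "axis undefined 1"])
  then obtain z where z: "norm z = 1" "\<And>y. norm y = 1 \<Longrightarrow> \<N> z \<le> \<N> y" by auto
  have "z \<noteq> 0" using z(1) by auto
  then have "0 < \<N> z" using N(1,2)[of z] by linarith
  moreover have "\<N> z * norm x \<le> \<N> x" for x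
  proof (cases "x = 0")
    case False
    then have "\<N> z \<le> \<N> (x /\<^sub>R norm x)" by (intro z(2)) simp
    also have "\<dots> = \<N> x / norm x" using False by (simp add: N(3) divide_inverse mult.commute)
    finally show ?thesis using False by (simp add: field_simps)
  qed (simp add: N0)
  ultimately show ?thesis using that[of "\<N> z" B] B0 up cont by blast
qed

lemma orth_hyperplane_scaleR: "c \<noteq> 0 \<Longrightarrow> orth_hyperplane (c *\<^sub>R p) = orth_hyperplane p"
  by (auto simp: orth_hyperplane_def)

lemma orth_hyperplane_minus [simp]: "orth_hyperplane (- p) = orth_hyperplane p"
  using orth_hyperplane_scaleR[of "-1" p] by simp

lemma closed_orth_hyperplane: "closed (orth_hyperplane p)"
  unfolding orth_hyperplane_def by (intro closed_Collect_eq continuous_intros)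

lemma P\<alpha>_nonneg: "0 \<le> P\<alpha> \<N> \<alpha> x"
  by (simp add: P\<alpha>_def)

lemma P\<alpha>_le_one:
  fixes x :: "real^'n"
  shows "P\<alpha> \<N> \<alpha> x \<le> 1"
proof -
  have "1 / (1 + \<N> x powr (real CARD('n) + \<alpha>)) \<le> 1 / 1" by (rule frac_le) auto
  then show ?thesis by (simp add: P\<alpha>_def)
qed

text \<open>The exponent \<open>N + \<alpha>\<close> is lowered to the integer \<open>N + 1\<close>,
  legitimately for \<open>y\<close> above 1; for \<open>y \<le> 1\<close> the right-hand side is at
  least 1 and the trivial bound applies.\<close>

lemma P\<alpha>_le:
  fixes x :: "real^'n"
  assumes "0 < y" "y \<le> \<N> x" "1 \<le> \<alpha>"
  shows "P\<alpha> \<N> \<alpha> x \<le> 1 / y ^ (CARD('n) + 1)"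
proof (cases "y \<le> 1")
  case True
  then have "1 \<le> 1 / y ^ (CARD('n) + 1)" using assms(1) power_le_one[of y "CARD('n) + 1"] by simp
  with P\<alpha>_le_one show ?thesis by (rule order_trans)
next
  case False
  have "y ^ (CARD('n) + 1) = y powr (real (CARD('n) + 1))" using assms(1) by (rule powr_realpow[symmetric])
  also have "\<dots> \<le> y powr (real CARD('n) + \<alpha>)" using False assms(3) by (intro powr_mono) auto
  also have "\<dots> \<le> \<N> x powr (real CARD('n) + \<alpha>)" using assms by (intro powr_mono2) auto
  finally show ?thesis unfolding P\<alpha>_def using assms(1) by (intro frac_le) (auto simp del: power_Suc)
qed

text \<open>Dyadic annuli: where the Euclidean norm lies between \<open>2 ^ (k - 1)\<close> and
  \<open>2 ^ k\<close>, the kernel is at most \<open>c k\<close>, of order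
  \<open>2 ^ (- k * (N + 1))\<close>. The packing bound for discs grows with the power
  \<open>N\<close> of the radius instead of the sharp \<open>N - 1\<close>, which still leaves a
  summable factor \<open>2 ^ (- k)\<close>.\<close>

lemma nn_integral_P\<alpha>_le:
  fixes \<N> :: "real^'n \<Rightarrow> real"
  assumes b: "0 < b" "\<And>x. b * norm x \<le> \<N> x" and \<alpha>: "1 \<le> \<alpha>" and p: "norm p = 1"
  shows "(\<integral>\<^sup>+x. ennreal (indicator (orth_hyperplane p) x * P\<alpha> \<N> \<alpha> x) \<partial>hausdorff_measure (CARD('n) - 1))
    \<le> ennreal (unit_ball_vol (real (CARD('n) - 1)) * (6 ^ CARD('n) + 2 * 8 ^ CARD('n) / b ^ (CARD('n) + 1)) * 2)"
proof -
  let ?H = "hausdorff_measure (CARD('n) - 1) :: (real^'n) measure"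
  define w where "w = unit_ball_vol (real (CARD('n) - 1))"
  \<comment> \<open>\<open>6 ^ N\<close> is the term \<open>k = 0\<close>. For positive
    \<open>k\<close> the base of the disc bound is at most \<open>8 * 2 ^ (k - 1)\<close>, and the
    factor 2 converts \<open>2 ^ (- (k - 1))\<close> into \<open>2 ^ (- k)\<close>.\<close>
  define D where "D = 6 ^ CARD('n) + 2 * 8 ^ CARD('n) / b ^ (CARD('n) + 1)"
  have w: "0 < w" and D: "0 < D" using b(1) by (auto simp: w_def D_def add_pos_nonneg)
  define c where "c k = (if k = 0 then 1 else 1 / (b * 2 ^ (k - 1)) ^ (CARD('n) + 1))" for k :: nat
  have c0: "0 \<le> c k" for k using b(1) by (simp add: c_def)
  define S where "S k = orth_hyperplane p \<inter> cball 0 (2 ^ k)" for k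
  have S: "S k \<in> sets ?H" for k by (simp add: S_def borel_closed closed_orth_hyperplane)
  have pt: "ennreal (indicator (orth_hyperplane p) x * P\<alpha> \<N> \<alpha> x) \<le> (\<Sum>k. ennreal (c k) * indicator (S k) x)" for x
  proof (cases "x \<in> orth_hyperplane p")
    case True
    define k where "k = (LEAST k. norm x \<le> 2 ^ k)"
    obtain m :: nat where "norm x < 2 ^ m" using real_arch_pow[of 2 "norm x"] by auto
    then have "norm x \<le> 2 ^ m" by simp
    then have k: "norm x \<le> 2 ^ k" unfolding k_def by (rule LeastI)
    have "P\<alpha> \<N> \<alpha> x \<le> c k"
    proof (cases k)
      case 0 then show ?thesis by (simp add: c_def P\<alpha>_le_one)
    next
      case (Suc j)
      then have "\<not> norm x \<le> 2 ^ j" using not_less_Least[of j "\<lambda>k. norm x \<le> 2 ^ k"] by (simp add: k_def)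
      then have "b * 2 ^ j \<le> \<N> x" using b(1) by (intro order_trans[OF mult_left_mono b(2)]) auto
      then show ?thesis using Suc P\<alpha>_le[of "b * 2 ^ j" \<N> x \<alpha>] b(1) \<alpha> by (simp add: c_def)
    qed
    then have "ennreal (indicator (orth_hyperplane p) x * P\<alpha> \<N> \<alpha> x) \<le> ennreal (c k) * indicator (S k) x"
      using True k by (auto simp: S_def intro: ennreal_leI)
    also have "\<dots> = (\<Sum>k\<in>{k}. ennreal (c k) * indicator (S k) x)" by (subst sum.insert) auto
    also have "\<dots> \<le> (\<Sum>k. ennreal (c k) * indicator (S k) x)"
      by (intro sum_le_suminf) auto
    finally show ?thesis .
  qed simp
  have term_le: "c k * (2 * (2 ^ k + 2)) ^ CARD('n) \<le> D * (1/2) ^ k" for k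
  proof (cases k)
    case 0 then show ?thesis using b(1) by (simp add: c_def D_def)
  next
    case (Suc j)
    have "(2 * (2 ^ k + 2)) ^ CARD('n) \<le> (8 * 2 ^ j :: real) ^ CARD('n)"
      using Suc by (intro power_mono) auto
    then have "c k * (2 * (2 ^ k + 2)) ^ CARD('n) \<le> c k * (8 * 2 ^ j) ^ CARD('n)"
      by (intro mult_left_mono c0)
    also have "\<dots> = 2 * 8 ^ CARD('n) / b ^ (CARD('n) + 1) * (1/2) ^ k"
      using b(1) Suc by (simp add: c_def power_mult_distrib field_simps)
    also have "\<dots> \<le> D * (1/2) ^ k" by (intro mult_right_mono) (auto simp: D_def)
    finally show ?thesis .
  qed
  have "(\<integral>\<^sup>+x. ennreal (indicator (orth_hyperplane p) x * P\<alpha> \<N> \<alpha> x) \<partial>?H)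
      \<le> (\<integral>\<^sup>+x. (\<Sum>k. ennreal (c k) * indicator (S k) x) \<partial>?H)"
    by (intro nn_integral_mono pt)
  also have "\<dots> = (\<Sum>k. \<integral>\<^sup>+x. ennreal (c k) * indicator (S k) x \<partial>?H)"
    using S by (intro nn_integral_suminf) auto
  also have "\<dots> = (\<Sum>k. ennreal (c k) * hausdorff_outer_measure (CARD('n) - 1) (S k))"
    using S by (intro suminf_cong) (simp add: nn_integral_cmult_indicator emeasure_hausdorff_measure)
  also have "\<dots> \<le> (\<Sum>k. ennreal (w * D * (1/2) ^ k))"
  proof (intro suminf_le)
    fix k
    have "ennreal (c k) * hausdorff_outer_measure (CARD('n) - 1) (S k)
        \<le> ennreal (c k) * ennreal (w * (2 * (2 ^ k + 2)) ^ CARD('n))"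
      unfolding S_def w_def by (intro mult_left_mono hausdorff_outer_measure_hyperplane_le p) auto
    also have "\<dots> = ennreal (w * (c k * (2 * (2 ^ k + 2)) ^ CARD('n)))"
      using c0 by (simp add: mult_ac flip: ennreal_mult')
    also have "\<dots> \<le> ennreal (w * (D * (1/2) ^ k))"
      using w by (intro ennreal_leI mult_left_mono term_le) auto
    finally show "ennreal (c k) * hausdorff_outer_measure (CARD('n) - 1) (S k) \<le> ennreal (w * D * (1/2) ^ k)"
      by (simp add: mult.assoc)
  qed auto
  also have "\<dots> = ennreal (w * D * 2)"
    using w D sums_mult[OF geometric_sums[of "1/2::real"], of "w * D"]
    by (intro suminf_ennreal_eq) (auto simp: mult.assoc)
  finally show ?thesis by (simp add: w_def D_def)
qed

text \<open>The upper bound on the hyperplane integral gives \<open>m\<close> and also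
  integrability, without which the Bochner integral would be 0. The lower bound comes from the unit
  disc, where the kernel is at least \<open>l\<close>, and gives \<open>M\<close>.\<close>

lemma \<mu>\<alpha>_bounds:
  fixes \<N> :: "real^'n \<Rightarrow> real"
  assumes N: "is_norm \<N>" and \<alpha>: "1 \<le> \<alpha>"
  obtains m M where "0 < m" "\<And>p. p \<noteq> 0 \<Longrightarrow> m \<le> \<mu>\<alpha> \<N> \<alpha> p" "\<And>p. p \<noteq> 0 \<Longrightarrow> \<mu>\<alpha> \<N> \<alpha> p \<le> M"
proof -
  obtain b B where b: "0 < b" "0 \<le> B" "\<And>x. b * norm x \<le> \<N> x" "\<And>x. \<N> x \<le> B * norm x" "continuous_on UNIV \<N>"
    using is_norm_bounds[OF N] by metis
  let ?H = "hausdorff_measure (CARD('n) - 1) :: (real^'n) measure"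
  define K where "K = unit_ball_vol (real (CARD('n) - 1)) * (6 ^ CARD('n) + 2 * 8 ^ CARD('n) / b ^ (CARD('n) + 1)) * 2"
  define L where "L = (1/2) ^ CARD('n) * unit_ball_vol (real (CARD('n) - 1)) / (2 ^ CARD('n) * 2 ^ CARD('n))"
  define l where "l = 1 / (1 + B powr (real CARD('n) + \<alpha>))"
  have K: "0 < K" unfolding K_def using b(1) by (intro mult_pos_pos add_pos_nonneg) auto
  have L: "0 < L" unfolding L_def by (intro divide_pos_pos mult_pos_pos) auto
  have l: "0 < l" unfolding l_def by (simp add: add_pos_nonneg)
  have meas: "P\<alpha> \<N> \<alpha> \<in> borel_measurable ?H"
  proof -
    have "\<N> \<in> borel_measurable borel" using b(5) by (rule borel_measurable_continuous_onI)
    then have "P\<alpha> \<N> \<alpha> \<in> borel_measurable borel" unfolding P\<alpha>_def[abs_def] by measurable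
    then show ?thesis by simp
  qed
  have main: "l * L \<le> (LINT x : orth_hyperplane p | ?H. P\<alpha> \<N> \<alpha> x) \<and>
      (LINT x : orth_hyperplane p | ?H. P\<alpha> \<N> \<alpha> x) \<le> K" if p: "norm p = 1" for p :: "real^'n"
  proof -
    let ?f = "\<lambda>x. indicator (orth_hyperplane p) x * P\<alpha> \<N> \<alpha> x"
    have om: "orth_hyperplane p \<in> sets ?H" by (simp add: borel_closed closed_orth_hyperplane)
    have fm: "?f \<in> borel_measurable ?H" using meas om by measurable
    have f0: "0 \<le> ?f x" for x by (simp add: P\<alpha>_nonneg)
    have nn: "(\<integral>\<^sup>+x. ennreal (?f x) \<partial>?H) \<le> ennreal K"
      unfolding K_def by (rule nn_integral_P\<alpha>_le[OF b(1,3) \<alpha> p])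
    have int: "integrable ?H ?f"
      using fm f0 nn by (intro integrableI_nonneg) (auto intro: order.strict_trans1)
    have eq: "ennreal (\<integral>x. ?f x \<partial>?H) = (\<integral>\<^sup>+x. ennreal (?f x) \<partial>?H)"
      using int f0 by (intro nn_integral_eq_integral[symmetric]) auto
    have "ennreal (\<integral>x. ?f x \<partial>?H) \<le> ennreal K" unfolding eq by (rule nn)
    then have up: "(\<integral>x. ?f x \<partial>?H) \<le> K" using K by (simp add: ennreal_le_iff)
    let ?S = "orth_hyperplane p \<inter> cball 0 1"
    have S: "?S \<in> sets ?H" by (simp add: borel_closed closed_orth_hyperplane)
    have "ennreal (l * L) = ennreal l * ennreal L" using l by (simp add: ennreal_mult')
    also have "\<dots> \<le> ennreal l * hausdorff_outer_measure (CARD('n) - 1) ?S"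
      unfolding L_def by (intro mult_left_mono hausdorff_outer_measure_hyperplane_ge p) auto
    also have "\<dots> = (\<integral>\<^sup>+x. ennreal l * indicator ?S x \<partial>?H)"
      using S by (simp add: nn_integral_cmult_indicator emeasure_hausdorff_measure)
    also have "\<dots> \<le> (\<integral>\<^sup>+x. ennreal (?f x) \<partial>?H)"
    proof (intro nn_integral_mono)
      fix x
      have "l \<le> P\<alpha> \<N> \<alpha> x" if "norm x \<le> 1"
      proof -
        have "0 \<le> b * norm x" "B * norm x \<le> B" using b(1) mult_left_mono[OF that b(2)] by auto
        then have "0 \<le> \<N> x" "\<N> x \<le> B" using b(3,4)[of x] by linarith+
        then have "\<N> x powr (real CARD('n) + \<alpha>) \<le> B powr (real CARD('n) + \<alpha>)"
          using \<alpha> by (intro powr_mono2) auto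
        then show ?thesis unfolding l_def P\<alpha>_def by (intro divide_left_mono) (auto intro!: mult_pos_pos add_pos_nonneg)
      qed
      then show "ennreal l * indicator ?S x \<le> ennreal (?f x)"
        by (auto simp: indicator_def intro: ennreal_leI)
    qed
    finally have "ennreal (l * L) \<le> ennreal (\<integral>x. ?f x \<partial>?H)" unfolding eq .
    then have "l * L \<le> (\<integral>x. ?f x \<partial>?H)"
      using f0 by (subst (asm) ennreal_le_iff) (auto intro: integral_nonneg)
    with up show ?thesis by (simp add: set_lebesgue_integral_def)
  qed
  have bd: "inverse (2 * K) \<le> \<mu>\<alpha> \<N> \<alpha> p \<and> \<mu>\<alpha> \<N> \<alpha> p \<le> inverse (2 * (l * L))" if "p \<noteq> 0" for p
  proof -
    have o: "orth_hyperplane p = orth_hyperplane (p /\<^sub>R norm p)"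
      using that by (simp add: orth_hyperplane_scaleR)
    have "norm (p /\<^sub>R norm p) = 1" using that by simp
    from main[OF this] show ?thesis
      using K mult_pos_pos[OF l L] unfolding \<mu>\<alpha>_def o
      by (auto intro!: le_imp_inverse_le simp del: inverse_mult_distrib)
  qed
  show ?thesis
    using that[of "inverse (2 * K)" "inverse (2 * (l * L))"] bd K by auto
qed

section \<open>Size and degeneracy of \<open>A_matrix\<close>\<close>

lemma norm_tensor_square_le: "norm \<theta> = 1 \<Longrightarrow> norm (tensor_square (\<theta> :: real^'n)) \<le> 1"
proof -
  assume "norm \<theta> = 1"
  have row: "tensor_square \<theta> $ i = \<theta> $ i *\<^sub>R \<theta>" for i
    by (simp add: tensor_square_def vec_eq_iff)
  have "norm (tensor_square \<theta>) = L2_set (\<lambda>i. norm (\<theta> $ i *\<^sub>R \<theta>)) UNIV"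
    by (simp only: norm_vec_def[of "tensor_square \<theta>"] row)
  also have "\<dots> = L2_set (\<lambda>i. norm (\<theta> $ i)) UNIV"
    by (simp add: \<open>norm \<theta> = 1\<close>)
  also have "\<dots> = norm \<theta>" by (simp only: norm_vec_def)
  finally have "norm (tensor_square \<theta>) = norm \<theta>" .
  then show ?thesis using \<open>norm \<theta> = 1\<close> by simp
qed

text \<open>On the sphere section the weight is at most \<open>1 / b ^ (N + 1)\<close>, and the
  measure of the section is bounded independently of its direction. A non-integrable integrand would
  have Bochner integral 0, so the bound covers that case too.\<close>

lemma A_matrix_bound:
  fixes \<N> :: "real^'n \<Rightarrow> real"
  assumes N: "is_norm \<N>" and n: "2 \<le> CARD('n)"
  obtains C where "\<And>q. norm q = 1 \<Longrightarrow> norm (A_matrix \<N> \<alpha> q) \<le> C"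
proof -
  obtain b B where b: "0 < b" "\<And>x. b * norm x \<le> \<N> x"
    using is_norm_bounds[OF N] by metis
  define V where "V = unit_ball_vol (real (CARD('n) - 2)) * 8 ^ CARD('n)"
  have V: "0 \<le> V" by (simp add: V_def)
  let ?H = "hausdorff_measure (CARD('n) - 2) :: (real^'n) measure"
  have "norm (A_matrix \<N> \<alpha> q) \<le> \<bar>C_const CARD('n) \<alpha>\<bar> * (1 / b ^ (CARD('n) + 1) * V)" if q: "norm q = 1" for q
  proof -
    let ?S = "sphere 0 1 \<inter> orth_hyperplane q"
    let ?f = "\<lambda>\<theta>. indicator ?S \<theta> *\<^sub>R ((1 / \<N> \<theta> ^ (CARD('n) + 1)) *\<^sub>R tensor_square \<theta>)"
    have S: "?S \<in> sets ?H" by (simp add: borel_closed closed_orth_hyperplane)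
    have le: "emeasure ?H ?S \<le> ennreal V"
      unfolding V_def emeasure_hausdorff_measure[OF S[unfolded sets_hausdorff_measure]]
      by (rule hausdorff_outer_measure_sphere_le[OF n q])
    then have fin: "emeasure ?H ?S < \<infinity>" by (auto intro: order.strict_trans1)
    have mV: "measure ?H ?S \<le> V" using le V fin
      by (simp add: emeasure_eq_ennreal_measure ennreal_le_iff less_top)
    have "norm (\<integral>\<theta>. ?f \<theta> \<partial>?H) \<le> 1 / b ^ (CARD('n) + 1) * V"
    proof (cases "integrable ?H ?f")
      case True
      have "norm (\<integral>\<theta>. ?f \<theta> \<partial>?H) \<le> (\<integral>\<theta>. norm (?f \<theta>) \<partial>?H)" by (rule integral_norm_bound)
      also have "\<dots> \<le> (\<integral>\<theta>. 1 / b ^ (CARD('n) + 1) * indicator ?S \<theta> \<partial>?H)"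
      proof (rule integral_mono)
        show "integrable ?H (\<lambda>\<theta>. norm (?f \<theta>))" using True by (rule integrable_norm)
        show "integrable ?H (\<lambda>\<theta>. 1 / b ^ (CARD('n) + 1) * indicator ?S \<theta> :: real)"
          using S fin by (intro integrable_mult_right integrable_real_indicator) auto
        fix \<theta> :: "real^'n"
        show "norm (?f \<theta>) \<le> 1 / b ^ (CARD('n) + 1) * indicator ?S \<theta>"
        proof (cases "\<theta> \<in> ?S")
          case True
          then have \<theta>: "norm \<theta> = 1" by simp
          then have "b \<le> \<N> \<theta>" using b(2)[of \<theta>] by simp
          then have "1 / \<N> \<theta> ^ (CARD('n) + 1) \<le> 1 / b ^ (CARD('n) + 1)" "0 \<le> \<N> \<theta>"
            using b(1) by (auto intro!: divide_left_mono power_mono mult_pos_pos zero_less_power simp del: power_Suc)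
          then have "1 / \<N> \<theta> ^ (CARD('n) + 1) * norm (tensor_square \<theta>) \<le> 1 / b ^ (CARD('n) + 1) * 1"
            using b(1) by (intro mult_mono norm_tensor_square_le \<theta>) auto
          then show ?thesis using True \<open>0 \<le> \<N> \<theta>\<close> by (simp add: abs_mult)
        qed simp
      qed
      also have "\<dots> = 1 / b ^ (CARD('n) + 1) * measure ?H ?S" using S by simp
      also have "\<dots> \<le> 1 / b ^ (CARD('n) + 1) * V" using b(1) by (intro mult_left_mono mV) auto
      finally show ?thesis .
    next
      case False
      then show ?thesis using b(1) V by (simp add: not_integrable_integral_eq)
    qed
    then show ?thesis
      unfolding A_matrix_def set_lebesgue_integral_def norm_scaleR by (rule mult_left_mono) simp
  qed
  then show ?thesis by (rule that)
qed

lemma A_matrix_minus [simp]: "A_matrix \<N> \<alpha> (- q) = A_matrix \<N> \<alpha> q"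
  by (simp add: A_matrix_def)

text \<open>The form is linear in the matrix and passes under the integral; on
  \<open>tensor_square \<theta>\<close> it is the square of \<open>\<theta> \<bullet> q\<close>,
  which vanishes on the hyperplane orthogonal to \<open>q\<close>.\<close>

lemma A_matrix_quadratic_form:
  fixes q :: "real^'n"
  shows "(\<Sum>i\<in>UNIV. \<Sum>k\<in>UNIV. q $ i * q $ k * A_matrix \<N> \<alpha> q $ k $ i) = 0"
proof -
  let ?H = "hausdorff_measure (CARD('n) - 2) :: (real^'n) measure"
  let ?f = "\<lambda>\<theta>. indicator (sphere 0 1 \<inter> orth_hyperplane q) \<theta> *\<^sub>R
     ((1 / \<N> \<theta> ^ (CARD('n) + 1)) *\<^sub>R tensor_square \<theta>)"
  define T :: "real^'n^'n \<Rightarrow> real" where "T X = (\<Sum>i\<in>UNIV. \<Sum>k\<in>UNIV. q $ i * q $ k * X $ k $ i)" for X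
  have lin: "linear T"
    by (rule linearI) (simp_all add: T_def algebra_simps sum.distrib sum_distrib_left)
  have tensor: "T (tensor_square \<theta>) = (\<theta> \<bullet> q)\<^sup>2" for \<theta>
    by (simp add: T_def tensor_square_def inner_vec_def power2_eq_square sum_product mult_ac)
  have "T (\<integral>\<theta>. ?f \<theta> \<partial>?H) = 0"
  proof (cases "integrable ?H ?f")
    case True
    have "T (\<integral>\<theta>. ?f \<theta> \<partial>?H) = (\<integral>\<theta>. T (?f \<theta>) \<partial>?H)"
      using lin True by (intro integral_bounded_linear[symmetric]) (auto simp: linear_conv_bounded_linear)
    also have "\<dots> = (\<integral>\<theta>. 0 \<partial>?H)"
      by (intro Bochner_Integration.integral_cong)
         (auto simp: linear_scale[OF lin] linear_0[OF lin] tensor orth_hyperplane_def indicator_def)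
    finally show ?thesis by simp
  next
    case False then show ?thesis by (simp add: not_integrable_integral_eq linear_0[OF lin])
  qed
  then have "T (A_matrix \<N> \<alpha> q) = 0"
    unfolding A_matrix_def set_lebesgue_integral_def linear_scale[OF lin] by simp
  then show ?thesis unfolding T_def .
qed

text \<open>Relabelling a quadratic barrier produces Hessians of exactly this form, a multiple of
  the tensor square of the gradient plus a multiple of the identity. The first part contributes
  nothing by the vanishing quadratic form.\<close>

lemma F\<alpha>_rank_one_plus_scalar:
  fixes p :: "real^'n"
  shows "F\<alpha> \<N> \<alpha> (\<chi> i j. u * (p $ i * p $ j) + (if i = j then v else 0)) p = v * trace (A_matrix \<N> \<alpha> (p /\<^sub>R norm p))"
proof -
  let ?q = "p /\<^sub>R norm p"
  let ?A = "A_matrix \<N> \<alpha> ?q"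
  have "(\<Sum>i\<in>UNIV. \<Sum>k\<in>UNIV. p $ i * p $ k * ?A $ k $ i) = 0"
  proof (cases "p = 0")
    case False
    have "(\<Sum>i\<in>UNIV. \<Sum>k\<in>UNIV. ?q $ i * ?q $ k * ?A $ k $ i)
       = inverse (norm p) * inverse (norm p) * (\<Sum>i\<in>UNIV. \<Sum>k\<in>UNIV. p $ i * p $ k * ?A $ k $ i)"
      by (simp add: sum_distrib_left mult_ac)
    then show ?thesis using A_matrix_quadratic_form[of ?q \<N> \<alpha>] False by simp
  qed simp
  then have "(\<Sum>i\<in>UNIV. \<Sum>k\<in>UNIV. u * (p $ i * p $ k) * ?A $ k $ i) = 0"
    by (simp add: sum_distrib_left[symmetric] mult.assoc)
  then show ?thesis
    by (simp add: F\<alpha>_def trace_def matrix_matrix_mult_def ring_distribs sum.distrib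
        if_distrib[where f = "\<lambda>z. z * c" for c] sum_distrib_left cong: if_cong)
qed

lemma F\<alpha>_minus: "F\<alpha> \<N> \<alpha> (- M) (- p) = - F\<alpha> \<N> \<alpha> M p"
proof -
  have "(- p) /\<^sub>R norm (- p) = - (p /\<^sub>R norm p)" by simp
  then show ?thesis
    by (simp add: F\<alpha>_def trace_def matrix_matrix_mult_def sum_negf)
qed

lemma \<mu>\<alpha>_scaleR: "c \<noteq> 0 \<Longrightarrow> \<mu>\<alpha> \<N> \<alpha> (c *\<^sub>R p) = \<mu>\<alpha> \<N> \<alpha> p"
  by (simp add: \<mu>\<alpha>_def orth_hyperplane_scaleR)

lemma \<mu>\<alpha>_minus [simp]: "\<mu>\<alpha> \<N> \<alpha> (- p) = \<mu>\<alpha> \<N> \<alpha> p"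
  by (simp add: \<mu>\<alpha>_def)

lemma trace_A_matrix_bound:
  fixes \<N> :: "real^'n \<Rightarrow> real"
  assumes "is_norm \<N>" "2 \<le> CARD('n)"
  obtains C where "0 < C" "\<And>q. norm q = 1 \<Longrightarrow> \<bar>trace (A_matrix \<N> \<alpha> q)\<bar> \<le> C"
proof -
  obtain C where C: "\<And>q. norm q = 1 \<Longrightarrow> norm (A_matrix \<N> \<alpha> q) \<le> C"
    using A_matrix_bound[OF assms] by metis
  have "\<bar>trace (A_matrix \<N> \<alpha> q)\<bar> \<le> real CARD('n) * \<bar>C\<bar> + 1" if "norm q = 1" for q
  proof -
    have "\<bar>A_matrix \<N> \<alpha> q $ i $ i\<bar> \<le> \<bar>C\<bar>" for i
      using component_le_norm_cart[of "A_matrix \<N> \<alpha> q $ i" i] Finite_Cartesian_Product.norm_nth_le[of "A_matrix \<N> \<alpha> q" i] C[OF that]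
      by linarith
    then have "(\<Sum>i\<in>UNIV. \<bar>A_matrix \<N> \<alpha> q $ i $ i\<bar>) \<le> real CARD('n) * \<bar>C\<bar>"
      by (intro sum_bounded_above[THEN order_trans]) auto
    then show ?thesis unfolding trace_def using sum_abs[of "\<lambda>i. A_matrix \<N> \<alpha> q $ i $ i" UNIV] by linarith
  qed
  then show ?thesis by (intro that[of "real CARD('n) * \<bar>C\<bar> + 1"]) (auto intro!: add_nonneg_pos)
qed

section \<open>Test functions\<close>

lemma C2_on_bounded_linear: "bounded_linear f \<Longrightarrow> C2_on S f"
  unfolding C2_on_def
  by (intro exI[of _ "\<lambda>_. Blinfun f"] exI[of _ "\<lambda>_. 0"])
     (auto simp: bounded_linear_Blinfun_apply bounded_linear_imp_has_derivative zero_blinfun.rep_eq)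

lemma C2_on_const: "C2_on S (\<lambda>_. c)"
  unfolding C2_on_def by (intro exI[of _ "\<lambda>_. 0"]) (auto simp: zero_blinfun.rep_eq)

lemma C2_on_add:
  assumes "C2_on S f" "C2_on S g"
  shows "C2_on S (\<lambda>z. f z + g z)"
proof -
  obtain f' f'' g' g'' where
    "\<forall>z\<in>S. (f has_derivative blinfun_apply (f' z)) (at z)" "\<forall>z\<in>S. (f' has_derivative blinfun_apply (f'' z)) (at z)"
    "continuous_on S f''"
    "\<forall>z\<in>S. (g has_derivative blinfun_apply (g' z)) (at z)" "\<forall>z\<in>S. (g' has_derivative blinfun_apply (g'' z)) (at z)"
    "continuous_on S g''"
    using assms unfolding C2_on_def by blast
  then show ?thesis unfolding C2_on_def
    by (intro exI[of _ "\<lambda>z. f' z + g' z"] exI[of _ "\<lambda>z. f'' z + g'' z"])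
       (auto simp: blinfun.add_left[abs_def] plus_blinfun.rep_eq intro!: has_derivative_add continuous_on_add)
qed

text \<open>In the second derivative the rank-one part is encoded as
  \<open>blinfun_scaleR_left (f' z) o\<^sub>L f' z\<close>, the operator sending \<open>h\<close> to
  \<open>f' z h\<close> times \<open>f' z\<close>.\<close>

lemma C2_on_compose:
  assumes "C2_on S f"
    and g: "\<And>z. z \<in> S \<Longrightarrow> (g has_real_derivative g' (f z)) (at (f z))"
    and g': "\<And>z. z \<in> S \<Longrightarrow> (g' has_real_derivative g'' (f z)) (at (f z))"
    and g'': "continuous_on (f ` S) g''"
  shows "C2_on S (\<lambda>z. g (f z))"
proof -
  obtain f' f'' where f: "\<And>z. z \<in> S \<Longrightarrow> (f has_derivative blinfun_apply (f' z)) (at z)"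
    "\<And>z. z \<in> S \<Longrightarrow> (f' has_derivative blinfun_apply (f'' z)) (at z)" "continuous_on S f''"
    using assms(1) unfolding C2_on_def by blast
  have "continuous_on S f" using f(1) by (meson has_derivative_continuous continuous_at_imp_continuous_on)
  moreover have cf': "continuous_on S f'" using f(2) by (meson has_derivative_continuous continuous_at_imp_continuous_on)
  moreover have cg': "continuous_on (f ` S) g'"
    using g' by (auto intro!: continuous_at_imp_continuous_on DERIV_isCont)
  ultimately have cont: "continuous_on S (\<lambda>z. g' (f z) *\<^sub>R f'' z + g'' (f z) *\<^sub>R (blinfun_scaleR_left (f' z) o\<^sub>L f' z))"
    using f(3) g''
    by (intro continuous_intros continuous_on_compose2[OF cg'] continuous_on_compose2[OF g'']
        bounded_linear.continuous_on[OF bounded_linear_blinfun_scaleR_left]) auto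
  show ?thesis unfolding C2_on_def
  proof (intro exI[of _ "\<lambda>z. g' (f z) *\<^sub>R f' z"] exI conjI ballI)
    fix z assume z: "z \<in> S"
    show "((\<lambda>z. g (f z)) has_derivative blinfun_apply (g' (f z) *\<^sub>R f' z)) (at z)"
      using has_derivative_compose[OF f(1)[OF z] g[OF z, unfolded has_field_derivative_def]]
      by (simp add: scaleR_blinfun.rep_eq mult.commute)
    have "((\<lambda>z. g' (f z)) has_derivative (\<lambda>h. g'' (f z) * blinfun_apply (f' z) h)) (at z)"
      using has_derivative_compose[OF f(1)[OF z] g'[OF z, unfolded has_field_derivative_def]] by simp
    from has_derivative_scaleR[OF this f(2)[OF z]]
    show "((\<lambda>z. g' (f z) *\<^sub>R f' z) has_derivative
       blinfun_apply (g' (f z) *\<^sub>R f'' z + g'' (f z) *\<^sub>R (blinfun_scaleR_left (f' z) o\<^sub>L f' z))) (at z)"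
      by (rule has_derivative_eq_rhs) (auto simp: blinfun.add_left blinfun.scaleR_left)
  qed (rule cont)
qed

lemma C2_on_cmult: "C2_on S f \<Longrightarrow> C2_on S (\<lambda>z. c * f z)"
  by (rule C2_on_compose[where g' = "\<lambda>_. c" and g'' = "\<lambda>_. 0"]) (auto intro!: derivative_eq_intros)

lemma C2_on_power2: "C2_on S f \<Longrightarrow> C2_on S (\<lambda>z. (f z)\<^sup>2)"
  by (rule C2_on_compose[where g' = "\<lambda>x. 2 * x" and g'' = "\<lambda>_. 2"]) (auto intro!: derivative_eq_intros)

text \<open>Polarization writes the product through two squares, which the chain rule already
  covers.\<close>

lemma C2_on_mult:
  assumes "C2_on S f" "C2_on S g"
  shows "C2_on S (\<lambda>z. f z * g z)"
proof -
  have eq: "f z * g z = 1/4 * (f z + g z)\<^sup>2 + (- (1/4)) * (f z + (- 1) * g z)\<^sup>2" for z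
    by (simp add: power2_eq_square algebra_simps)
  show ?thesis unfolding eq by (intro C2_on_add C2_on_cmult C2_on_power2 assms)
qed

lemma C2_on_sum: "(\<And>i. i \<in> I \<Longrightarrow> C2_on S (f i)) \<Longrightarrow> C2_on S (\<lambda>z. \<Sum>i\<in>I. f i z)"
  by (induction I rule: infinite_finite_induct) (auto intro: C2_on_const C2_on_add)

lemma C2_on_norm_fst: "C2_on S (\<lambda>z :: (real^'n) \<times> real. fst z \<bullet> fst z)"
proof -
  have "C2_on S (\<lambda>z :: (real^'n) \<times> real. fst z $ i)" for i
    by (intro C2_on_bounded_linear bounded_linear_compose[OF bounded_linear_vec_nth bounded_linear_fst])
  then show ?thesis unfolding inner_vec_def inner_real_def by (intro C2_on_sum C2_on_mult)
qed

text \<open>An exponent of at least 2 makes the positive part differentiable at 0 too. The cube is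
  thus the smallest integer power that is twice continuously differentiable, and its second
  derivative \<open>6 * max 0 s\<close> vanishes together with the first.\<close>

lemma DERIV_max_power:
  "((\<lambda>s. max 0 s ^ Suc (Suc n)) has_real_derivative real (Suc (Suc n)) * max 0 s ^ Suc n) (at (s::real))"
proof -
  consider "0 < s" | "s < 0" | "s = 0" by linarith
  then show ?thesis
  proof cases
    case 1
    have "((\<lambda>s. s ^ Suc (Suc n)) has_real_derivative real (Suc (Suc n)) * max 0 s ^ Suc n) (at s)"
      using 1 DERIV_pow[of "Suc (Suc n)" s] by simp
    then show ?thesis by (rule has_field_derivative_transform_within_open[of _ _ _ "{0<..}"]) (use 1 in auto)
  next
    case 2
    have "((\<lambda>s. 0) has_real_derivative real (Suc (Suc n)) * max 0 s ^ Suc n) (at s)"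
      using 2 by simp
    then show ?thesis by (rule has_field_derivative_transform_within_open[of _ _ _ "{..<0}"]) (use 2 in auto)
  next
    case 3
    have "((\<lambda>h::real. max 0 h ^ Suc n) \<longlongrightarrow> max 0 0 ^ Suc n) (at 0)" by (intro tendsto_intros)
    moreover have "\<forall>\<^sub>F h in at (0::real). max 0 h ^ Suc n = (max 0 (0 + h) ^ Suc (Suc n) - max 0 0 ^ Suc (Suc n)) / h"
      by (auto simp: eventually_at max_def intro!: exI[of _ 1])
    ultimately have "((\<lambda>h::real. (max 0 (0 + h) ^ Suc (Suc n) - max 0 0 ^ Suc (Suc n)) / h) \<longlongrightarrow> 0) (at 0)"
      by (simp add: tendsto_cong)
    then show ?thesis using 3 by (simp add: DERIV_def)
  qed
qed

text \<open>Test functions must stay above \<open>u\<close> at infinity, where its growth is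
  unknown. The cubes of \<open>max 0 (s - real k)\<close> with weights
  \<open>\<bar>m k\<bar>\<close> form a locally finite sum, and the \<open>k\<close>-th summand
  alone dominates \<open>m k\<close> as soon as \<open>s\<close> reaches
  \<open>k + 1\<close>.\<close>

lemma smooth_dominating_function:
  fixes m :: "nat \<Rightarrow> real"
  obtains G G' G'' :: "real \<Rightarrow> real" where
    "\<And>s. (G has_real_derivative G' s) (at s)" "\<And>s. (G' has_real_derivative G'' s) (at s)"
    "continuous_on UNIV G''" "\<And>s. s \<le> 0 \<Longrightarrow> G s = 0" "\<And>s. s \<le> 0 \<Longrightarrow> G' s = 0" "\<And>s. s \<le> 0 \<Longrightarrow> G'' s = 0"
    "\<And>s. 0 \<le> G s" "\<And>s. 0 \<le> G' s" "\<And>k s. real k + 1 \<le> s \<Longrightarrow> m k \<le> G s"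
proof -
  \<comment> \<open>Factor and exponent are parameters so that \<open>H 1 3\<close>,
    \<open>H 3 2\<close> and \<open>H 6 1\<close> are the function and its two derivatives. Cutting
    the sum at the ceiling of \<open>s\<close> drops only summands that vanish for positive
    exponents.\<close>
  define H where "H c e s = (\<Sum>k<nat \<lceil>s\<rceil>. c * \<bar>m k\<bar> * max 0 (s - real k) ^ e)" for c :: real and e :: nat and s
  have H: "H c (Suc e) s = (\<Sum>k<n. c * \<bar>m k\<bar> * max 0 (s - real k) ^ Suc e)" if "s \<le> real n" for c e s n
    unfolding H_def
  proof (rule sum.mono_neutral_left)
    show "\<forall>i\<in>{..<n} - {..<nat \<lceil>s\<rceil>}. c * \<bar>m i\<bar> * max 0 (s - real i) ^ Suc e = 0"
    proof
      fix i assume "i \<in> {..<n} - {..<nat \<lceil>s\<rceil>}"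
      then have "s \<le> real i" by (simp add: not_less)
      then show "c * \<bar>m i\<bar> * max 0 (s - real i) ^ Suc e = 0" by simp
    qed
  qed (use that in \<open>auto simp: nat_le_iff ceiling_le_iff\<close>)
  have D: "(H c (Suc (Suc e)) has_real_derivative H (c * real (Suc (Suc e))) (Suc e) s) (at s)" for c e s
  proof -
    obtain n where n: "s < real n" using reals_Archimedean2 by blast
    have "((\<lambda>s. \<Sum>k<n. c * \<bar>m k\<bar> * max 0 (s - real k) ^ Suc (Suc e)) has_real_derivative
        (\<Sum>k<n. c * \<bar>m k\<bar> * (real (Suc (Suc e)) * max 0 (s - real k) ^ Suc e))) (at s)"
    proof (intro DERIV_sum DERIV_cmult)
      fix k
      have "((\<lambda>s. s - real k) has_real_derivative 1) (at s)" by (auto intro!: derivative_eq_intros)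
      from DERIV_chain2[OF DERIV_max_power this]
      show "((\<lambda>s. max 0 (s - real k) ^ Suc (Suc e)) has_real_derivative real (Suc (Suc e)) * max 0 (s - real k) ^ Suc e) (at s)"
        by simp
    qed
    also have "(\<Sum>k<n. c * \<bar>m k\<bar> * (real (Suc (Suc e)) * max 0 (s - real k) ^ Suc e)) = H (c * real (Suc (Suc e))) (Suc e) s"
      using n by (subst H[of s n]) (auto intro!: sum.cong)
    finally show ?thesis
      by (rule has_field_derivative_transform_within_open[of _ _ _ "{..<real n}"]) (use n in \<open>auto intro!: H[symmetric] simp del: power_Suc\<close>)
  qed
  have cont: "continuous_on UNIV (H c (Suc e))" for c e
  proof (rule continuous_at_imp_continuous_on, rule ballI)
    fix s :: real
    obtain n where n: "s < real n" using reals_Archimedean2 by blast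
    have "continuous (at s) (\<lambda>s. \<Sum>k<n. c * \<bar>m k\<bar> * max 0 (s - real k) ^ Suc e)"
      by (intro continuous_intros)
    moreover have "\<forall>\<^sub>F s in nhds s. H c (Suc e) s = (\<Sum>k<n. c * \<bar>m k\<bar> * max 0 (s - real k) ^ Suc e)"
      using eventually_nhds_in_open[of "{..<real n}" s] n by (auto elim!: eventually_mono intro!: H simp del: power_Suc)
    ultimately show "isCont (H c (Suc e)) s" by (simp add: isCont_cong)
  qed
  have nn: "0 \<le> c \<Longrightarrow> 0 \<le> H c e s" for c e s unfolding H_def by (intro sum_nonneg) auto
  have z: "s \<le> 0 \<Longrightarrow> H c e s = 0" for c e s unfolding H_def by simp
  have dom: "m k \<le> H 1 3 s" if "real k + 1 \<le> s" for k s
  proof -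
    have k: "k < nat \<lceil>s\<rceil>" using that by linarith
    have "1 \<le> max 0 (s - real k) ^ 3" using that by (intro one_le_power) auto
    then have "m k \<le> 1 * \<bar>m k\<bar> * max 0 (s - real k) ^ 3"
      using mult_left_mono[of 1 "max 0 (s - real k) ^ 3" "\<bar>m k\<bar>"] by linarith
    also have "\<dots> \<le> H 1 3 s" unfolding H_def
      using k by (intro member_le_sum) auto
    finally show ?thesis .
  qed
  show ?thesis
    using that[of "H 1 3" "H 3 2" "H 6 1"] D[of 1 1] D[of 3 0] cont[of 6 0] nn z dom
    by (simp add: numeral_eq_Suc)
qed

text \<open>\<open>space_hess\<close> differentiates \<open>space_grad\<close>, so the gradient must
  be known near \<open>z\<close>; hence the first derivative is given on the whole open half-space
  and that of \<open>P\<close> only at \<open>z\<close>.\<close>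

lemma test_function_derivatives:
  fixes \<phi> :: "(real^'n) \<times> real \<Rightarrow> real"
  assumes D: "\<And>w. w \<in> open_halfspace \<Longrightarrow> (\<phi> has_derivative (\<lambda>v. P w \<bullet> fst v + Q w * snd v)) (at w)"
    and z: "z \<in> open_halfspace" and P: "(P has_derivative P') (at z)"
  shows "time_deriv \<phi> z = Q z" "space_grad \<phi> z = P z" "space_hess \<phi> z = (\<chi> i j. P' (axis i 1, 0) $ j)"
proof -
  have fd: "frechet_derivative \<phi> (at w) = (\<lambda>v. P w \<bullet> fst v + Q w * snd v)" if "w \<in> open_halfspace" for w
    using frechet_derivative_at[OF D[OF that]] by simp
  show "time_deriv \<phi> z = Q z" by (simp add: time_deriv_def fd z)
  have sg: "space_grad \<phi> w = P w" if "w \<in> open_halfspace" for w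
    by (simp add: space_grad_def fd that inner_axis vec_eq_iff)
  then show "space_grad \<phi> z = P z" using z .
  have op: "open (open_halfspace :: ((real^'n) \<times> real) set)" by (intro open_Times) auto
  have "((\<lambda>w. space_grad \<phi> w $ j) has_derivative (\<lambda>v. P' v $ j)) (at z)" for j
  proof (rule has_derivative_transform_within_open[OF _ op z])
    show "((\<lambda>w. P w $ j) has_derivative (\<lambda>v. P' v $ j)) (at z)"
      using bounded_linear.has_derivative[OF bounded_linear_vec_nth P] .
  qed (simp add: sg)
  then have "frechet_derivative (\<lambda>w. space_grad \<phi> w $ j) (at z) = (\<lambda>v. P' v $ j)" for j
    by (metis frechet_derivative_at)
  then show "space_hess \<phi> z = (\<chi> i j. P' (axis i 1, 0) $ j)" by (simp add: space_hess_def)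
qed

lemma C2_on_derivatives_uminus:
  fixes \<phi> :: "(real^'n) \<times> real \<Rightarrow> real"
  assumes "C2_on open_halfspace \<phi>" and z: "z \<in> open_halfspace"
  shows "C2_on open_halfspace (\<lambda>w. - \<phi> w)" "time_deriv (\<lambda>w. - \<phi> w) z = - time_deriv \<phi> z"
    "space_grad (\<lambda>w. - \<phi> w) z = - space_grad \<phi> z" "space_hess (\<lambda>w. - \<phi> w) z = - space_hess \<phi> z"
proof -
  show "C2_on open_halfspace (\<lambda>w. - \<phi> w)" using C2_on_cmult[OF assms(1), of "-1"] by simp
  obtain f' f'' where f: "\<And>w. w \<in> open_halfspace \<Longrightarrow> (\<phi> has_derivative blinfun_apply (f' w)) (at w)"
    "\<And>w. w \<in> open_halfspace \<Longrightarrow> (f' has_derivative blinfun_apply (f'' w)) (at w)"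
    using assms(1) unfolding C2_on_def by blast
  have fd: "frechet_derivative \<phi> (at w) = blinfun_apply (f' w)"
    "frechet_derivative (\<lambda>w. - \<phi> w) (at w) = (\<lambda>v. - blinfun_apply (f' w) v)" if "w \<in> open_halfspace" for w
    using frechet_derivative_at[OF f(1)[OF that]] frechet_derivative_at[OF has_derivative_minus[OF f(1)[OF that]]] by simp_all
  show "time_deriv (\<lambda>w. - \<phi> w) z = - time_deriv \<phi> z" by (simp add: time_deriv_def fd z)
  have sg: "space_grad \<phi> w $ j = blinfun_apply (f' w) (axis j 1, 0)"
    "space_grad (\<lambda>w. - \<phi> w) w $ j = - blinfun_apply (f' w) (axis j 1, 0)" if "w \<in> open_halfspace" for w j
    by (simp_all add: space_grad_def fd that)
  show "space_grad (\<lambda>w. - \<phi> w) z = - space_grad \<phi> z" by (simp add: vec_eq_iff sg z)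
  have op: "open (open_halfspace :: ((real^'n) \<times> real) set)" by (intro open_Times) auto
  have d: "((\<lambda>w. blinfun_apply (f' w) (axis j 1, 0)) has_derivative (\<lambda>v. blinfun_apply (blinfun_apply (f'' z) v) (axis j 1, 0))) (at z)" for j
    using bounded_linear.has_derivative[OF blinfun.bounded_linear_left f(2)[OF z]] .
  have f0: "((\<lambda>w. space_grad \<phi> w $ j) has_derivative (\<lambda>v. blinfun_apply (blinfun_apply (f'' z) v) (axis j 1, 0))) (at z)" for j
    by (rule has_derivative_transform_within_open[OF d op z]) (simp add: sg)
  have f1: "((\<lambda>w. space_grad (\<lambda>w. - \<phi> w) w $ j) has_derivative (\<lambda>v. - blinfun_apply (blinfun_apply (f'' z) v) (axis j 1, 0))) (at z)" for j
    by (rule has_derivative_transform_within_open[OF has_derivative_minus[OF d] op z]) (simp add: sg)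
  show "space_hess (\<lambda>w. - \<phi> w) z = - space_hess \<phi> z"
    unfolding space_hess_def by (simp add: vec_eq_iff frechet_derivative_at[symmetric, OF f0] frechet_derivative_at[symmetric, OF f1])
qed

text \<open>Under a change of sign the curvature term is odd while the norm of the gradient is even,
  so the forcing constant becomes \<open>- c\<close>. Bounds from below thus reduce to the
  comparison for subsolutions.\<close>

lemma viscosity_supersolution_uminus:
  assumes "viscosity_supersolution \<N> \<alpha> c u"
  shows "viscosity_subsolution \<N> \<alpha> (- c) (\<lambda>w. - u w)"
proof -
  have "bounded ((\<lambda>w. - u w) ` A)" if "bounded (u ` A)" for A
    using that by (simp add: image_image[symmetric, of uminus u] bounded_uminus)
  then have lb: "locally_bounded_on closed_halfspace (\<lambda>w. - u w)"
    using assms unfolding viscosity_supersolution_def locally_bounded_on_def by blast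
  have us: "usc_on closed_halfspace (\<lambda>w. - u w)"
    unfolding usc_on_def
  proof (intro ballI allI impI)
    fix z a assume z: "z \<in> (closed_halfspace :: ((real^'a) \<times> real) set)" "- u z < a"
    then have "\<forall>\<^sub>F w in at z within closed_halfspace. - a < u w"
      using assms unfolding viscosity_supersolution_def lsc_on_def by (metis minus_less_iff)
    then show "\<forall>\<^sub>F w in at z within closed_halfspace. - u w < a"
      by eventually_elim simp
  qed
  have test: "(space_grad \<phi> z \<noteq> 0 \<longrightarrow>
           time_deriv \<phi> z \<le> \<mu>\<alpha> \<N> \<alpha> (space_grad \<phi> z) *
             (F\<alpha> \<N> \<alpha> (space_hess \<phi> z) (space_grad \<phi> z) + (- c) * norm (space_grad \<phi> z))) \<and>
        (space_grad \<phi> z = 0 \<and> space_hess \<phi> z = 0 \<longrightarrow> time_deriv \<phi> z \<le> 0)"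
    if C2: "C2_on open_halfspace \<phi>" and z: "z \<in> open_halfspace"
      and mx: "\<forall>w\<in>open_halfspace. - u w - \<phi> w \<le> - u z - \<phi> z" for \<phi> z
  proof -
    let ?\<psi> = "\<lambda>w. - \<phi> w"
    note n = C2_on_derivatives_uminus[OF C2 z]
    have "\<forall>w\<in>open_halfspace. u w - ?\<psi> w \<ge> u z - ?\<psi> z" using mx by (auto simp: algebra_simps)
    with n(1) z assms have "(space_grad ?\<psi> z \<noteq> 0 \<longrightarrow>
           time_deriv ?\<psi> z \<ge> \<mu>\<alpha> \<N> \<alpha> (space_grad ?\<psi> z) *
             (F\<alpha> \<N> \<alpha> (space_hess ?\<psi> z) (space_grad ?\<psi> z) + c * norm (space_grad ?\<psi> z))) \<and>
        (space_grad ?\<psi> z = 0 \<and> space_hess ?\<psi> z = 0 \<longrightarrow> time_deriv ?\<psi> z \<ge> 0)"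
      unfolding viscosity_supersolution_def by blast
    then show ?thesis unfolding n(2-4) F\<alpha>_minus by (auto simp: algebra_simps)
  qed
  show ?thesis unfolding viscosity_subsolution_def using lb us test by blast
qed

section \<open>Comparison with barriers\<close>

text \<open>The relabelled barrier \<open>(max 0 \<psi>)^3\<close> has vanishing second derivatives where its gradient vanishes, and
  \<open>A(e) e = 0\<close> removes the rank-one term created by the relabelling. The small multiple of \<open>t\<close> makes the
  inequality strict, and the function \<open>G\<close> confines the contact point to a compact set.\<close>

lemma barrier_comparison:
  fixes u \<psi> :: "(real^'n) \<times> real \<Rightarrow> real" and p :: "(real^'n) \<times> real \<Rightarrow> real^'n"
  assumes cont: "continuous_on closed_halfspace u"
    and sub: "viscosity_subsolution \<N> \<alpha> c u"
    and \<psi>C2: "C2_on open_halfspace \<psi>" and \<psi>cont: "continuous_on closed_halfspace \<psi>"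
    and \<psi>': "\<And>w. w \<in> open_halfspace \<Longrightarrow> (\<psi> has_derivative (\<lambda>v. p w \<bullet> fst v + q w * snd v)) (at w)"
    and p': "\<And>w. w \<in> open_halfspace \<Longrightarrow> (p has_derivative (\<lambda>v. (2 * a) *\<^sub>R fst v + snd v *\<^sub>R r w)) (at w)"
    and T: "0 < T" and \<rho>: "0 < \<rho>" and s0: "0 < s0"
    and super: "\<And>x t. norm x < \<rho> \<Longrightarrow> 0 < t \<Longrightarrow> t < T + 1 \<Longrightarrow> 0 < \<psi> (x, t) \<Longrightarrow> \<psi> (x, t) < s0 \<Longrightarrow>
        p (x, t) \<noteq> 0 \<and> \<mu>\<alpha> \<N> \<alpha> (p (x, t)) * (2 * a * trace (A_matrix \<N> \<alpha> (p (x, t) /\<^sub>R norm (p (x, t))))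
          + c * norm (p (x, t))) \<le> q (x, t)"
    and init: "\<And>x. norm x \<le> \<rho> + 1 \<Longrightarrow> \<psi> (x, 0) \<le> 0 \<Longrightarrow> u (x, 0) < 0"
    and lateral: "\<And>x t. \<rho> \<le> norm x \<Longrightarrow> norm x \<le> \<rho> + 1 \<Longrightarrow> 0 \<le> t \<Longrightarrow> t \<le> T + 1 \<Longrightarrow> \<psi> (x, t) \<le> 0 \<Longrightarrow> u (x, t) < 0"
    and xt: "norm x \<le> \<rho>" "0 \<le> t" "t \<le> T" "\<psi> (x, t) \<le> 0"
  shows "u (x, t) < 0"
proof -
  define K where "K = cball (0::real^'n) (\<rho> + 1) \<times> {0..T + 1}"
  \<comment> \<open>The parabolic boundary, with a lateral shell of thickness 1 instead of a sphere:
    across the shell \<open>G\<close> grows from 0 to a size that dominates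
    \<open>u\<close>.\<close>
  define B where "B = cball (0::real^'n) (\<rho> + 1) \<times> {0} \<union> (cball 0 (\<rho> + 1) \<inter> {x. \<rho> \<le> norm x}) \<times> {0..T + 1}"
  have Kc: "compact K" unfolding K_def by (intro compact_Times) auto
  have "closed {x :: real^'n. \<rho> \<le> norm x}" by (intro closed_Collect_le continuous_intros)
  then have Bc: "compact B" unfolding B_def by (intro compact_Un compact_Times compact_Int_closed) auto
  have KH: "K \<subseteq> closed_halfspace" and BK: "B \<subseteq> K" using T by (auto simp: K_def B_def)
  \<comment> \<open>Where \<open>\<psi>\<close> is nonpositive on \<open>B\<close>, \<open>u\<close>
    is negative by \<open>init\<close> and \<open>lateral\<close>; so the maximum of
    \<open>\<psi>\<close> and \<open>- u\<close> is positive on a compact set, which yields a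
    uniform margin \<open>e\<close>.\<close>
  have "\<exists>e>0. \<forall>w\<in>B. e \<le> max (\<psi> w) (- u w)"
  proof (cases "B = {}")
    case False
    have "continuous_on B (\<lambda>w. max (\<psi> w) (- u w))"
      using KH BK by (intro continuous_on_max continuous_on_minus continuous_on_subset[OF cont] continuous_on_subset[OF \<psi>cont]) auto
    from continuous_attains_inf[OF Bc False this]
    obtain w where w: "w \<in> B" "\<And>y. y \<in> B \<Longrightarrow> max (\<psi> w) (- u w) \<le> max (\<psi> y) (- u y)" by auto
    moreover have "0 < max (\<psi> w) (- u w)"
    proof (cases "\<psi> w \<le> 0")
      case True
      then have "u w < 0" using w(1) init lateral by (cases w) (auto simp: B_def)
      then show ?thesis by auto
    qed auto
    ultimately show ?thesis by blast
  qed (auto intro: exI[of _ 1])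
  then obtain e where e: "0 < e" "\<And>w. w \<in> B \<Longrightarrow> e \<le> max (\<psi> w) (- u w)" by blast
  define s1 where "s1 = min (e/2) s0"
  have s1: "0 < s1" "s1 \<le> s0" "s1 < e" using e(1) s0 by (auto simp: s1_def)
  have Bneg: "u w \<le> - e" if "w \<in> B" "\<psi> w \<le> s1" for w using e(2)[OF that(1)] that(2) s1(3) by auto
  \<comment> \<open>These bounded sets exhaust the half-space. With a bound \<open>m k\<close> for
    \<open>u\<close> on each, \<open>G\<close> is made to dominate \<open>m k + e\<close> from
    \<open>k + 1\<close> on.\<close>
  define Kn where "Kn k = {w :: (real^'n) \<times> real. norm (fst w) ^ 2 \<le> real k + 2 + \<rho>^2 \<and> 0 \<le> snd w \<and> snd w \<le> real k + 2 + T}" for k :: nat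
  have "\<exists>M. \<forall>w\<in>Kn k. u w \<le> M" for k
  proof -
    let ?C = "cball (0::real^'n) (sqrt (real k + 2 + \<rho>^2)) \<times> {0..real k + 2 + T}"
    have "compact ?C" by (intro compact_Times) auto
    then have "compact (u ` ?C)" by (intro compact_continuous_image continuous_on_subset[OF cont]) auto
    from compact_imp_bounded[OF this] obtain M where M: "\<forall>y\<in>u ` ?C. norm y \<le> M"
      unfolding bounded_iff by (rule exE)
    have "Kn k \<subseteq> ?C" by (auto simp: Kn_def real_le_rsqrt)
    have "u w \<le> M" if "w \<in> Kn k" for w
    proof -
      have "norm (u w) \<le> M" using M \<open>Kn k \<subseteq> ?C\<close> that by blast
      then show ?thesis by simp
    qed
    then show ?thesis by blast
  qed
  then obtain m where m: "\<And>k w. w \<in> Kn k \<Longrightarrow> u w \<le> m k" by metis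
  obtain G G' G'' where G: "\<And>s. (G has_real_derivative G' s) (at s)" "\<And>s. (G' has_real_derivative G'' s) (at s)"
    "continuous_on UNIV G''" "\<And>s. s \<le> 0 \<Longrightarrow> G s = 0" "\<And>s. s \<le> 0 \<Longrightarrow> G' s = 0" "\<And>s. s \<le> 0 \<Longrightarrow> G'' s = 0"
    "\<And>s. 0 \<le> G s" "\<And>s. 0 \<le> G' s" "\<And>k s. real k + 1 \<le> s \<Longrightarrow> m k + e \<le> G s"
    using smooth_dominating_function[of "\<lambda>k. m k + e"] by metis
  have Gc: "isCont G s" "isCont G' s" for s using G(1,2) by (auto intro: DERIV_isCont)
  obtain U where U: "0 \<le> U" "\<And>w. w \<in> K \<Longrightarrow> u w \<le> U"
  proof -
    have "compact (u ` K)" by (intro compact_continuous_image continuous_on_subset[OF cont] KH Kc)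
    from compact_imp_bounded[OF this] obtain M where M: "\<forall>y\<in>u ` K. norm y \<le> M"
      unfolding bounded_iff by (rule exE)
    have "u w \<le> \<bar>M\<bar>" if "w \<in> K" for w
    proof -
      have "norm (u w) \<le> M" using M that by blast
      then show ?thesis by simp
    qed
    then show ?thesis by (intro that[of "\<bar>M\<bar>"]) auto
  qed
  \<comment> \<open>At \<open>\<psi> = s1\<close> the penalty equals \<open>U + e\<close> and lifts
    the test function above \<open>U\<close>, so a contact point has \<open>\<psi>\<close> below
    \<open>s1\<close>.\<close>
  define A where "A = (U + e) / s1 ^ 3"
  have A: "0 < A" "A * s1 ^ 3 = U + e" using U(1) e(1) s1(1) by (auto simp: A_def)
  define \<kappa> where "\<kappa> = e / (2 * T)"
  have \<kappa>: "0 < \<kappa>" "\<kappa> * T < e" using e(1) T by (auto simp: \<kappa>_def)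
  \<comment> \<open>The test function starts from the level \<open>- e\<close>. As
    \<open>\<kappa> * T < e\<close>, it stays negative wherever \<open>\<psi>\<close> is nonpositive
    within radius \<open>\<rho>\<close> and up to time \<open>T\<close>.\<close>
  define \<phi> where "\<phi> w = - e + (\<kappa> * snd w + (A * max 0 (\<psi> w) ^ 3
      + (G (fst w \<bullet> fst w + (- \<rho>\<^sup>2)) + G (snd w + (- T)))))" for w
  have cube: "0 \<le> A * max 0 (\<psi> w) ^ 3" for w using A(1) by simp
  have \<phi>pos: "- e \<le> \<phi> w" if "w \<in> closed_halfspace" for w
    using that \<kappa>(1) cube[of w] G(7)[of "fst w \<bullet> fst w + (- \<rho>\<^sup>2)"] G(7)[of "snd w + (- T)"]
      mult_nonneg_nonneg[of \<kappa> "snd w"] by (auto simp: \<phi>_def)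
  have out: "u w \<le> \<phi> w" if w: "w \<in> closed_halfspace" "\<rho> + 1 \<le> norm (fst w) \<or> T + 1 \<le> snd w" for w
  proof -
    define s where "s = max (fst w \<bullet> fst w + (- \<rho>\<^sup>2)) (snd w + (- T))"
    have "1 \<le> s"
    proof (cases "T + 1 \<le> snd w")
      case False
      then have "(\<rho> + 1)\<^sup>2 \<le> (norm (fst w))\<^sup>2" using w(2) \<rho> by (intro power_mono) auto
      then have "1 \<le> fst w \<bullet> fst w + (- \<rho>\<^sup>2)" unfolding power2_norm_eq_inner power2_sum using \<rho> by simp
      then show ?thesis by (simp add: s_def)
    qed (simp add: s_def)
    \<comment> \<open>Then \<open>s\<close> lies between \<open>k + 1\<close>, where
      \<open>G\<close> dominates \<open>m k + e\<close>, and \<open>k + 2\<close>, the size up to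
      which \<open>Kn k\<close> reaches.\<close>
    define k where "k = nat \<lfloor>s\<rfloor> - 1"
    have k: "real k + 1 \<le> s" "s \<le> real k + 2" using \<open>1 \<le> s\<close> unfolding k_def by linarith+
    have "fst w \<bullet> fst w + (- \<rho>\<^sup>2) \<le> real k + 2" "snd w + (- T) \<le> real k + 2" using k(2) by (auto simp: s_def)
    then have "w \<in> Kn k" using w(1) by (auto simp: Kn_def power2_norm_eq_inner)
    from m[OF this] have "u w + e \<le> G s" using G(9)[OF k(1)] by linarith
    also have "G s \<le> G (fst w \<bullet> fst w + (- \<rho>\<^sup>2)) + G (snd w + (- T))"
      using G(7) by (auto simp: s_def max_def)
    also have "\<dots> \<le> \<phi> w + e" using w(1) \<kappa>(1) cube[of w] mult_nonneg_nonneg[of \<kappa> "snd w"] by (auto simp: \<phi>_def)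
    finally show ?thesis by simp
  qed
  have "u w \<le> \<phi> w" if "w \<in> closed_halfspace" for w
  proof (rule ccontr)
    assume w: "\<not> u w \<le> \<phi> w"
    have "\<not> (\<rho> + 1 \<le> norm (fst w) \<or> T + 1 \<le> snd w)" using out[OF that] w by blast
    then have wK: "w \<in> K" using that by (auto simp: K_def mem_Times_iff)
    have cG: "continuous_on UNIV G" using Gc by (auto intro!: continuous_at_imp_continuous_on)
    have "continuous_on K (\<lambda>w. G (fst w \<bullet> fst w + (- \<rho>\<^sup>2)))" "continuous_on K (\<lambda>w. G (snd w + (- T)))"
      by (auto intro!: continuous_on_compose2[OF cG] continuous_intros)
    then have "continuous_on K \<phi>" unfolding \<phi>_def
      by (intro continuous_intros continuous_on_subset[OF \<psi>cont KH])
    then have "continuous_on K (\<lambda>w. u w - \<phi> w)" using KH by (intro continuous_on_diff continuous_on_subset[OF cont])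
    from continuous_attains_sup[OF Kc _ this] wK
    obtain z where z: "z \<in> K" "\<And>y. y \<in> K \<Longrightarrow> u y - \<phi> y \<le> u z - \<phi> z" by blast
    have pos: "\<phi> z < u z" using z(2)[OF wK] w by simp
    have glob: "u y - \<phi> y \<le> u z - \<phi> z" if "y \<in> closed_halfspace" for y
    proof (cases "y \<in> K")
      case False
      then have "u y \<le> \<phi> y" using that by (intro out) (auto simp: K_def mem_Times_iff)
      then show ?thesis using pos by simp
    qed (rule z(2))
    have zH: "z \<in> closed_halfspace" using z(1) KH by blast
    have in': "\<not> (\<rho> + 1 \<le> norm (fst z) \<or> T + 1 \<le> snd z)" using out[OF zH] pos by auto
    have "\<psi> z < s1"
    proof (rule ccontr)
      assume "\<not> \<psi> z < s1"
      then have "s1 ^ 3 \<le> max 0 (\<psi> z) ^ 3" using s1(1) by (intro power_mono) auto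
      then have "A * s1 ^ 3 \<le> A * max 0 (\<psi> z) ^ 3" using A(1) by simp
      moreover have "0 \<le> \<kappa> * snd z" using zH \<kappa>(1) by auto
      ultimately have "U \<le> \<phi> z"
        using A(2) G(7)[of "fst z \<bullet> fst z + (- \<rho>\<^sup>2)"] G(7)[of "snd z + (- T)"]
        unfolding \<phi>_def by linarith
      then show False using pos U(2)[OF z(1)] by simp
    qed
    have "z \<notin> B"
    proof
      assume "z \<in> B"
      from Bneg[OF this] show False using \<phi>pos[OF zH] pos \<open>\<psi> z < s1\<close> by linarith
    qed
    \<comment> \<open>Being off \<open>B\<close> excludes time 0 and the shell, so the spatial
      \<open>G\<close> has vanishing derivatives at \<open>z\<close>. The one in time may have a
      positive derivative, which only raises the time derivative of the test function.\<close>
    then have zt: "0 < snd z" "snd z < T + 1" "norm (fst z) < \<rho>"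
      using z(1) in' by (auto simp: B_def K_def mem_Times_iff)
    then have zO: "z \<in> open_halfspace" by (auto simp: mem_Times_iff)
    have neg: "fst z \<bullet> fst z + (- \<rho>\<^sup>2) \<le> 0"
      using zt(3) power_mono[of "norm (fst z)" \<rho> 2] by (simp add: power2_norm_eq_inner)
    define l where "l w = A * (3 * max 0 (\<psi> w) ^ 2)" for w
    define P where "P w = l w *\<^sub>R p w + (2 * G' (fst w \<bullet> fst w + (- \<rho>\<^sup>2))) *\<^sub>R fst w" for w
    define Q where "Q w = \<kappa> + l w * q w + G' (snd w + (- T))" for w
    have m3: "((\<lambda>s. max 0 s ^ 3) has_real_derivative 3 * max 0 s ^ 2) (at s)" for s :: real
      using DERIV_max_power[of 1 s] by (simp add: numeral_eq_Suc)
    have m2: "((\<lambda>s. 3 * max 0 s ^ 2) has_real_derivative 6 * max 0 s) (at s)" for s :: real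
      using DERIV_cmult[OF DERIV_max_power[of 0 s], of 3] by (simp add: numeral_eq_Suc)
    have C2: "C2_on open_halfspace \<phi>"
      unfolding \<phi>_def
    proof (intro C2_on_add C2_on_const C2_on_cmult)
      show "C2_on open_halfspace (\<lambda>z :: (real^'n) \<times> real. snd z)"
        by (intro C2_on_bounded_linear bounded_linear_snd)
      show "C2_on open_halfspace (\<lambda>z. max 0 (\<psi> z) ^ 3)"
        by (rule C2_on_compose[OF \<psi>C2 m3 m2]) (intro continuous_intros)
      show "C2_on open_halfspace (\<lambda>z :: (real^'n) \<times> real. G (fst z \<bullet> fst z + - \<rho>\<^sup>2))"
        by (rule C2_on_compose[where g = G, OF _ G(1,2) continuous_on_subset[OF G(3)]])
           (intro C2_on_add C2_on_const C2_on_norm_fst, simp)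
      show "C2_on open_halfspace (\<lambda>z :: (real^'n) \<times> real. G (snd z + - T))"
        by (rule C2_on_compose[where g = G, OF _ G(1,2) continuous_on_subset[OF G(3)]])
           (intro C2_on_add C2_on_const C2_on_bounded_linear bounded_linear_snd, simp)
    qed
    have dpsi3: "((\<lambda>w. A * max 0 (\<psi> w) ^ 3) has_derivative (\<lambda>v. l w * (p w \<bullet> fst v + q w * snd v))) (at w)"
      if "w \<in> open_halfspace" for w
      using has_derivative_compose[OF \<psi>'[OF that] DERIV_cmult[OF m3, unfolded has_field_derivative_def]]
      by (simp add: l_def)
    have dl: "(l has_derivative (\<lambda>v. A * (6 * max 0 (\<psi> w)) * (p w \<bullet> fst v + q w * snd v))) (at w)"
      if "w \<in> open_halfspace" for w
      using has_derivative_compose[OF \<psi>'[OF that] DERIV_cmult[OF m2, unfolded has_field_derivative_def]]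
      by (simp add: l_def[abs_def])
    have dsq: "((\<lambda>w :: (real^'n) \<times> real. fst w \<bullet> fst w + (- \<rho>\<^sup>2)) has_derivative (\<lambda>v. 2 * (fst w \<bullet> fst v))) (at w)" for w
      by (auto intro!: derivative_eq_intros simp: inner_commute)
    have dG: "((\<lambda>w :: (real^'n) \<times> real. G (fst w \<bullet> fst w + (- \<rho>\<^sup>2))) has_derivative
        (\<lambda>v. G' (fst w \<bullet> fst w + (- \<rho>\<^sup>2)) * (2 * (fst w \<bullet> fst v)))) (at w)" for w
      using has_derivative_compose[OF dsq G(1)[unfolded has_field_derivative_def]] by simp
    have dG': "((\<lambda>w :: (real^'n) \<times> real. 2 * G' (fst w \<bullet> fst w + (- \<rho>\<^sup>2))) has_derivative
        (\<lambda>v. 2 * (G'' (fst w \<bullet> fst w + (- \<rho>\<^sup>2)) * (2 * (fst w \<bullet> fst v))))) (at w)" for w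
      by (rule has_derivative_mult_right[OF has_derivative_compose[OF dsq G(2)[unfolded has_field_derivative_def]]])
    have dsn: "((\<lambda>w :: (real^'n) \<times> real. snd w + (- T)) has_derivative snd) (at w)" for w
      by (auto intro!: derivative_eq_intros)
    have dGt: "((\<lambda>w :: (real^'n) \<times> real. G (snd w + (- T))) has_derivative
        (\<lambda>v. G' (snd w + (- T)) * snd v)) (at w)" for w
      using has_derivative_compose[OF dsn G(1)[unfolded has_field_derivative_def]] by simp
    have d\<phi>: "(\<phi> has_derivative (\<lambda>v. P w \<bullet> fst v + Q w * snd v)) (at w)" if "w \<in> open_halfspace" for w
    proof -
      have "(\<phi> has_derivative (\<lambda>v. 0 + (\<kappa> * snd v + (l w * (p w \<bullet> fst v + q w * snd v)
          + (G' (fst w \<bullet> fst w + (- \<rho>\<^sup>2)) * (2 * (fst w \<bullet> fst v)) + G' (snd w + (- T)) * snd v))))) (at w)"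
        unfolding \<phi>_def
        by (intro has_derivative_add has_derivative_const dpsi3 that dG dGt has_derivative_mult_right has_derivative_snd has_derivative_ident)
      then show ?thesis
        by (rule has_derivative_eq_rhs) (auto simp: P_def Q_def inner_add_left algebra_simps)
    qed
    define DP where "DP = (\<lambda>v. (l z *\<^sub>R ((2 * a) *\<^sub>R fst v + snd v *\<^sub>R r z)
        + (A * (6 * max 0 (\<psi> z)) * (p z \<bullet> fst v + q z * snd v)) *\<^sub>R p z)
        + ((2 * G' (fst z \<bullet> fst z + (- \<rho>\<^sup>2))) *\<^sub>R fst v
        + (2 * (G'' (fst z \<bullet> fst z + (- \<rho>\<^sup>2)) * (2 * (fst z \<bullet> fst v)))) *\<^sub>R fst z))"
    have dP: "(P has_derivative DP) (at z)"
      unfolding P_def[abs_def] DP_def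
      by (intro has_derivative_add has_derivative_scaleR dl p' zO dG' has_derivative_fst has_derivative_ident)
    have td: "time_deriv \<phi> z = Q z" "space_grad \<phi> z = P z" "space_hess \<phi> z = (\<chi> i j. DP (axis i 1, 0) $ j)"
      by (rule test_function_derivatives[OF d\<phi> zO dP], assumption)+
    have G0: "G' (fst z \<bullet> fst z + (- \<rho>\<^sup>2)) = 0" "G'' (fst z \<bullet> fst z + (- \<rho>\<^sup>2)) = 0"
      using G(5,6)[OF neg] by auto
    have grad: "space_grad \<phi> z = l z *\<^sub>R p z" unfolding td(2) P_def G0 by simp
    have ax: "axis i (1::real) $ j = (if i = j then 1 else 0)" for i j :: 'n
      by (simp add: axis_def)
    have hess: "space_hess \<phi> z = (\<chi> i j. A * (6 * max 0 (\<psi> z)) * (p z $ i * p z $ j) + (if i = j then l z * (2 * a) else 0))"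
      unfolding td(3) DP_def G0 by (simp add: vec_eq_iff inner_axis ax)
    have test: "(space_grad \<phi> z \<noteq> 0 \<longrightarrow>
           time_deriv \<phi> z \<le> \<mu>\<alpha> \<N> \<alpha> (space_grad \<phi> z) *
             (F\<alpha> \<N> \<alpha> (space_hess \<phi> z) (space_grad \<phi> z) + c * norm (space_grad \<phi> z))) \<and>
        (space_grad \<phi> z = 0 \<and> space_hess \<phi> z = 0 \<longrightarrow> time_deriv \<phi> z \<le> 0)"
      using sub C2 zO glob unfolding viscosity_subsolution_def by auto
    show False
    proof (cases "\<psi> z \<le> 0")
      case True
      \<comment> \<open>The cube contributes neither gradient nor Hessian here, so the degenerate
        clause of the definition applies; it asks for a nonpositive time derivative, against the
        drift \<open>\<kappa>\<close>.\<close>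
      then have "l z = 0" by (simp add: l_def)
      then have "space_grad \<phi> z = 0" "space_hess \<phi> z = 0"
        using True by (auto simp: grad hess vec_eq_iff)
      moreover have "0 < time_deriv \<phi> z" unfolding td(1) Q_def using \<kappa>(1) G(8)[of "snd z + (- T)"] \<open>l z = 0\<close> by simp
      ultimately show False using test by auto
    next
      case False
      then have l: "0 < l z" using A(1) by (simp add: l_def)
      have sup: "p z \<noteq> 0" "\<mu>\<alpha> \<N> \<alpha> (p z) * (2 * a * trace (A_matrix \<N> \<alpha> (p z /\<^sub>R norm (p z))) + c * norm (p z)) \<le> q z"
        using super[of "fst z" "snd z"] zt False \<open>\<psi> z < s1\<close> s1(2) by auto
      have nrm: "(l z *\<^sub>R p z) /\<^sub>R norm (l z *\<^sub>R p z) = p z /\<^sub>R norm (p z)"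
        using l by (simp add: field_simps)
      \<comment> \<open>The rank-one part is rescaled to the actual gradient
        \<open>l z *\<^sub>R p z\<close>, as the formula for \<open>F\<alpha>\<close>
        requires.\<close>
      have hess': "space_hess \<phi> z = (\<chi> i j. A * (6 * max 0 (\<psi> z)) / (l z)\<^sup>2 * ((l z *\<^sub>R p z) $ i * (l z *\<^sub>R p z) $ j)
          + (if i = j then l z * (2 * a) else 0))"
        unfolding hess using l by (simp add: vec_eq_iff power2_eq_square)
      have F: "F\<alpha> \<N> \<alpha> (space_hess \<phi> z) (space_grad \<phi> z) = l z * (2 * a) * trace (A_matrix \<N> \<alpha> (p z /\<^sub>R norm (p z)))"
        unfolding grad hess' F\<alpha>_rank_one_plus_scalar nrm ..
      have "time_deriv \<phi> z \<le> \<mu>\<alpha> \<N> \<alpha> (space_grad \<phi> z) *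
             (F\<alpha> \<N> \<alpha> (space_hess \<phi> z) (space_grad \<phi> z) + c * norm (space_grad \<phi> z))"
        using test sup(1) l by (simp add: grad)
      also have "\<dots> = l z * (\<mu>\<alpha> \<N> \<alpha> (p z) * (2 * a * trace (A_matrix \<N> \<alpha> (p z /\<^sub>R norm (p z))) + c * norm (p z)))"
        unfolding F unfolding grad using l by (simp add: \<mu>\<alpha>_scaleR algebra_simps)
      also have "\<dots> \<le> l z * q z" using sup(2) l by simp
      finally show False unfolding td(1) Q_def using \<kappa>(1) G(8)[of "snd z + (- T)"] by simp
    qed
  qed
  from this[of "(x, t)"] have "u (x, t) \<le> \<phi> (x, t)" using xt by simp
  moreover have "x \<bullet> x \<le> \<rho>\<^sup>2" using xt(1) power_mono[of "norm x" \<rho> 2] by (simp add: power2_norm_eq_inner)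
  ultimately have "u (x, t) \<le> - e + \<kappa> * t" using xt G(4) by (simp add: \<phi>_def)
  also have "\<dots> \<le> - e + \<kappa> * T" using \<kappa>(1) xt(3) by simp
  finally show ?thesis using \<kappa>(2) by simp
qed

section \<open>Moving balls and half-spaces\<close>

lemma C2_on_snd_compose:
  fixes g :: "real \<Rightarrow> real"
  assumes "\<And>t. 0 < t \<Longrightarrow> (g has_real_derivative g' t) (at t)" "\<And>t. 0 < t \<Longrightarrow> (g' has_real_derivative g'' t) (at t)"
    "continuous_on {0<..} g''"
  shows "C2_on (open_halfspace :: ((real^'n) \<times> real) set) (\<lambda>w. g (snd w))"
proof (rule C2_on_compose[where g = g and f = snd and g' = g' and g'' = g''])
  show "C2_on (open_halfspace :: ((real^'n) \<times> real) set) snd"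
    by (intro C2_on_bounded_linear bounded_linear_snd)
  show "continuous_on (snd ` (open_halfspace :: ((real^'n) \<times> real) set)) g''"
    by (rule continuous_on_subset[OF assms(3)]) auto
qed (use assms in auto)

text \<open>One family serves both kinds of barrier: \<open>a = 1\<close> with \<open>b1\<close> a
  multiple of the velocity gives moving balls in expanded form, and \<open>a = 0\<close> gives
  moving half-spaces.\<close>

lemma quadratic_barrier:
  fixes a :: real and b0 b1 :: "real^'n" and g g' g'' h h' h'' :: "real \<Rightarrow> real"
  assumes g: "\<And>t. 0 < t \<Longrightarrow> (g has_real_derivative g' t) (at t)" "\<And>t. 0 < t \<Longrightarrow> (g' has_real_derivative g'' t) (at t)"
    "continuous_on {0<..} g''" "continuous_on {0..} g"
    and h: "\<And>t. 0 < t \<Longrightarrow> (h has_real_derivative h' t) (at t)" "\<And>t. 0 < t \<Longrightarrow> (h' has_real_derivative h'' t) (at t)"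
    "continuous_on {0<..} h''" "continuous_on {0..} h"
  defines "\<psi> \<equiv> \<lambda>w. a * (fst w \<bullet> fst w) + (fst w \<bullet> b0 + (g (snd w) * (fst w \<bullet> b1) + h (snd w)))"
    and "p \<equiv> \<lambda>w. (2 * a) *\<^sub>R fst w + (b0 + g (snd w) *\<^sub>R b1)"
    and "q \<equiv> \<lambda>w. g' (snd w) * (fst w \<bullet> b1) + h' (snd w)"
  shows "C2_on open_halfspace \<psi>" "continuous_on closed_halfspace \<psi>"
    "\<And>w. w \<in> open_halfspace \<Longrightarrow> (\<psi> has_derivative (\<lambda>v. p w \<bullet> fst v + q w * snd v)) (at w)"
    "\<And>w. w \<in> open_halfspace \<Longrightarrow> (p has_derivative (\<lambda>v. (2 * a) *\<^sub>R fst v + snd v *\<^sub>R (g' (snd w) *\<^sub>R b1))) (at w)"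
proof -
  have lin: "C2_on open_halfspace (\<lambda>w :: (real^'n) \<times> real. fst w \<bullet> b)" for b
    by (intro C2_on_bounded_linear bounded_linear_compose[OF bounded_linear_inner_left bounded_linear_fst])
  show "C2_on open_halfspace \<psi>" unfolding \<psi>_def
    by (intro C2_on_add C2_on_cmult C2_on_norm_fst C2_on_mult lin C2_on_snd_compose[OF g(1-3)] C2_on_snd_compose[OF h(1-3)])
  show "continuous_on closed_halfspace \<psi>" unfolding \<psi>_def
    by (intro continuous_intros continuous_on_compose2[OF g(4)] continuous_on_compose2[OF h(4)]) auto
  fix w :: "(real^'n) \<times> real" assume "w \<in> open_halfspace"
  then have w: "0 < snd w" by auto
  have sn: "(snd has_derivative snd) (at w)" by (intro bounded_linear_imp_has_derivative bounded_linear_snd)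
  have dg: "((\<lambda>w. g (snd w)) has_derivative (\<lambda>v. g' (snd w) * snd v)) (at w)"
    using has_derivative_compose[OF sn g(1)[OF w, unfolded has_field_derivative_def]] .
  have dh: "((\<lambda>w. h (snd w)) has_derivative (\<lambda>v. h' (snd w) * snd v)) (at w)"
    using has_derivative_compose[OF sn h(1)[OF w, unfolded has_field_derivative_def]] .
  show "(\<psi> has_derivative (\<lambda>v. p w \<bullet> fst v + q w * snd v)) (at w)" unfolding \<psi>_def
    by (rule derivative_eq_intros dg dh refl)+
       (auto simp: p_def q_def inner_add_left inner_commute algebra_simps)
  show "(p has_derivative (\<lambda>v. (2 * a) *\<^sub>R fst v + snd v *\<^sub>R (g' (snd w) *\<^sub>R b1))) (at w)" unfolding p_def
    by (rule derivative_eq_intros dg refl)+ (auto simp: algebra_simps)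
qed

text \<open>The barrier is the squared distance to the moving centre minus
  \<open>(R t)\<^sup>2\<close>. At distance \<open>r\<close> in direction \<open>e\<close> its
  gradient is \<open>2 * r\<close> times \<open>e\<close>, and its Hessian is twice the identity.
  With \<open>s0 = 1\<close> the differential inequality is asked only in the shell where
  \<open>r\<^sup>2\<close> exceeds \<open>(R t)\<^sup>2\<close> by at most 1.\<close>

lemma moving_ball_comparison:
  fixes u :: "(real^'n) \<times> real \<Rightarrow> real" and x0 v :: "real^'n" and \<gamma> \<gamma>' \<gamma>'' R R' R'' :: "real \<Rightarrow> real"
  assumes cont: "continuous_on closed_halfspace u"
    and sub: "viscosity_subsolution \<N> \<alpha> c u"
    and \<gamma>: "\<And>t. 0 < t \<Longrightarrow> (\<gamma> has_real_derivative \<gamma>' t) (at t)" "\<And>t. 0 < t \<Longrightarrow> (\<gamma>' has_real_derivative \<gamma>'' t) (at t)"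
      "continuous_on {0<..} \<gamma>''" "continuous_on {0..} \<gamma>"
    and R: "\<And>t. 0 < t \<Longrightarrow> (R has_real_derivative R' t) (at t)" "\<And>t. 0 < t \<Longrightarrow> (R' has_real_derivative R'' t) (at t)"
      "continuous_on {0<..} R''" "continuous_on {0..} R"
    and T: "0 < T" and Rpos: "\<And>t. 0 \<le> t \<Longrightarrow> t \<le> T + 1 \<Longrightarrow> 0 < R t"
    and super: "\<And>t r e. 0 < t \<Longrightarrow> t < T + 1 \<Longrightarrow> norm e = 1 \<Longrightarrow> R t \<le> r \<Longrightarrow> r\<^sup>2 \<le> (R t)\<^sup>2 + 1 \<Longrightarrow>
        \<mu>\<alpha> \<N> \<alpha> e * (trace (A_matrix \<N> \<alpha> e) + c * r) \<le> - r * \<gamma>' t * (e \<bullet> v) - R t * R' t"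
    and init: "\<And>x. dist x (x0 + \<gamma> 0 *\<^sub>R v) \<le> R 0 \<Longrightarrow> u (x, 0) < 0"
    and xt: "0 \<le> t" "t \<le> T" "dist x (x0 + \<gamma> t *\<^sub>R v) \<le> R t"
  shows "u (x, t) < 0"
proof -
  define h where "h t = (norm x0)\<^sup>2 + 2 * \<gamma> t * (x0 \<bullet> v) + (\<gamma> t)\<^sup>2 * (norm v)\<^sup>2 - (R t)\<^sup>2" for t
  define h' where "h' t = 2 * \<gamma>' t * (x0 \<bullet> v) + 2 * \<gamma> t * \<gamma>' t * (norm v)\<^sup>2 - 2 * R t * R' t" for t
  define h'' where "h'' t = 2 * \<gamma>'' t * (x0 \<bullet> v) + 2 * (\<gamma>' t * \<gamma>' t + \<gamma> t * \<gamma>'' t) * (norm v)\<^sup>2 - 2 * (R' t * R' t + R t * R'' t)" for t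
  have contd: "continuous_on {0<..} f" if "\<And>t. 0 < t \<Longrightarrow> (f has_real_derivative f' t) (at t)" for f f' :: "real \<Rightarrow> real"
    using that by (auto intro!: continuous_at_imp_continuous_on DERIV_isCont)
  define \<psi> where "\<psi> w = 1 * (fst w \<bullet> fst w) + (fst w \<bullet> ((- 2) *\<^sub>R x0) + (\<gamma> (snd w) * (fst w \<bullet> ((- 2) *\<^sub>R v)) + h (snd w)))" for w
  define p where "p w = (2 * 1) *\<^sub>R fst w + ((- 2) *\<^sub>R x0 + \<gamma> (snd w) *\<^sub>R ((- 2) *\<^sub>R v))" for w
  define q where "q w = \<gamma>' (snd w) * (fst w \<bullet> ((- 2) *\<^sub>R v)) + h' (snd w)" for w
  have hd: "(h has_real_derivative h' t) (at t)" "(h' has_real_derivative h'' t) (at t)" if "0 < t" for t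
    unfolding h_def[abs_def] h'_def[abs_def] h''_def
    by (rule derivative_eq_intros \<gamma>(1,2) R(1,2) refl that | simp add: algebra_simps power2_eq_square)+
  have hc: "continuous_on {0<..} h''" "continuous_on {0..} h"
    unfolding h_def[abs_def] h''_def[abs_def]
    by (intro continuous_intros \<gamma> R contd[OF \<gamma>(1)] contd[OF \<gamma>(2)] contd[OF R(1)] contd[OF R(2)]; simp)+
  note qb = quadratic_barrier[where a = 1 and ?b0.0 = "(- 2) *\<^sub>R x0" and ?b1.0 = "(- 2) *\<^sub>R v", OF \<gamma> hd hc,
      folded \<psi>_def[abs_def] p_def[abs_def] q_def[abs_def], folded \<psi>_def p_def q_def]
  define y where "y w = fst w - x0 - \<gamma> (snd w) *\<^sub>R v" for w
  have \<psi>y: "\<psi> w = (norm (y w))\<^sup>2 - (R (snd w))\<^sup>2" for w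
    unfolding \<psi>_def y_def h_def power2_norm_eq_inner
    by (simp add: inner_simps inner_commute algebra_simps power2_eq_square)
  have py: "p w = 2 *\<^sub>R y w" for w by (simp add: p_def y_def algebra_simps)
  have qy: "q w = - 2 * \<gamma>' (snd w) * (y w \<bullet> v) - 2 * R (snd w) * R' (snd w)" for w
    unfolding q_def y_def h'_def power2_norm_eq_inner
    by (simp add: inner_simps inner_commute algebra_simps power2_eq_square)
  have dy: "dist x (x0 + \<gamma> t *\<^sub>R v) = norm (y (x, t))" for x t by (simp add: y_def dist_norm diff_diff_eq)
  have \<psi>le: "\<psi> (x, t) \<le> 0 \<longleftrightarrow> dist x (x0 + \<gamma> t *\<^sub>R v) \<le> R t" if "0 \<le> t" "t \<le> T + 1" for x t
    using Rpos[OF that] by (simp add: \<psi>y dy power_mono_iff)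
  have "\<exists>M. \<forall>t\<in>{0..T+1}. norm x0 + \<bar>\<gamma> t\<bar> * norm v + R t \<le> M"
  proof -
    have "compact ((\<lambda>t. norm x0 + \<bar>\<gamma> t\<bar> * norm v + R t) ` {0..T+1})"
      by (intro compact_continuous_image continuous_intros continuous_on_subset[OF \<gamma>(4)] continuous_on_subset[OF R(4)]) auto
    from compact_imp_bounded[OF this] obtain M where M: "\<forall>y\<in>(\<lambda>t. norm x0 + \<bar>\<gamma> t\<bar> * norm v + R t) ` {0..T+1}. norm y \<le> M"
      unfolding bounded_iff by (rule exE)
    show ?thesis
    proof (intro exI[of _ M] ballI)
      fix t assume "t \<in> {0..T+1}"
      then have "norm (norm x0 + \<bar>\<gamma> t\<bar> * norm v + R t) \<le> M" using M by blast
      then show "norm x0 + \<bar>\<gamma> t\<bar> * norm v + R t \<le> M" by simp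
    qed
  qed
  then obtain M where M0: "\<forall>t\<in>{0..T+1}. norm x0 + \<bar>\<gamma> t\<bar> * norm v + R t \<le> M" ..
  have M: "norm x0 + \<bar>\<gamma> t\<bar> * norm v + R t \<le> M" if "0 \<le> t" "t \<le> T + 1" for t
    using M0 that by simp
  \<comment> \<open>All moving balls up to time \<open>T + 1\<close> lie strictly inside this
    radius, so the lateral condition is vacuous.\<close>
  define \<rho> where "\<rho> = \<bar>M\<bar> + 1"
  have small: "norm x < \<rho>" if "0 \<le> t" "t \<le> T + 1" "\<psi> (x, t) \<le> 0" for x t
  proof -
    have "norm (x - x0 - \<gamma> t *\<^sub>R v) \<le> R t" using that \<psi>le by (simp add: dy y_def)
    then have "norm x \<le> R t + norm (x0 + \<gamma> t *\<^sub>R v)"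
      using norm_triangle_ineq[of "x - x0 - \<gamma> t *\<^sub>R v" "x0 + \<gamma> t *\<^sub>R v"] by simp
    then show ?thesis using M[OF that(1,2)] norm_triangle_ineq[of x0 "\<gamma> t *\<^sub>R v"] by (simp add: \<rho>_def)
  qed
  show ?thesis
  proof (rule barrier_comparison[OF cont sub qb T, where \<rho> = \<rho> and ?s0.0 = 1])
    fix x t assume t: "0 < t" "t < T + 1" and pos: "0 < \<psi> (x, t)" "\<psi> (x, t) < 1"
    define r where "r = norm (y (x, t))"
    have Rt: "0 < R t" using t by (intro Rpos) auto
    have "(R t)\<^sup>2 \<le> r\<^sup>2" "r\<^sup>2 \<le> (R t)\<^sup>2 + 1" using pos by (auto simp: \<psi>y r_def)
    then have r: "R t \<le> r" "r\<^sup>2 \<le> (R t)\<^sup>2 + 1"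
      by (auto simp: r_def intro: power2_le_imp_le[OF _ norm_ge_zero])
    then have y0: "y (x, t) \<noteq> 0" "0 < r" using Rt by (auto simp: r_def)
    define e where "e = y (x, t) /\<^sub>R r"
    have e: "norm e = 1" "y (x, t) = r *\<^sub>R e" using y0 by (auto simp: e_def r_def)
    have pe: "p (x, t) = (2 * r) *\<^sub>R e" using e by (simp add: py)
    have np: "norm (p (x, t)) = 2 * r" "p (x, t) /\<^sub>R norm (p (x, t)) = e"
      using y0 e(1) by (simp_all add: pe)
    have "\<mu>\<alpha> \<N> \<alpha> (p (x, t)) * (2 * 1 * trace (A_matrix \<N> \<alpha> e) + c * (2 * r))
        = 2 * (\<mu>\<alpha> \<N> \<alpha> e * (trace (A_matrix \<N> \<alpha> e) + c * r))"
      unfolding pe using y0 by (simp add: \<mu>\<alpha>_scaleR algebra_simps)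
    also have "\<dots> \<le> 2 * (- r * \<gamma>' t * (e \<bullet> v) - R t * R' t)"
      by (intro mult_left_mono super t e r) auto
    also have "\<dots> = q (x, t)" by (simp add: qy e(2))
    finally show "p (x, t) \<noteq> 0 \<and> \<mu>\<alpha> \<N> \<alpha> (p (x, t)) * (2 * 1 * trace (A_matrix \<N> \<alpha> (p (x, t) /\<^sub>R norm (p (x, t))))
          + c * norm (p (x, t))) \<le> q (x, t)"
      unfolding np using y0 e by (auto simp: py)
  next
    fix x assume "\<psi> (x, 0) \<le> 0"
    then show "u (x, 0) < 0" using \<psi>le[of 0 x] T by (intro init) auto
  next
    fix x t assume "\<rho> \<le> norm x" "0 \<le> t" "t \<le> T + 1" "\<psi> (x, t) \<le> 0"
    then show "u (x, t) < 0" using small by force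
  next
    show "\<psi> (x, t) \<le> 0" using \<psi>le xt by auto
    then show "norm x \<le> \<rho>" using small[of t x] xt by auto
  qed (use xt in \<open>auto simp: \<rho>_def\<close>)
qed

text \<open>A ball on which \<open>u\<close> is negative shrinks at speed at most \<open>L\<close>.
  If it is disjoint from the ball of radius \<open>R0\<close> at time 0 and keeps a radius of at
  least 1 until \<open>T + 1\<close>, then \<open>u\<close> is still negative at its centre.\<close>

lemma subsolution_finite_propagation:
  fixes \<N> :: "real^'n \<Rightarrow> real"
  assumes M: "\<And>e. norm e = 1 \<Longrightarrow> 0 \<le> \<mu>\<alpha> \<N> \<alpha> e" "\<And>e. norm e = 1 \<Longrightarrow> \<mu>\<alpha> \<N> \<alpha> e \<le> M" "0 < M"
    and C: "0 < C" "\<And>e. norm e = 1 \<Longrightarrow> \<bar>trace (A_matrix \<N> \<alpha> e)\<bar> \<le> C" and c: "0 < c"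
    and cont: "continuous_on closed_halfspace u" and sub: "viscosity_subsolution \<N> \<alpha> c u"
    and init: "\<And>x. R0 < norm x \<Longrightarrow> u (x, 0) < 0" and T: "0 < T"
  obtains R1 where "\<And>x t. R1 \<le> norm x \<Longrightarrow> 0 \<le> t \<Longrightarrow> t \<le> T \<Longrightarrow> u (x, t) < 0"
proof -
  \<comment> \<open>As \<open>1 \<le> R t\<close>, the shell condition gives
    \<open>r \<le> 2 * R t\<close>, and trace and forcing together are at most
    \<open>(C + 2 * c) * R t\<close>.\<close>
  define L where "L = M * (C + 2 * c)"
  have L: "0 < L" using M C c by (simp add: L_def)
  define r0 where "r0 = L * (T + 1) + 1"
  define R where "R t = r0 - L * t" for t
  have R1: "1 \<le> R t" if "t \<le> T + 1" for t
    using mult_left_mono[OF that, of L] L by (simp add: R_def r0_def)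
  have "u (x, t) < 0" if x: "R0 + r0 + 1 \<le> norm x" and t: "0 \<le> t" "t \<le> T" for x t
  proof (rule moving_ball_comparison[OF cont sub, where \<gamma> = "\<lambda>_. 0" and \<gamma>' = "\<lambda>_. 0" and \<gamma>'' = "\<lambda>_. 0" and
        R = R and R' = "\<lambda>_. - L" and R'' = "\<lambda>_. 0" and v = 0 and ?x0.0 = x and T = T])
    fix t r :: real and e :: "real^'n" assume a: "t < T + 1" "norm e = 1" "R t \<le> r" "r\<^sup>2 \<le> (R t)\<^sup>2 + 1"
    have Rt: "1 \<le> R t" using a by (intro R1) auto
    have "r\<^sup>2 \<le> (2 * R t)\<^sup>2" using a(4) one_le_power[OF Rt, of 2] by (simp add: power_mult_distrib)
    then have r: "r \<le> 2 * R t" by (rule power2_le_imp_le) (use Rt in simp)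
    have "C \<le> C * R t" using mult_left_mono[OF Rt, of C] C(1) by simp
    moreover have "c * r \<le> c * (2 * R t)" using r c by (intro mult_left_mono) auto
    ultimately have "trace (A_matrix \<N> \<alpha> e) + c * r \<le> C * R t + c * (2 * R t)"
      using C(2)[OF a(2)] by linarith
    also have "\<dots> = (C + 2 * c) * R t" by (simp add: algebra_simps)
    finally have "\<mu>\<alpha> \<N> \<alpha> e * (trace (A_matrix \<N> \<alpha> e) + c * r) \<le> \<mu>\<alpha> \<N> \<alpha> e * ((C + 2 * c) * R t)"
      by (rule mult_left_mono) (rule M(1)[OF a(2)])
    also have "\<dots> \<le> M * ((C + 2 * c) * R t)"
      using C(1) c Rt by (intro mult_right_mono M(2)[OF a(2)]) auto
    finally have "\<mu>\<alpha> \<N> \<alpha> e * (trace (A_matrix \<N> \<alpha> e) + c * r) \<le> M * ((C + 2 * c) * R t)" .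
    then show "\<mu>\<alpha> \<N> \<alpha> e * (trace (A_matrix \<N> \<alpha> e) + c * r) \<le> - r * 0 * (e \<bullet> 0) - R t * (- L)"
      by (simp add: L_def algebra_simps)
  next
    fix y assume "dist y (x + 0 *\<^sub>R 0) \<le> R 0"
    then have "norm x - norm y \<le> r0" using norm_triangle_ineq2[of x y] by (simp add: R_def dist_norm norm_minus_commute)
    then show "u (y, 0) < 0" using x by (intro init) auto
  next
    show "dist x (x + 0 *\<^sub>R 0) \<le> R t" using R1[of t] t by simp
    show "0 < R t" if "0 \<le> t" "t \<le> T + 1" for t using R1[of t] that by simp
    show "(R has_real_derivative - L) (at t)" for t unfolding R_def[abs_def] by (auto intro!: derivative_eq_intros)
    show "continuous_on {0..} R" unfolding R_def[abs_def] by (intro continuous_intros)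
  qed (use t T in auto)
  then show ?thesis by (rule that)
qed

text \<open>A half-space has no curvature, so its barrier satisfies the equation exactly. If
  \<open>x\<close> were too far out, the half-space with \<open>x\<close> on its boundary at time
  \<open>t\<close> would, traced back to time 0, miss the ball of radius \<open>R0\<close>, and
  comparison would give \<open>u (x, t) < 0\<close>. Half-spaces are unbounded, so the lateral
  condition has to come from finite propagation.\<close>

lemma subsolution_planar_bound:
  fixes \<N> :: "real^'n \<Rightarrow> real" and p :: "real^'n"
  assumes M: "\<And>e. norm e = 1 \<Longrightarrow> 0 \<le> \<mu>\<alpha> \<N> \<alpha> e" "\<And>e. norm e = 1 \<Longrightarrow> \<mu>\<alpha> \<N> \<alpha> e \<le> M" "0 < M"
    and C: "0 < C" "\<And>e. norm e = 1 \<Longrightarrow> \<bar>trace (A_matrix \<N> \<alpha> e)\<bar> \<le> C" and c: "0 < c"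
    and cont: "continuous_on closed_halfspace u" and sub: "viscosity_subsolution \<N> \<alpha> c u"
    and init: "\<And>x. R0 < norm x \<Longrightarrow> u (x, 0) < 0"
    and p: "norm p = 1" and t: "0 \<le> t" and u: "0 \<le> u (x, t)"
  shows "x \<bullet> p \<le> c * \<mu>\<alpha> \<N> \<alpha> p * t + R0"
proof (rule ccontr)
  assume far: "\<not> x \<bullet> p \<le> c * \<mu>\<alpha> \<N> \<alpha> p * t + R0"
  define k where "k = c * \<mu>\<alpha> \<N> \<alpha> p"
  define T where "T = t + 1"
  have T: "0 < T" using t by (simp add: T_def)
  obtain R1 where R1: "\<And>x t. R1 \<le> norm x \<Longrightarrow> 0 \<le> t \<Longrightarrow> t \<le> T + 1 \<Longrightarrow> u (x, t) < 0"
    by (rule subsolution_finite_propagation[OF M C c cont sub init, where T = "T + 1"]) (use T in auto)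
  define d where "d = x \<bullet> p - k * t"
  have d: "R0 < d" using far by (simp add: d_def k_def)
  define \<psi> where "\<psi> w = 0 * (fst w \<bullet> fst w) + (fst w \<bullet> (- p) + (0 * (fst w \<bullet> 0) + (d + k * snd w)))" for w
  define P where "P w = (2 * 0) *\<^sub>R fst w + (- p + 0 *\<^sub>R 0)" for w :: "(real^'n) \<times> real"
  define Q where "Q w = 0 * (fst w \<bullet> 0) + k" for w :: "(real^'n) \<times> real"
  note qb = quadratic_barrier[where g = "\<lambda>_. 0" and g' = "\<lambda>_. 0" and g'' = "\<lambda>_. 0" and h = "\<lambda>s. d + k * s"
      and h' = "\<lambda>_. k" and h'' = "\<lambda>_. 0" and a = 0 and ?b0.0 = "- p" and ?b1.0 = 0,
      folded \<psi>_def[abs_def] P_def[abs_def] Q_def[abs_def], folded \<psi>_def P_def Q_def]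
  have "u (x, t) < 0"
  proof (rule barrier_comparison[OF cont sub qb T, where \<rho> = "max R1 (norm x) + \<bar>R1\<bar> + 1" and ?s0.0 = 1])
    fix x t
    show "P (x, t) \<noteq> 0 \<and> \<mu>\<alpha> \<N> \<alpha> (P (x, t)) * (2 * 0 * trace (A_matrix \<N> \<alpha> (P (x, t) /\<^sub>R norm (P (x, t))))
          + c * norm (P (x, t))) \<le> Q (x, t)"
      using p by (auto simp: P_def Q_def k_def)
  next
    fix y assume "\<psi> (y, 0) \<le> 0"
    then have "d \<le> y \<bullet> p" by (simp add: \<psi>_def)
    also have "\<dots> \<le> norm y" using norm_cauchy_schwarz[of y p] p by simp
    finally show "u (y, 0) < 0" using d by (intro init) simp
  next
    fix y :: "real^'n" and s assume "max R1 (norm x) + \<bar>R1\<bar> + 1 \<le> norm y" "0 \<le> s" "s \<le> T + 1"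
    then show "u (y, s) < 0" by (intro R1) auto
  next
    show "\<psi> (x, t) \<le> 0" by (simp add: \<psi>_def d_def)
  qed (use t in \<open>auto simp: T_def intro!: derivative_eq_intros continuous_intros\<close>)
  with u show False by simp
qed

text \<open>The translating ball is a strict subflow although \<open>W\<close> need not be smooth: its normal velocity in direction \<open>e\<close> is
  bounded by the support function of \<open>W\<close>, hence by \<open>c \<Phi>(e)\<close>. The radius grows so slowly that the
  curvature becomes negligible while the average velocity stays close to \<open>v\<close>.\<close>

lemma supersolution_contains_moving_ball:
  fixes \<N> :: "real^'n \<Rightarrow> real"
  assumes m: "0 < m" "\<And>e. norm e = 1 \<Longrightarrow> m \<le> \<mu>\<alpha> \<N> \<alpha> e"
    and C: "0 < C" "\<And>e. norm e = 1 \<Longrightarrow> \<bar>trace (A_matrix \<N> \<alpha> e)\<bar> \<le> C" and c: "0 < c"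
    and cont: "continuous_on closed_halfspace u" and sup: "viscosity_supersolution \<N> \<alpha> c u"
    and R0: "2 * C / c \<le> R0" and init: "\<And>x. norm x \<le> R0 \<Longrightarrow> 0 < u (x, 0)"
    and \<delta>: "0 < \<delta>" "\<delta> \<le> 1" and v: "v \<in> Wulff_shape \<N> \<alpha> c" and t: "0 \<le> t"
  defines "\<beta> \<equiv> m * c * \<delta> / 2"
  shows "0 < u (((1 - \<delta>/2) * t - C / (c * \<beta>) * (ln (R0 + \<beta> * t) - ln R0)) *\<^sub>R v, t)"
proof -
  define T where "T = t + 1"
  define R where "R t = R0 + \<beta> * t" for t
  \<comment> \<open>The logarithm integrates \<open>C / (c * R t)\<close>, the fraction of the speed
    given up to curvature; subtracting \<open>ln R0\<close> makes
    \<open>\<gamma> 0 = 0\<close>.\<close>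
  define \<gamma> where "\<gamma> t = (1 - \<delta>/2) * t - C / (c * \<beta>) * (ln (R t) - ln R0)" for t
  define \<gamma>' where "\<gamma>' t = 1 - \<delta>/2 - C / (c * R t)" for t
  define \<gamma>'' where "\<gamma>'' t = C * \<beta> / (c * (R t)\<^sup>2)" for t
  have \<beta>: "0 < \<beta>" using m(1) c \<delta> by (simp add: \<beta>_def)
  have "0 < 2 * C / c" using C c by simp
  then have R0': "0 < R0" using R0 by linarith
  have Rge: "R0 \<le> R t" if "0 \<le> t" for t using that \<beta> by (simp add: R_def)
  then have Rpos: "0 < R t" if "0 \<le> t" for t using R0' that by (metis less_le_trans)
  have "(\<lambda>w. - u w) (\<gamma> t *\<^sub>R v, t) < 0"
  proof (rule moving_ball_comparison[OF _ viscosity_supersolution_uminus[OF sup], where \<gamma> = \<gamma> and \<gamma>' = \<gamma>' and \<gamma>'' = \<gamma>'' and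
        R = R and R' = "\<lambda>_. \<beta>" and R'' = "\<lambda>_. 0" and v = v and ?x0.0 = 0 and T = T])
    show "continuous_on closed_halfspace (\<lambda>w. - u w)" by (intro continuous_intros cont)
    have dR: "(R has_real_derivative \<beta>) (at t)" for t unfolding R_def[abs_def] by (auto intro!: derivative_eq_intros)
    then show "(R has_real_derivative \<beta>) (at t)" for t .
    show "(\<gamma> has_real_derivative \<gamma>' t) (at t)" if "0 < t" for t
      unfolding \<gamma>_def[abs_def] \<gamma>'_def using Rpos[of t] that \<beta> c
      by (auto intro!: derivative_eq_intros dR simp: field_simps)
    show "(\<gamma>' has_real_derivative \<gamma>'' t) (at t)" if "0 < t" for t
      unfolding \<gamma>'_def[abs_def] \<gamma>''_def using Rpos[of t] that c
      by (auto intro!: derivative_eq_intros dR simp: field_simps power2_eq_square)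
    have cR: "continuous_on {0..} R" unfolding R_def[abs_def] by (intro continuous_intros)
    then show "continuous_on {0..} R" .
    have Rne: "R t \<noteq> 0" if "0 \<le> t" for t using Rpos[OF that] by simp
    show "continuous_on {0..} \<gamma>" unfolding \<gamma>_def[abs_def]
      using Rne by (intro continuous_intros cR) auto
    show "continuous_on {0<..} \<gamma>''" unfolding \<gamma>''_def[abs_def]
      using Rne c by (intro continuous_intros continuous_on_subset[OF cR]) auto
    show "0 < R t" if "0 \<le> t" for t using Rpos that .
    fix t r :: real and e :: "real^'n" assume a: "0 < t" "norm e = 1" "R t \<le> r"
    have Rt: "0 < R t" "R0 \<le> R t" using Rpos Rge a(1) by auto
    have r: "0 < r" using Rt a(3) by simp
    define k where "k = \<mu>\<alpha> \<N> \<alpha> e"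
    have k: "m \<le> k" "0 < k" using m a(2) unfolding k_def by force+
    have "e \<noteq> 0" using a(2) by auto
    have "e \<in> sphere 0 1" using a(2) by simp
    then have "v \<bullet> e \<le> c * \<Phi>\<alpha> \<N> \<alpha> e" using v unfolding Wulff_shape_def by blast
    then have ev: "e \<bullet> v \<le> c * k" using a(2) \<open>e \<noteq> 0\<close> by (simp add: \<Phi>\<alpha>_def k_def inner_commute)
    \<comment> \<open>The lower bound on \<open>R0\<close> keeps the speed factor nonnegative, so
      that the bound on \<open>e \<bullet> v\<close> may be multiplied by it.\<close>
    have "c * (2 * C / c) \<le> c * R t" using R0 Rt(2) c by (intro mult_left_mono) auto
    then have "2 * C \<le> c * R t" using c by simp
    then have "C / (c * R t) \<le> 1/2" using c Rt by (simp add: field_simps)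
    then have g: "0 \<le> \<gamma>' t" using \<delta> unfolding \<gamma>'_def by linarith
    have 1: "r * \<gamma>' t * (e \<bullet> v) \<le> r * \<gamma>' t * (c * k)" using r g ev by (intro mult_left_mono) auto
    have "C \<le> C * r / R t" using C(1) a(3) Rt by (simp add: field_simps)
    then have 2: "k * (trace (A_matrix \<N> \<alpha> e)) \<le> k * (C * r / R t)"
      using C(2)[OF a(2)] k by (intro mult_left_mono) auto
    have "R t * \<beta> \<le> r * \<beta>" using a(3) \<beta> by simp
    also have "\<dots> = m * (r * c * \<delta> / 2)" by (simp add: \<beta>_def)
    also have "\<dots> \<le> k * (r * c * \<delta> / 2)" using k r c \<delta> by (intro mult_right_mono) auto
    finally have 3: "R t * \<beta> \<le> k * (r * c * \<delta> / 2)" .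
    \<comment> \<open>The forcing \<open>k * (c * r)\<close> is shared exactly among translation,
      curvature and growth of the radius: the shares \<open>\<gamma>' t\<close>,
      \<open>C / (c * R t)\<close> and \<open>\<delta> / 2\<close> sum to 1.\<close>
    have "r * \<gamma>' t * (c * k) + k * (C * r / R t) + k * (r * c * \<delta> / 2) = k * (c * r)"
      using c Rt by (simp add: \<gamma>'_def field_simps)
    with 1 2 3 have "k * trace (A_matrix \<N> \<alpha> e) + r * \<gamma>' t * (e \<bullet> v) + R t * \<beta> \<le> k * (c * r)" by linarith
    then show "\<mu>\<alpha> \<N> \<alpha> e * (trace (A_matrix \<N> \<alpha> e) + (- c) * r) \<le> - r * \<gamma>' t * (e \<bullet> v) - R t * \<beta>"
      by (simp add: k_def[symmetric] algebra_simps)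
  next
    fix x assume "dist x (0 + \<gamma> 0 *\<^sub>R v) \<le> R 0"
    then show "- u (x, 0) < 0" using init[of x] by (simp add: \<gamma>_def R_def)
  next
    show "dist (\<gamma> t *\<^sub>R v) (0 + \<gamma> t *\<^sub>R v) \<le> R t" using Rpos[OF t] by simp
  qed (use t in \<open>auto simp: T_def\<close>)
  then show ?thesis by (simp add: \<gamma>_def R_def)
qed

lemma moving_ball_speed_tendsto:
  fixes \<beta> R0 :: real
  assumes "0 < \<beta>"
  shows "((\<lambda>t. (s * t - k * (ln (R0 + \<beta> * t) - ln R0)) / t) \<longlongrightarrow> s) at_top"
proof -
  have top: "filterlim (\<lambda>t. R0 + \<beta> * t) at_top at_top"
    by (rule filterlim_tendsto_add_at_top[OF tendsto_const])
       (rule filterlim_tendsto_pos_mult_at_top[OF tendsto_const assms filterlim_ident])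
  have inv: "((\<lambda>t::real. 1 / t) \<longlongrightarrow> 0) at_top"
    using tendsto_inverse_0_at_top[OF filterlim_ident] by (simp add: inverse_eq_divide)
  have "((\<lambda>t. ln (R0 + \<beta> * t) / (R0 + \<beta> * t)) \<longlongrightarrow> 0) at_top"
    by (rule filterlim_compose[OF ln_x_over_x_tendsto_0 top])
  moreover have "((\<lambda>t. R0 * (1 / t) + \<beta>) \<longlongrightarrow> R0 * 0 + \<beta>) at_top" by (intro tendsto_intros inv)
  ultimately have "((\<lambda>t. s - k * (ln (R0 + \<beta> * t) / (R0 + \<beta> * t) * (R0 * (1 / t) + \<beta>) - ln R0 * (1 / t)))
      \<longlongrightarrow> s - k * (0 * (R0 * 0 + \<beta>) - ln R0 * 0)) at_top"
    by (intro tendsto_intros inv)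
  then have "((\<lambda>t. s - k * (ln (R0 + \<beta> * t) / (R0 + \<beta> * t) * (R0 * (1 / t) + \<beta>) - ln R0 * (1 / t))) \<longlongrightarrow> s) at_top"
    by simp
  moreover have "\<forall>\<^sub>F t in at_top. s - k * (ln (R0 + \<beta> * t) / (R0 + \<beta> * t) * (R0 * (1 / t) + \<beta>) - ln R0 * (1 / t))
      = (s * t - k * (ln (R0 + \<beta> * t) - ln R0)) / t"
    using eventually_gt_at_top[of 0] filterlim_at_top_dense[THEN iffD1, OF top, rule_format, of 0]
  proof eventually_elim
    case (elim t)
    then have "R0 * (1 / t) + \<beta> = (R0 + \<beta> * t) / t" by (simp add: field_simps)
    then show ?case using elim by (simp add: diff_divide_distrib right_diff_distrib)
  qed
  ultimately show ?thesis by (rule Lim_transform_eventually)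
qed

section \<open>The Wulff shape\<close>

lemma closed_segment_meets_frontier:
  fixes x y :: "'a::euclidean_space"
  assumes "x \<in> W" "y \<notin> W"
  obtains z where "z \<in> frontier W" "dist x z \<le> dist x y" "dist y z \<le> dist x y"
proof -
  have "closed_segment x y \<inter> frontier W \<noteq> {}"
    using assms by (intro connected_Int_frontier) auto
  then obtain z where "z \<in> closed_segment x y" "z \<in> frontier W" by blast
  then show ?thesis using that[of z] dist_in_closed_segment[of z x y] by (simp add: dist_commute)
qed

lemma ball_subset_if_infdist_frontier:
  fixes W :: "'a::euclidean_space set"
  assumes "x \<in> W" "\<epsilon> < infdist x (frontier W)"
  shows "cball x \<epsilon> \<subseteq> W"
proof
  fix y assume y: "y \<in> cball x \<epsilon>"
  show "y \<in> W"
  proof (rule ccontr)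
    assume "y \<notin> W"
    then obtain z where "z \<in> frontier W" "dist x z \<le> dist x y"
      using closed_segment_meets_frontier[OF assms(1)] by metis
    then show False using infdist_le[of z "frontier W" x] y assms(2) by simp
  qed
qed

lemma infdist_ge_if_ball_subset_interior:
  fixes W :: "'a::metric_space set"
  assumes "ball x d \<subseteq> W" "frontier W \<noteq> {}"
  shows "d \<le> infdist x (frontier W)"
  unfolding infdist_notempty[OF assms(2)]
proof (rule cINF_greatest[OF assms(2)])
  fix z assume "z \<in> frontier W"
  then have "z \<notin> interior W" by (simp add: frontier_def)
  moreover have "ball x d \<subseteq> interior W" using assms(1) by (simp add: interior_maximal)
  ultimately show "d \<le> dist x z" by (force simp: not_less)
qed

text \<open>The last part turns an additive error \<open>s\<close> in the support inequalities into
  a dilation, because \<open>s\<close> is at most \<open>s / (c * m)\<close> times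
  \<open>c * \<mu>\<alpha> \<N> \<alpha> p\<close>.\<close>

lemma
  fixes \<N> :: "real^'n \<Rightarrow> real" and x :: "real^'n"
  assumes \<mu>: "0 < m" "\<And>p. p \<noteq> 0 \<Longrightarrow> m \<le> \<mu>\<alpha> \<N> \<alpha> p" "\<And>p. p \<noteq> 0 \<Longrightarrow> \<mu>\<alpha> \<N> \<alpha> p \<le> M" and c: "0 < c"
  shows closed_Wulff_shape: "closed (Wulff_shape \<N> \<alpha> c)"
    and convex_Wulff_shape: "convex (Wulff_shape \<N> \<alpha> c)"
    and Wulff_shape_subset_cball: "Wulff_shape \<N> \<alpha> c \<subseteq> cball 0 (c * M)"
    and ball_subset_Wulff_shape: "cball 0 (c * m) \<subseteq> Wulff_shape \<N> \<alpha> c"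
    and Wulff_shape_scaling: "\<lbrakk>0 \<le> s; \<And>p. norm p = 1 \<Longrightarrow> x \<bullet> p \<le> c * \<mu>\<alpha> \<N> \<alpha> p + s\<rbrakk>
       \<Longrightarrow> x /\<^sub>R (1 + s / (c * m)) \<in> Wulff_shape \<N> \<alpha> c"
proof -
  have eq: "Wulff_shape \<N> \<alpha> c = (\<Inter>p\<in>sphere 0 1. {x. p \<bullet> x \<le> c * \<Phi>\<alpha> \<N> \<alpha> p})"
    by (auto simp: Wulff_shape_def inner_commute)
  show "closed (Wulff_shape \<N> \<alpha> c)" unfolding eq by (intro closed_INT ballI closed_halfspace_le)
  show "convex (Wulff_shape \<N> \<alpha> c)" unfolding eq by (intro convex_INT ballI convex_halfspace_le)
  have \<Phi>: "\<Phi>\<alpha> \<N> \<alpha> p = \<mu>\<alpha> \<N> \<alpha> p" "p \<noteq> 0" if "norm p = 1" for p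
    using that by (auto simp: \<Phi>\<alpha>_def)
  have W: "x \<in> Wulff_shape \<N> \<alpha> c \<longleftrightarrow> (\<forall>p. norm p = 1 \<longrightarrow> x \<bullet> p \<le> c * \<mu>\<alpha> \<N> \<alpha> p)" for x
    by (auto simp: Wulff_shape_def \<Phi>)
  show "Wulff_shape \<N> \<alpha> c \<subseteq> cball 0 (c * M)"
  proof
    fix x assume x: "x \<in> Wulff_shape \<N> \<alpha> c"
    show "x \<in> cball 0 (c * M)"
    proof (cases "x = 0")
      case True
      obtain e :: "real^'n" where "norm e = 1" using vector_choose_size[of 1] by auto
      then have "0 \<le> M" using \<mu>(1) \<mu>(2,3)[of e] \<Phi>(2)[of e] by linarith
      then show ?thesis using True c by simp
    next
      case False
      then have "norm (x /\<^sub>R norm x) = 1" by simp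
      then have "x \<bullet> (x /\<^sub>R norm x) \<le> c * \<mu>\<alpha> \<N> \<alpha> (x /\<^sub>R norm x)" using x W by blast
      also have "\<dots> \<le> c * M" using False c by (intro mult_left_mono \<mu>) auto
      finally show ?thesis using False by (simp add: dot_square_norm power2_eq_square field_simps)
    qed
  qed
  show "cball 0 (c * m) \<subseteq> Wulff_shape \<N> \<alpha> c"
  proof
    fix x :: "real^'n" assume x: "x \<in> cball 0 (c * m)"
    have "x \<bullet> p \<le> c * \<mu>\<alpha> \<N> \<alpha> p" if "norm p = 1" for p
    proof -
      have "x \<bullet> p \<le> norm x" using norm_cauchy_schwarz[of x p] that by simp
      also have "\<dots> \<le> c * m" using x by simp
      also have "\<dots> \<le> c * \<mu>\<alpha> \<N> \<alpha> p" using c \<Phi>(2)[OF that] by (intro mult_left_mono \<mu>) auto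
      finally show ?thesis .
    qed
    then show "x \<in> Wulff_shape \<N> \<alpha> c" using W by blast
  qed
  assume s: "0 \<le> s" and x: "\<And>p. norm p = 1 \<Longrightarrow> x \<bullet> p \<le> c * \<mu>\<alpha> \<N> \<alpha> p + s"
  let ?k = "1 + s / (c * m)"
  have k: "1 \<le> ?k" using s c \<mu>(1) by simp
  have "(x /\<^sub>R ?k) \<bullet> p \<le> c * \<mu>\<alpha> \<N> \<alpha> p" if "norm p = 1" for p
  proof -
    have "c * m \<le> c * \<mu>\<alpha> \<N> \<alpha> p" using c \<Phi>(2)[OF that] by (intro mult_left_mono \<mu>) auto
    then have "s / (c * m) * (c * m) \<le> s / (c * m) * (c * \<mu>\<alpha> \<N> \<alpha> p)"
      using s c \<mu>(1) by (intro mult_left_mono) auto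
    then have "x \<bullet> p \<le> ?k * (c * \<mu>\<alpha> \<N> \<alpha> p)" using x[OF that] c \<mu>(1) by (simp add: algebra_simps)
    then have "inverse ?k * (x \<bullet> p) \<le> inverse ?k * (?k * (c * \<mu>\<alpha> \<N> \<alpha> p))"
      using k by (intro mult_left_mono) auto
    then show ?thesis using k by (simp add: mult.assoc[symmetric])
  qed
  then show "x /\<^sub>R ?k \<in> Wulff_shape \<N> \<alpha> c" using W by blast
qed

text \<open>Along each ray, the function \<open>f\<close> changes sign between \<open>(1 - \<eta>) y\<close> and \<open>(1 + \<eta>) y\<close> for \<open>y\<close> in the frontier.\<close>

lemma hausdorff_distance_zero_set_le:
  fixes W :: "(real^'n) set" and f :: "real^'n \<Rightarrow> real"
  assumes W: "closed W" "convex W" "cball 0 k \<subseteq> W" "0 < k" "W \<subseteq> cball 0 B" and r: "0 < r"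
    and \<eta>: "0 < \<eta>" "\<eta> * B \<le> r" "\<eta> < 1" and \<epsilon>: "0 < \<epsilon>" "\<epsilon> \<le> r" "\<epsilon> < \<eta> * k"
    and cont: "continuous_on UNIV f"
    and inner: "\<And>x. x \<in> W \<Longrightarrow> \<epsilon> < infdist x (frontier W) \<Longrightarrow> 0 < f x"
    and outer: "\<And>x. 0 \<le> f x \<Longrightarrow> infdist x W < \<epsilon>"
  shows "hausdorff_distance {x. f x = 0} (frontier W) \<le> ennreal r"
proof -
  have W0: "0 \<in> W" using W(3,4) by auto
  have "W \<noteq> UNIV" using W(5) bounded_subset[OF bounded_cball] not_bounded_UNIV by metis
  then have fne: "frontier W \<noteq> {}" using W0 frontier_eq_empty[of W] by blast
  have "\<exists>y\<in>frontier W. dist x y \<le> r" if x: "f x = 0" for x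
  proof (cases "x \<in> W")
    case True
    then have "infdist x (frontier W) \<le> \<epsilon>" using inner[of x] x by force
    moreover obtain y where "y \<in> frontier W" "infdist x (frontier W) = dist x y"
      using infdist_attains_inf[OF frontier_closed fne] by metis
    ultimately show ?thesis using \<epsilon> by force
  next
    case False
    obtain y where y: "y \<in> W" "infdist x W = dist x y"
      using infdist_attains_inf[OF W(1)] W0 by blast
    obtain z where "z \<in> frontier W" "dist x z \<le> dist y x"
      using closed_segment_meets_frontier[OF y(1) False] by metis
    then show ?thesis using y(2) outer[of x] x \<epsilon> by (force simp: dist_commute)
  qed
  moreover have "\<exists>x\<in>{x. f x = 0}. dist x y \<le> r" if y: "y \<in> frontier W" for y
  proof -
    have yW: "y \<in> W" using y W(1) by (simp add: frontier_def closure_closed)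
    have yB: "norm y \<le> B" using yW W(5) by auto
    have yI: "y \<notin> interior W" using y by (simp add: frontier_def)
    \<comment> \<open>By convexity the ball of radius \<open>k\<close> about 0, contracted by
      \<open>\<eta>\<close> and moved to \<open>(1 - \<eta>) *\<^sub>R y\<close>, stays in
      \<open>W\<close>.\<close>
    have "ball ((1 - \<eta>) *\<^sub>R y) (\<eta> * k) \<subseteq> W"
    proof
      fix z assume z: "z \<in> ball ((1 - \<eta>) *\<^sub>R y) (\<eta> * k)"
      define b where "b = (z - (1 - \<eta>) *\<^sub>R y) /\<^sub>R \<eta>"
      have "norm b = dist ((1 - \<eta>) *\<^sub>R y) z / \<eta>"
        using \<eta> by (simp add: b_def dist_norm norm_minus_commute divide_inverse_commute)
      then have "norm b \<le> k" using z \<eta> by (simp add: pos_divide_le_eq mult.commute)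
      then have "b \<in> W" using W(3) by auto
      then have "(1 - \<eta>) *\<^sub>R y + \<eta> *\<^sub>R b \<in> W" using \<eta> by (intro convexD_alt W yW) auto
      then show "z \<in> W" using \<eta> by (simp add: b_def)
    qed
    then have in1: "\<eta> * k \<le> infdist ((1 - \<eta>) *\<^sub>R y) (frontier W)"
      by (rule infdist_ge_if_ball_subset_interior[OF _ fne])
    have "(1 - \<eta>) *\<^sub>R y + \<eta> *\<^sub>R 0 \<in> W" using \<eta> by (intro convexD_alt W yW W0) auto
    then have pos: "0 < f ((1 - \<eta>) *\<^sub>R y)" using in1 \<epsilon> by (intro inner) auto
    have "\<eta> * k \<le> infdist ((1 + \<eta>) *\<^sub>R y) W"
    proof -
      have "W \<noteq> {}" using W0 by blast
      show ?thesis unfolding infdist_notempty[OF \<open>W \<noteq> {}\<close>]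
      proof (rule cINF_greatest[OF \<open>W \<noteq> {}\<close>], rule ccontr)
        \<comment> \<open>If \<open>w\<close> were that close, the averages of \<open>w\<close> and
          the ball about 0 with weights \<open>1 / (1 + \<eta>)\<close> and
          \<open>\<eta> / (1 + \<eta>)\<close> would form a ball in \<open>W\<close> containing
          \<open>y\<close>, and \<open>y\<close> would be interior.\<close>
        fix w assume w: "w \<in> W" and "\<not> \<eta> * k \<le> dist ((1 + \<eta>) *\<^sub>R y) w"
        then have d: "dist ((1 + \<eta>) *\<^sub>R y) w < \<eta> * k" by simp
        let ?q = "1 / (1 + \<eta>)"
        have "ball (?q *\<^sub>R w) (\<eta> * k * ?q) \<subseteq> W"
        proof
          fix z assume z: "z \<in> ball (?q *\<^sub>R w) (\<eta> * k * ?q)"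
          define b where "b = ((1 + \<eta>) / \<eta>) *\<^sub>R (z - ?q *\<^sub>R w)"
          have "norm b = ((1 + \<eta>) / \<eta>) * dist (?q *\<^sub>R w) z" using \<eta>
            by (simp add: b_def dist_norm norm_minus_commute)
          also have "\<dots> \<le> ((1 + \<eta>) / \<eta>) * (\<eta> * k * ?q)" using z \<eta> by (intro mult_left_mono) auto
          also have "\<dots> = k"
          proof -
            have "\<eta> \<noteq> 0" "1 + \<eta> \<noteq> 0" using \<eta> by auto
            then show ?thesis by simp
          qed
          finally have "b \<in> W" using W(3) by auto
          then have "(1 - \<eta> / (1 + \<eta>)) *\<^sub>R w + (\<eta> / (1 + \<eta>)) *\<^sub>R b \<in> W" using \<eta> by (intro convexD_alt W w) auto
          moreover have "1 - \<eta> / (1 + \<eta>) = ?q" using \<eta> by (simp add: field_simps)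
          ultimately show "z \<in> W" using \<eta> by (simp add: b_def)
        qed
        moreover have "y \<in> ball (?q *\<^sub>R w) (\<eta> * k * ?q)"
        proof -
          have "1 + \<eta> \<noteq> 0" using \<eta> by auto
          then have "y - ?q *\<^sub>R w = ?q *\<^sub>R ((1 + \<eta>) *\<^sub>R y - w)" by (simp add: scaleR_diff_right)
          then have "norm (y - ?q *\<^sub>R w) = ?q * dist ((1 + \<eta>) *\<^sub>R y) w" using \<eta> by (simp add: dist_norm)
          also have "\<dots> < ?q * (\<eta> * k)" using d \<eta> by (intro mult_strict_left_mono) auto
          finally show ?thesis by (simp add: dist_norm norm_minus_commute mult.commute)
        qed
        ultimately show False using yI by (meson interiorI open_ball)
      qed
    qed
    then have neg: "f ((1 + \<eta>) *\<^sub>R y) < 0" using outer[of "(1 + \<eta>) *\<^sub>R y"] \<epsilon> by force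
    have "\<exists>s\<ge>1 - \<eta>. s \<le> 1 + \<eta> \<and> f (s *\<^sub>R y) = 0"
      using pos neg \<eta>
      by (intro IVT2' continuous_on_compose2[OF cont] continuous_intros) auto
    then obtain s where s: "1 - \<eta> \<le> s" "s \<le> 1 + \<eta>" "f (s *\<^sub>R y) = 0" by blast
    have "dist (s *\<^sub>R y) y = norm ((s - 1) *\<^sub>R y)" by (simp add: dist_norm algebra_simps)
    also have "\<dots> = \<bar>s - 1\<bar> * norm y" by simp
    also have "\<dots> \<le> \<eta> * B" using s \<eta> yB by (intro mult_mono) auto
    finally show ?thesis using s(3) \<eta>(2) by (intro bexI[of _ "s *\<^sub>R y"]) auto
  qed
  ultimately show ?thesis unfolding hausdorff_distance_def using r by (intro INF_lower) auto
qed

section \<open>Uniform thresholds in time and the Hausdorff limit\<close>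

lemma ennreal_tendsto_zeroI:
  fixes f :: "'b \<Rightarrow> ennreal"
  assumes "\<And>r. 0 < r \<Longrightarrow> \<forall>\<^sub>F t in F. f t \<le> ennreal r"
  shows "(f \<longlongrightarrow> 0) F"
proof (rule order_tendstoI)
  fix a :: ennreal assume "0 < a"
  then obtain b where b: "0 < b" "b < a" using dense by blast
  then obtain r where r: "b = ennreal r" "0 \<le> r" by (cases b) auto
  then have "\<forall>\<^sub>F t in F. f t \<le> ennreal r" using b by (intro assms) auto
  then show "\<forall>\<^sub>F t in F. f t < a" using b r by (auto elim!: eventually_mono)
qed auto

theorem theorem8p1:
  fixes \<N> :: "real^'n \<Rightarrow> real" and \<alpha> c :: real
  assumes "CARD('n) \<ge> 2" and "is_norm \<N>" and "1 \<le> \<alpha>" and "\<alpha> < 2" and "c > 0"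
  defines "W \<equiv> Wulff_shape \<N> \<alpha> c"
  shows "\<exists>R>0. \<forall>\<Omega>0 :: (real^'n) set.
           open \<Omega>0 \<and> bounded \<Omega>0 \<and> ball 0 R \<subseteq> \<Omega>0 \<longrightarrow>
             (\<forall>\<epsilon>>0. \<exists>T>0. \<forall>Xs Os. generalized_evolution \<N> \<alpha> c \<Omega>0 Xs Os \<longrightarrow>
                (\<forall>t\<ge>T. {x \<in> W. infdist x (frontier W) > \<epsilon>} \<subseteq> (\<lambda>x. x /\<^sub>R t) ` Os t \<and>
                        (\<lambda>x. x /\<^sub>R t) ` Xs t \<subseteq> {x. infdist x W < \<epsilon>})) \<and>
             (\<forall>Xs Os. generalized_evolution \<N> \<alpha> c \<Omega>0 Xs Os \<longrightarrow>
                ((\<lambda>t. hausdorff_distance ((\<lambda>x. x /\<^sub>R t) ` (Xs t - Os t)) (frontier W))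
                   \<longlongrightarrow> 0) at_top)"
proof -
  obtain m M where \<mu>: "0 < m" "\<And>p. p \<noteq> 0 \<Longrightarrow> m \<le> \<mu>\<alpha> \<N> \<alpha> p" "\<And>p. p \<noteq> 0 \<Longrightarrow> \<mu>\<alpha> \<N> \<alpha> p \<le> M"
    using \<mu>\<alpha>_bounds[OF assms(2,3)] by metis
  obtain C where C: "0 < C" "\<And>q. norm q = 1 \<Longrightarrow> \<bar>trace (A_matrix \<N> \<alpha> q)\<bar> \<le> C"
    using trace_A_matrix_bound[OF assms(2,1)] by metis
  have c: "0 < c" using assms by simp
  obtain e :: "real^'n" where "norm e = 1" using vector_choose_size[of 1] by auto
  then have "e \<noteq> 0" by auto
  then have mM: "m \<le> M" using \<mu>(2,3)[of e] by linarith
  have \<mu>1: "m \<le> \<mu>\<alpha> \<N> \<alpha> p" "\<mu>\<alpha> \<N> \<alpha> p \<le> M" "0 \<le> \<mu>\<alpha> \<N> \<alpha> p" if "norm p = 1" for p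
  proof -
    have "p \<noteq> 0" using that by auto
    then show "m \<le> \<mu>\<alpha> \<N> \<alpha> p" "\<mu>\<alpha> \<N> \<alpha> p \<le> M" "0 \<le> \<mu>\<alpha> \<N> \<alpha> p" using \<mu>(1) \<mu>(2,3)[of p] by linarith+
  qed
  define k where "k = c * m"
  define B where "B = c * M"
  have k: "0 < k" and B: "0 < B" using c \<mu>(1) mM by (auto simp: k_def B_def)
  have W: "closed W" "convex W" "cball 0 k \<subseteq> W" "W \<subseteq> cball 0 B"
    unfolding W_def k_def B_def
    by (rule closed_Wulff_shape[OF \<mu> c] convex_Wulff_shape[OF \<mu> c] ball_subset_Wulff_shape[OF \<mu> c]
        Wulff_shape_subset_cball[OF \<mu> c]; assumption)+
  \<comment> \<open>More than twice \<open>C / c\<close>, the radius at which the curvature bound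
    balances the forcing. The open ball of radius \<open>R0 + 1\<close> contains the closed ball of
    radius \<open>R0\<close> from which the barrier starts.\<close>
  define R0 where "R0 = 2 * C / c + 1"
  have R0: "0 < R0" "2 * C / c \<le> R0" using C c by (auto simp: R0_def add_pos_pos)
  have main: "\<exists>T>0. \<forall>Xs Os. generalized_evolution \<N> \<alpha> c \<Omega>0 Xs Os \<longrightarrow>
                (\<forall>t\<ge>T. {x \<in> W. infdist x (frontier W) > \<epsilon>} \<subseteq> (\<lambda>x. x /\<^sub>R t) ` Os t \<and>
                        (\<lambda>x. x /\<^sub>R t) ` Xs t \<subseteq> {x. infdist x W < \<epsilon>})"
    if \<Omega>: "bounded \<Omega>0" "ball 0 (R0 + 1) \<subseteq> \<Omega>0" and \<epsilon>: "0 < \<epsilon>" for \<Omega>0 :: "(real^'n) set" and \<epsilon>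
  proof -
    obtain Rb where Rb: "0 < Rb" "closure \<Omega>0 \<subseteq> cball 0 Rb"
      using bounded_closure[OF \<Omega>(1)] by (auto simp: bounded_pos subset_iff)
    \<comment> \<open>This ensures \<open>B / (B + \<epsilon>) < 1 - \<delta>/2\<close>. For a speed
      factor \<open>\<sigma>\<close> above \<open>B / (B + \<epsilon>)\<close>, replacing
      \<open>x\<close> by \<open>x /\<^sub>R \<sigma>\<close> moves it by at most
      \<open>(1 / \<sigma> - 1) * B \<le> \<epsilon>\<close>.\<close>
    define \<delta> where "\<delta> = min 1 (\<epsilon> / (B + \<epsilon>))"
    have \<delta>: "0 < \<delta>" "\<delta> \<le> 1" using \<epsilon> B by (auto simp: \<delta>_def)
    define \<beta> where "\<beta> = m * c * \<delta> / 2"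
    have \<beta>: "0 < \<beta>" using \<mu>(1) c \<delta> by (simp add: \<beta>_def)
    define g where "g t = (1 - \<delta>/2) * t - C / (c * \<beta>) * (ln (R0 + \<beta> * t) - ln R0)" for t
    have "((\<lambda>t. g t / t) \<longlongrightarrow> 1 - \<delta>/2) at_top"
      unfolding g_def by (rule moving_ball_speed_tendsto[OF \<beta>])
    moreover have "B / (B + \<epsilon>) < 1 - \<delta>/2"
    proof -
      have "\<delta> \<le> \<epsilon> / (B + \<epsilon>)" by (simp add: \<delta>_def)
      moreover have "B / (B + \<epsilon>) + \<epsilon> / (B + \<epsilon>) = 1" using B \<epsilon> by (simp add: add_divide_distrib[symmetric])
      ultimately show ?thesis using \<delta> by linarith
    qed
    ultimately have "\<forall>\<^sub>F t in at_top. B / (B + \<epsilon>) < g t / t \<and> g t / t < 1"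
      using \<delta> by (intro eventually_conj order_tendstoD) auto
    then obtain T1 where T1: "\<And>t. T1 \<le> t \<Longrightarrow> B / (B + \<epsilon>) < g t / t" "\<And>t. T1 \<le> t \<Longrightarrow> g t / t < 1"
      unfolding eventually_at_top_linorder by blast
    \<comment> \<open>The last entry makes the excess \<open>Rb * B / (k * t)\<close> of the upper
      bound smaller than \<open>\<epsilon>\<close>. No function \<open>u\<close> enters the choice,
      so \<open>T\<close> serves all evolutions of the same set.\<close>
    define T where "T = max (max T1 1) (Rb * B / (k * \<epsilon>) + 1)"
    have T: "T1 \<le> T" "1 \<le> T" "Rb * B / (k * \<epsilon>) < T" by (auto simp: T_def)
    show ?thesis
    proof (intro exI[of _ T] conjI allI impI)
      show "0 < T" using T by simp
      fix Xs Os t assume ge: "generalized_evolution \<N> \<alpha> c \<Omega>0 Xs Os" and t: "T \<le> t"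
      then obtain u0 u where u: "\<Omega>0 = {x. u0 x > 0}" "frontier \<Omega>0 = {x. u0 x = 0}"
        "viscosity_solution \<N> \<alpha> c u" "\<And>x. u (x, 0) = u0 x"
        and Xs: "\<And>t. 0 \<le> t \<Longrightarrow> Xs t = {x. u (x, t) > 0} \<union> {x. u (x, t) = 0}"
        and Os: "\<And>t. 0 \<le> t \<Longrightarrow> Os t = {x. u (x, t) > 0}"
        unfolding generalized_evolution_def by auto
      have vs: "continuous_on closed_halfspace u" "viscosity_subsolution \<N> \<alpha> c u" "viscosity_supersolution \<N> \<alpha> c u"
        using u(3) by (auto simp: viscosity_solution_def)
      have t0: "0 < t" using T t by simp
      show "{x \<in> W. infdist x (frontier W) > \<epsilon>} \<subseteq> (\<lambda>x. x /\<^sub>R t) ` Os t"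
      proof
        fix x assume "x \<in> {x \<in> W. infdist x (frontier W) > \<epsilon>}"
        then have x: "x \<in> W" "cball x \<epsilon> \<subseteq> W" using ball_subset_if_infdist_frontier by auto
        define \<sigma> where "\<sigma> = g t / t"
        have \<sigma>: "B / (B + \<epsilon>) < \<sigma>" "\<sigma> < 1" using T1[of t] T t by (auto simp: \<sigma>_def)
        have "0 < B / (B + \<epsilon>)" using B \<epsilon> by simp
        then have \<sigma>0: "0 < \<sigma>" using \<sigma> by linarith
        \<comment> \<open>Aiming at \<open>v\<close> instead of \<open>x\<close> compensates the
          loss of speed: at time \<open>t\<close> the centre of the ball is exactly
          \<open>t *\<^sub>R x\<close>.\<close>
        define v where "v = x /\<^sub>R \<sigma>"
        have "x - v = (1 - inverse \<sigma>) *\<^sub>R x" by (simp add: v_def algebra_simps)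
        then have "dist x v = \<bar>1 - inverse \<sigma>\<bar> * norm x" by (simp add: dist_norm)
        also have "\<dots> = (inverse \<sigma> - 1) * norm x" using \<sigma> \<sigma>0 by (simp add: field_simps)
        also have "\<dots> \<le> (inverse \<sigma> - 1) * B" using x(1) W(4) \<sigma> \<sigma>0 by (intro mult_left_mono) (auto simp: field_simps)
        also have "\<dots> \<le> \<epsilon>" using \<sigma> \<sigma>0 B \<epsilon> by (simp add: field_simps)
        finally have v: "v \<in> Wulff_shape \<N> \<alpha> c" using x(2) unfolding W_def by auto
        have "0 < u (g t *\<^sub>R v, t)"
          unfolding g_def \<beta>_def
        proof (rule supersolution_contains_moving_ball[OF \<mu>(1) \<mu>1(1) C c vs(1,3) R0(2) _ \<delta> v])
          fix y :: "real^'n" assume "norm y \<le> R0"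
          then have "y \<in> \<Omega>0" using \<Omega>(2) by (auto simp: subset_iff)
          then show "0 < u (y, 0)" using u(1,4) by simp
        qed (use t0 in auto)
        moreover have "g t = \<sigma> * t" using t0 by (simp add: \<sigma>_def)
        then have "g t *\<^sub>R v = t *\<^sub>R x" using \<sigma>0 by (simp add: v_def)
        ultimately have "t *\<^sub>R x \<in> Os t" using Os t0 by simp
        then show "x \<in> (\<lambda>x. x /\<^sub>R t) ` Os t" using t0 by (intro image_eqI[of _ _ "t *\<^sub>R x"]) auto
      qed
      show "(\<lambda>x. x /\<^sub>R t) ` Xs t \<subseteq> {x. infdist x W < \<epsilon>}"
      proof clarify
        fix x assume "x \<in> Xs t"
        then have x: "0 \<le> u (x, t)" using Xs[of t] t0 by auto
        have init: "u (y, 0) < 0" if "Rb < norm y" for y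
        proof -
          have "y \<notin> \<Omega>0" "y \<notin> frontier \<Omega>0" using that Rb(2) by (auto simp: closure_Un_frontier)
          then show ?thesis using u by (auto simp: not_less order.order_iff_strict)
        qed
        define z where "z = x /\<^sub>R t"
        \<comment> \<open>The initial radius \<open>Rb\<close> survives rescaling only as the error
          \<open>s\<close> in the support inequalities.\<close>
        define s where "s = Rb / t"
        have s: "0 \<le> s" using Rb t0 by (simp add: s_def)
        have "z \<bullet> p \<le> c * \<mu>\<alpha> \<N> \<alpha> p + s" if "norm p = 1" for p
        proof -
          have "x \<bullet> p \<le> c * \<mu>\<alpha> \<N> \<alpha> p * t + Rb"
            by (rule subsolution_planar_bound[OF \<mu>1(3,2) _ C c vs(1,2) init that _ x])
               (use t0 \<mu>(1) mM in auto)
          then show ?thesis using t0 by (simp add: z_def s_def field_simps)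
        qed
        then have zW: "z /\<^sub>R (1 + s / k) \<in> W"
          unfolding W_def k_def using s by (intro Wulff_shape_scaling[OF \<mu> c])
        have "0 \<le> s / k" using s k by simp
        have "dist z (z /\<^sub>R (1 + s / k)) = s / k * norm (z /\<^sub>R (1 + s / k))"
        proof -
          have "z - z /\<^sub>R (1 + s / k) = (s / k) *\<^sub>R (z /\<^sub>R (1 + s / k))"
          proof -
            have "z = (1 + s / k) *\<^sub>R (z /\<^sub>R (1 + s / k))" using \<open>0 \<le> s / k\<close> by simp
            then show ?thesis by (metis add_diff_cancel_left' scaleR_add_left scaleR_one)
          qed
          then show ?thesis using \<open>0 \<le> s / k\<close> by (simp only: dist_norm norm_scaleR abs_of_nonneg)
        qed
        also have "\<dots> \<le> s / k * B" using zW W(4) \<open>0 \<le> s / k\<close> by (intro mult_left_mono) auto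
        also have "\<dots> < \<epsilon>"
        proof -
          have "Rb * B / (k * \<epsilon>) < t" using T t by linarith
          then show ?thesis using k \<epsilon> t0 by (simp add: s_def field_simps)
        qed
        finally show "infdist (x /\<^sub>R t) W < \<epsilon>"
          using infdist_le[OF zW, of z] by (simp add: z_def)
      qed
    qed
  qed
  have lim: "((\<lambda>t. hausdorff_distance ((\<lambda>x. x /\<^sub>R t) ` (Xs t - Os t)) (frontier W)) \<longlongrightarrow> 0) at_top"
    if \<Omega>: "bounded \<Omega>0" "ball 0 (R0 + 1) \<subseteq> \<Omega>0" and ge: "generalized_evolution \<N> \<alpha> c \<Omega>0 Xs Os"
    for \<Omega>0 :: "(real^'n) set" and Xs Os
  proof (rule ennreal_tendsto_zeroI)
    fix r :: real assume r: "0 < r"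
    \<comment> \<open>The radial displacement \<open>\<eta> * B\<close> must stay within
      \<open>r\<close>; then \<open>\<epsilon>\<close> is taken below \<open>\<eta> * k\<close>, the
      clearance that the points \<open>(1 - \<eta>) *\<^sub>R y\<close> have from the frontier and
      the points \<open>(1 + \<eta>) *\<^sub>R y\<close> from \<open>W\<close>.\<close>
    define \<eta> where "\<eta> = min (1/2) (r / B)"
    have \<eta>: "0 < \<eta>" "\<eta> * B \<le> r" "\<eta> < 1" using r B by (auto simp: \<eta>_def min_def field_simps)
    define \<epsilon> where "\<epsilon> = min r (\<eta> * k / 2)"
    have \<epsilon>: "0 < \<epsilon>" "\<epsilon> \<le> r" "\<epsilon> < \<eta> * k" using r \<eta> k by (auto simp: \<epsilon>_def min_def)
    from main[OF \<Omega> \<epsilon>(1)] obtain T where T0: "0 < T" and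
        T1: "\<forall>Xs Os. generalized_evolution \<N> \<alpha> c \<Omega>0 Xs Os \<longrightarrow>
                (\<forall>t\<ge>T. {x \<in> W. infdist x (frontier W) > \<epsilon>} \<subseteq> (\<lambda>x. x /\<^sub>R t) ` Os t \<and>
                        (\<lambda>x. x /\<^sub>R t) ` Xs t \<subseteq> {x. infdist x W < \<epsilon>})"
      by (elim exE conjE)
    note T = T0 T1[rule_format, OF ge, THEN conjunct1] T1[rule_format, OF ge, THEN conjunct2]
    obtain u0 u where sol: "viscosity_solution \<N> \<alpha> c u" "\<And>x. u (x, 0) = u0 x"
        and Xs: "\<And>t. 0 \<le> t \<Longrightarrow> Xs t = {x. u (x, t) > 0} \<union> {x. u (x, t) = 0}"
        and Os: "\<And>t. 0 \<le> t \<Longrightarrow> Os t = {x. u (x, t) > 0}"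
      using ge unfolding generalized_evolution_def by auto
    have u: "continuous_on closed_halfspace u" using sol(1) by (simp add: viscosity_solution_def)
    have "hausdorff_distance ((\<lambda>x. x /\<^sub>R t) ` (Xs t - Os t)) (frontier W) \<le> ennreal r" if t: "T \<le> t" for t
    proof -
      have t0: "0 < t" using T t by simp
      define f where "f x = u (t *\<^sub>R x, t)" for x
      have im: "x \<in> (\<lambda>x. x /\<^sub>R t) ` S \<longleftrightarrow> t *\<^sub>R x \<in> S" for x :: "real^'n" and S
        using t0 by (auto intro!: image_eqI[of _ _ "t *\<^sub>R x"])
      have "(\<lambda>x. x /\<^sub>R t) ` (Xs t - Os t) = {x. f x = 0}"
        using Xs[of t] Os[of t] t0 by (auto simp: set_eq_iff im f_def)
      moreover have "hausdorff_distance {x. f x = 0} (frontier W) \<le> ennreal r"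
      proof (rule hausdorff_distance_zero_set_le[OF W(1-3) k W(4) r \<eta> \<epsilon>])
        show "continuous_on UNIV f" unfolding f_def
          using t0 by (intro continuous_on_compose2[OF u] continuous_intros) auto
        show "0 < f x" if "x \<in> W" "\<epsilon> < infdist x (frontier W)" for x
        proof -
          have "x \<in> {x \<in> W. \<epsilon> < infdist x (frontier W)}" using that by simp
          then have "x \<in> (\<lambda>x. x /\<^sub>R t) ` Os t" by (rule subsetD[OF T(2)[OF t]])
          then show ?thesis using Os[of t] t0 by (simp add: im f_def)
        qed
        show "infdist x W < \<epsilon>" if "0 \<le> f x" for x
        proof -
          have "0 < u (t *\<^sub>R x, t) \<or> u (t *\<^sub>R x, t) = 0" using that unfolding f_def by linarith
          then have "t *\<^sub>R x \<in> Xs t" unfolding Xs[OF less_imp_le[OF t0]] by simp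
          then have "x \<in> (\<lambda>x. x /\<^sub>R t) ` Xs t" by (simp add: im)
          then have "x \<in> {x. infdist x W < \<epsilon>}" by (rule subsetD[OF T(3)[OF t]])
          then show ?thesis by simp
        qed
      qed
      ultimately show ?thesis by simp
    qed
    then show "\<forall>\<^sub>F t in at_top. hausdorff_distance ((\<lambda>x. x /\<^sub>R t) ` (Xs t - Os t)) (frontier W) \<le> ennreal r"
      unfolding eventually_at_top_linorder by blast
  qed
  show ?thesis
    using R0(1) main lim by (intro exI[of _ "R0 + 1"]) auto
qed

end
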